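(* Let $G$ be a finite abelian group and $n\ge1$. For $\lambda\in\Lambda_n[\widehat{G}]$ define $$\mathfrak{f}_\lambda=\frac{1}{|G|^{\ell(\lambda)}\,\ell(\lambda)!}\sum_{\substack{\alpha\in\Gamma_n[\widehat{G}]\\ \mathsf{supp}(\alpha)=\lambda}}\ \sum_{\substack{p\in\Gamma_n[G]\\ |p|=|\alpha|}}\overline{\alpha(p)}\sum_{\substack{q\in\Gamma_n[G]\\ p\le q}}\frac{(-1)^{\ell(q)-\ell(p)}}{\deg(q/p)}X_q\ \in{\sf MR}_n[G].$$ Then $\{\mathfrak{f}_\lambda\}_{\lambda\in\Lambda_n[\widehat{G}]}$ is a complete system of primitive orthogonal idempotents of the Mantaci–Reutenauer algebra ${\sf MR}_n[G]$.
   Context: The wreath product $\mathfrak{S}_n[G]$ has elements $(\sigma,g)=((\sigma_1,g_1),\dots,(\sigma_n,g_n))$ with $\sigma\in\mathfrak{S}_n$ in one-line notation and $g_i\in G$, product $((\sigma_1,g_1),\dots)\cdot((\tau_1,h_1),\dots)=((\sigma_{\tau_1},g_{\tau_1}h_1),\dots,(\sigma_{\tau_n},g_{\tau_n}h_n))$. $\Gamma_n[G]$ is the set of tuples $p=((a_1,g_1),\dots,(a_k,g_k))$ of positive integers $a_i$ with $\sum a_i=n$ and $g_i\in G$; $\ell(p)=k$; $|p|=(a_1,\dots,a_k)$. $\mathrm{co}(\sigma,g)\in\Gamma_n[G]$ is the coarsest $((a_1,h_1),\dots,(a_k,h_k))$ such that on each consecutive segment of positions of lengths $a_1,a_2,\dots$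 the entries $\sigma_j$ increase and the $g_j$ all equal the corresponding $h_i$. Order on $\Gamma_n[G]$: $p\le q$ iff $q$ is obtained by splitting each part $(a,g)$ of $p$ into consecutive parts all labeled $g$; if part $i$ of $p$ is split into $d_i$ parts, $\deg(q/p)=\prod_i d_i$. $Y_p=\sum_{\mathrm{co}(\sigma,g)=p}(\sigma,g)$, $X_p=\sum_{q\le p}Y_q$ in $\mathbb{C}\mathfrak{S}_n[G]$; ${\sf MR}_n[G]$ is their span, a subalgebra of $\mathbb{C}\mathfrak{S}_n[G]$. $\widehat{G}=\mathrm{Hom}(G,\mathbb{C}^\times)$; $\Gamma_n[\widehat{G}]$ is defined like $\Gamma_n[G]$ with labels in $\widehat{G}$; $\Lambda_n[\widehat{G}]$ is the set of multisets $\{(a_i,\phi_i)\}$ with $\sum a_i=n$; $\mathsf{supp}:\Gamma_n[\widehat{G}]\to\Lambda_n[\widehat{G}]$ forgets the order; $\ell(\lambda)$ is the number of parts. For $\alpha=((a_i,\alpha_i))$ and $p=((a_i,g_i))$ with $|p|=|\alpha|$, $\alpha(p)=\prod_i\alpha_i(g_i)$, and the bar is complex conjugation. *)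

theory Defs
  imports Complex_Main "HOL-Algebra.Ring" "HOL-Library.Function_Algebras"
    "HOL-Library.Multiset" "HOL-Combinatorics.Multiset_Permutations"
begin

section \<open>Idempotents\<close>

definition primitive_idempotent :: "('a, 'm) ring_scheme \<Rightarrow> 'a \<Rightarrow> bool" where
  "primitive_idempotent R e \<longleftrightarrow>
     e \<in> carrier R \<and> e \<noteq> \<zero>\<^bsub>R\<^esub> \<and> e \<otimes>\<^bsub>R\<^esub> e = e \<and>
     \<not> (\<exists>a \<in> carrier R. \<exists>b \<in> carrier R.
          a \<noteq> \<zero>\<^bsub>R\<^esub> \<and> b \<noteq> \<zero>\<^bsub>R\<^esub> \<and>
          a \<otimes>\<^bsub>R\<^esub> a = a \<and> b \<otimes>\<^bsub>R\<^esub> b = b \<and>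
          a \<otimes>\<^bsub>R\<^esub> b = \<zero>\<^bsub>R\<^esub> \<and> b \<otimes>\<^bsub>R\<^esub> a = \<zero>\<^bsub>R\<^esub> \<and>
          e = a \<oplus>\<^bsub>R\<^esub> b)"

text \<open>Here completeness means that the idempotents sum to the identity.\<close>

definition complete_primitive_orthogonal_idempotents ::
    "('a, 'm) ring_scheme \<Rightarrow> 'i set \<Rightarrow> ('i \<Rightarrow> 'a) \<Rightarrow> bool" where
  "complete_primitive_orthogonal_idempotents R I e \<longleftrightarrow>
     finite I \<and>
     (\<forall>i\<in>I. primitive_idempotent R (e i)) \<and>
     (\<forall>i\<in>I. \<forall>j\<in>I. i \<noteq> j \<longrightarrow> e i \<otimes>\<^bsub>R\<^esub> e j = \<zero>\<^bsub>R\<^esub>) \<and>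
     (\<Oplus>\<^bsub>R\<^esub>i\<in>I. e i) = \<one>\<^bsub>R\<^esub>"

section \<open>Complex group algebras\<close>

text \<open>
  The algebra \<open>\<complex>W\<close> of a finite group \<open>W\<close> consists of the functions into \<open>\<complex>\<close> vanishing off
  \<open>carrier W\<close>; \<open>f\<close> stands for the formal sum of the \<open>f w \<cdot> w\<close>. Note that the pointwise product \<open>*\<close>
  on functions, which comes with the instances for pointwise addition, is not its multiplication.
\<close>

definition basis_elt :: "'w \<Rightarrow> 'w \<Rightarrow> complex" where
  "basis_elt w = (\<lambda>x. if x = w then 1 else 0)"

definition scale :: "complex \<Rightarrow> ('w \<Rightarrow> complex) \<Rightarrow> 'w \<Rightarrow> complex" where
  "scale c f = (\<lambda>x. c * f x)"

definition group_algebra :: "('w, 'm) monoid_scheme \<Rightarrow> ('w \<Rightarrow> complex) ring" where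
  "group_algebra W =
     \<lparr> carrier = {f. \<forall>x. x \<notin> carrier W \<longrightarrow> f x = 0},
       monoid.mult = (\<lambda>f h. \<Sum>u\<in>carrier W. \<Sum>v\<in>carrier W. scale (f u * h v) (basis_elt (u \<otimes>\<^bsub>W\<^esub> v))),
       one = basis_elt \<one>\<^bsub>W\<^esub>,
       zero = 0,
       add = (+) \<rparr>"

section \<open>The wreath product\<close>

text \<open>
  Permutations are in one-line notation with values in \<open>{1..n}\<close>, while list positions count
  from 0; hence the index \<open>t - 1\<close>.
\<close>

definition wreath :: "nat \<Rightarrow> ('g, 'm) monoid_scheme \<Rightarrow> (nat \<times> 'g) list monoid" where
  "wreath n G =
     \<lparr> carrier = {w. map fst w \<in> permutations_of_set {1..n} \<and> snd ` set w \<subseteq> carrier G},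
       monoid.mult = (\<lambda>u v. map (\<lambda>(t, h). (fst (u ! (t - 1)), snd (u ! (t - 1)) \<otimes>\<^bsub>G\<^esub> h)) v),
       one = map (\<lambda>i. (i, \<one>\<^bsub>G\<^esub>)) [1..<Suc n] \<rparr>"

section \<open>Labelled compositions and partitions\<close>

definition Gamma :: "nat \<Rightarrow> 'l set \<Rightarrow> (nat \<times> 'l) list set" where
  "Gamma n L = {p. (\<forall>(a, l) \<in> set p. 0 < a \<and> l \<in> L) \<and> sum_list (map fst p) = n}"

definition Lambda :: "nat \<Rightarrow> 'l set \<Rightarrow> (nat \<times> 'l) multiset set" where
  "Lambda n L = {M. (\<forall>(a, l) \<in> set_mset M. 0 < a \<and> l \<in> L) \<and> sum_mset (image_mset fst M) = n}"

text \<open>\<open>splitting p q qs\<close>: the i-th entry of \<open>qs\<close> is the block of \<open>q\<close> into which part i of \<open>p\<close> is split.\<close>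

definition splitting ::
    "(nat \<times> 'l) list \<Rightarrow> (nat \<times> 'l) list \<Rightarrow> (nat \<times> 'l) list list \<Rightarrow> bool" where
  "splitting p q qs \<longleftrightarrow>
     concat qs = q \<and>
     list_all2 (\<lambda>(a, l) b. sum_list (map fst b) = a \<and> (\<forall>x \<in> set b. snd x = l)) p qs"

definition refines :: "(nat \<times> 'l) list \<Rightarrow> (nat \<times> 'l) list \<Rightarrow> bool"  (infix \<open>\<preceq>\<close> 50) where
  "p \<preceq> q \<longleftrightarrow> (\<exists>qs. splitting p q qs)"

text \<open>For \<open>p \<preceq> q\<close> with positive parts the splitting is unique.\<close>

definition split_degree :: "(nat \<times> 'l) list \<Rightarrow> (nat \<times> 'l) list \<Rightarrow> nat" where
  "split_degree q p = prod_list (map length (THE qs. splitting p q qs))"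

section \<open>The Mantaci--Reutenauer algebra\<close>

text \<open>
  \<open>compatible w p\<close>: cutting \<open>w\<close> into consecutive segments of the lengths prescribed by \<open>p\<close>, the
  permutation entries increase on each segment and the group entries are constantly its label.
\<close>

definition compatible :: "(nat \<times> 'g) list \<Rightarrow> (nat \<times> 'g) list \<Rightarrow> bool" where
  "compatible w p \<longleftrightarrow>
     (\<exists>ws. concat ws = w \<and>
        list_all2 (\<lambda>(a, h) s. length s = a \<and> sorted_wrt (<) (map fst s) \<and> (\<forall>x \<in> set s. snd x = h))
          p ws)"

text \<open>Coarsest means least with respect to \<open>\<preceq>\<close>.\<close>

definition co :: "nat \<Rightarrow> ('g, 'm) monoid_scheme \<Rightarrow> (nat \<times> 'g) list \<Rightarrow> (nat \<times> 'g) list" where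
  "co n G w = (THE p. p \<in> Gamma n (carrier G) \<and> compatible w p \<and>
                 (\<forall>q \<in> Gamma n (carrier G). compatible w q \<longrightarrow> p \<preceq> q))"

definition Y :: "nat \<Rightarrow> ('g, 'm) monoid_scheme \<Rightarrow> (nat \<times> 'g) list \<Rightarrow> (nat \<times> 'g) list \<Rightarrow> complex" where
  "Y n G p = (\<Sum>w \<in> {w \<in> carrier (wreath n G). co n G w = p}. basis_elt w)"

definition X :: "nat \<Rightarrow> ('g, 'm) monoid_scheme \<Rightarrow> (nat \<times> 'g) list \<Rightarrow> (nat \<times> 'g) list \<Rightarrow> complex" where
  "X n G p = (\<Sum>q \<in> {q \<in> Gamma n (carrier G). q \<preceq> p}. Y n G q)"

definition MR :: "nat \<Rightarrow> ('g, 'm) monoid_scheme \<Rightarrow> ((nat \<times> 'g) list \<Rightarrow> complex) ring" where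
  "MR n G = (group_algebra (wreath n G))
     \<lparr> carrier := module.span scale (Y n G ` Gamma n (carrier G)) \<rparr>"

section \<open>Characters and the elements f\<close>

definition complex_units :: "complex monoid" where
  "complex_units = \<lparr> carrier = - {0}, monoid.mult = (*), one = 1 \<rparr>"

text \<open>
  Restricting to extensional functions makes homomorphisms equal iff they agree on \<open>carrier G\<close>.
\<close>

definition characters :: "('g, 'm) monoid_scheme \<Rightarrow> ('g \<Rightarrow> complex) set" where
  "characters G = hom G complex_units \<inter> extensional (carrier G)"

definition char_eval :: "(nat \<times> ('g \<Rightarrow> complex)) list \<Rightarrow> (nat \<times> 'g) list \<Rightarrow> complex" where
  "char_eval \<alpha> p = (\<Prod>i<length p. snd (\<alpha> ! i) (snd (p ! i)))"

definition f_elt :: "nat \<Rightarrow> ('g, 'm) monoid_scheme \<Rightarrow> (nat \<times> ('g \<Rightarrow> complex)) multiset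
    \<Rightarrow> (nat \<times> 'g) list \<Rightarrow> complex" where
  "f_elt n G M =
     scale (1 / (of_nat (card (carrier G)) ^ size M * fact (size M)))
       (\<Sum>\<alpha> \<in> {\<alpha> \<in> Gamma n (characters G). mset \<alpha> = M}.
          \<Sum>p \<in> {p \<in> Gamma n (carrier G). map fst p = map fst \<alpha>}.
            scale (cnj (char_eval \<alpha> p))
              (\<Sum>q \<in> {q \<in> Gamma n (carrier G). p \<preceq> q}.
                 scale ((-1) ^ (length q - length p) / of_nat (split_degree q p)) (X n G q)))"

end

theory Submission
  imports Defs "HOL-Computational_Algebra.Polynomial"
begin

text \<open>
  An element of the group algebra is a functional on labelled words, and right multiplication by
  \<open>X\<^sub>p\<close> sums a functional over the shuffles of the segments that \<open>p\<close> cuts out of a word. Dually to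
  the unshuffle coproduct, the indicator of increasing words labelled \<open>g\<close> is multiplicative on
  shuffles, so its convolution logarithm is primitive, that is, it vanishes on proper shuffles. The
  inner sums of \<open>f\<^sub>\<lambda>\<close> are exactly the convolution products of such logarithms. Twisted by characters,
  they give products \<open>I\<^sub>\<alpha>\<close> of primitives, and primitivity shows that \<open>I\<^sub>\<alpha> \<cdot> X\<^sub>p\<close> is a combination
  of the \<open>I\<^sub>\<beta>\<close> with \<open>\<beta>\<close> a rearrangement of \<open>\<alpha>\<close>. Hence the span \<open>M\<^sub>\<lambda>\<close> of the \<open>I\<^sub>\<alpha>\<close> of support
  \<open>\<lambda>\<close> is a right ideal. Moreover the sum of the \<open>M\<^sub>\<lambda>\<close> is direct, \<open>f\<^sub>\<lambda>\<close> lies in \<open>M\<^sub>\<lambda>\<close>, and the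
  identity \<open>exp \<circ> log = id\<close> gives \<open>1 = \<Sum> f\<^sub>\<lambda>\<close>. Comparing components in \<open>f\<^sub>\<mu> = \<Sum> f\<^sub>\<lambda> f\<^sub>\<mu>\<close> yields
  orthogonality and idempotency. Finally \<open>I\<^sub>\<alpha> f\<^sub>\<lambda>\<close> does not depend on the order of \<open>\<alpha>\<close>, so
  \<open>M\<^sub>\<lambda> f\<^sub>\<lambda>\<close> is one-dimensional, and \<open>f\<^sub>\<lambda>\<close> is primitive.
\<close>

section \<open>Functionals on words\<close>

text \<open>For fixed \<open>u\<close> the map N -> A^N u is polynomial in N. Identities are
  therefore proved for natural exponents, where they concern honest convolution powers, and then
  read off on coefficients; this replaces the manipulation of formal series for exp and log.
  Multiplicativity fails on words with repeated first entries, so the statements about products on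
  shuffles carry a distinctness hypothesis. Characters enter because multiplying by X_p strips a
  label h off a segment: this permutes the logarithms of the indicators, while their Fourier
  transforms in the label are eigenvectors. The constant comes from the sum over all \<phi>: each
  part contributes a factor |G| and forces its label to be 1. After division by |G|^l l! the sum
  over all \<alpha> is exp(log A) for A the indicator of increasing words labelled 1, which among
  elements of the wreath product selects the identity. Directness rests on two triangular changes of
  basis (words against compositions, logarithms against the X_q) followed by Fourier
  inversion.\<close>

fun shuf_sum :: "('a list \<Rightarrow> 'b::comm_monoid_add) \<Rightarrow> 'a list \<Rightarrow> 'a list \<Rightarrow> 'b" where
  "shuf_sum F [] t = F t"
| "shuf_sum F (x # s) [] = F (x # s)"
| "shuf_sum F (x # s) (y # t) = shuf_sum (\<lambda>u. F (x # u)) s (y # t) + shuf_sum (\<lambda>u. F (y # u)) (x # s) t"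

lemma shuf_sum_Nil2 [simp]: "shuf_sum F s [] = F s"
  by (cases s) auto

lemma shuf_sum_cong:
  assumes "\<And>u. mset u = mset s + mset t \<Longrightarrow> F u = F' u"
  shows "shuf_sum F s t = shuf_sum F' s t"
  using assms
proof (induction F s t arbitrary: F' rule: shuf_sum.induct)
  case (3 F x s y t)
  have "shuf_sum (\<lambda>u. F (x # u)) s (y # t) = shuf_sum (\<lambda>u. F' (x # u)) s (y # t)"
    by (rule 3(1)) (use 3(3) in auto)
  moreover have "shuf_sum (\<lambda>u. F (y # u)) (x # s) t = shuf_sum (\<lambda>u. F' (y # u)) (x # s) t"
    by (rule 3(2)) (use 3(3) in auto)
  ultimately show ?case by simp
qed auto

lemma shuf_sum_add: "shuf_sum (\<lambda>u. F u + F' u) s t = shuf_sum F s t + shuf_sum F' s t"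
proof (induction F s t arbitrary: F' rule: shuf_sum.induct)
  case (3 F x s y t)
  then show ?case
    using 3(1)[of "\<lambda>u. F' (x # u)"] 3(2)[of "\<lambda>u. F' (y # u)"] by (simp add: add_ac)
qed auto

text \<open>Besides scalars, \<open>h\<close> will be evaluation at a natural number and extraction
  of a coefficient, which carry shuffle sums of polynomial-valued functionals to complex
  ones.\<close>

lemma shuf_sum_hom:
  assumes "\<And>a b. h (a + b) = h a + h b"
  shows "shuf_sum (\<lambda>u. h (F u)) s t = h (shuf_sum F s t)"
  by (induction F s t rule: shuf_sum.induct) (auto simp: assms)

lemma shuf_sum_cmult: "shuf_sum (\<lambda>u. c * F u) s t = (c :: 'b :: semiring_0) * shuf_sum F s t"
  by (rule shuf_sum_hom) (rule distrib_left)

lemma shuf_sum_zero: "shuf_sum (\<lambda>u. 0) s t = 0"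
  using shuf_sum_hom[of "\<lambda>_. 0" "\<lambda>_. 0" s t] by simp

lemma shuf_sum_sum: "shuf_sum (\<lambda>u. \<Sum>i\<in>A. F i u) s t = (\<Sum>i\<in>A. shuf_sum (F i) s t)"
  by (induction A rule: infinite_finite_induct) (auto simp: shuf_sum_zero shuf_sum_add)

section \<open>Convolution, the product dual to deconcatenation\<close>

fun conv :: "('a list \<Rightarrow> 'b::comm_semiring_1) \<Rightarrow> ('a list \<Rightarrow> 'b) \<Rightarrow> 'a list \<Rightarrow> 'b" where
  "conv A B [] = A [] * B []"
| "conv A B (x # u) = A [] * B (x # u) + conv (\<lambda>v. A (x # v)) B u"

lemma conv_sum: "conv A B u = (\<Sum>i\<le>length u. A (take i u) * B (drop i u))"
  by (induction u arbitrary: A) (auto simp: sum.atMost_Suc_shift simp del: sum.atMost_Suc)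

lemma conv_add_left: "conv (\<lambda>v. A v + A' v) B u = conv A B u + conv A' B u"
  by (simp add: conv_sum algebra_simps sum.distrib)

lemma conv_cmult_left: "conv (\<lambda>v. c * A v) B u = c * conv A B u"
  by (simp add: conv_sum algebra_simps sum_distrib_left)

lemma conv_assoc: "conv (conv A B) C u = conv A (conv B C) u"
proof (induction u arbitrary: A)
  case (Cons x u)
  have "(\<lambda>v. conv A B (x # v)) = (\<lambda>v. A [] * B (x # v) + conv (\<lambda>v. A (x # v)) B v)"
    by auto
  then show ?case
    using Cons[of "\<lambda>v. A (x # v)"] by (simp add: conv_add_left conv_cmult_left algebra_simps)
qed (simp add: algebra_simps)

lemma sum_atMost_Suc_shift2:
  fixes T :: "nat \<Rightarrow> nat \<Rightarrow> 'b::comm_monoid_add"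
  shows "(\<Sum>i\<le>Suc m. \<Sum>j\<le>Suc n. T i j) = T 0 0 + (\<Sum>j\<le>n. T 0 (Suc j)) +
    ((\<Sum>i\<le>m. T (Suc i) 0) + (\<Sum>i\<le>m. \<Sum>j\<le>n. T (Suc i) (Suc j)))"
  by (simp add: sum.atMost_Suc_shift sum.distrib add_ac del: sum.atMost_Suc)

text \<open>Shuffling is compatible with deconcatenation: to cut a shuffle of \<open>s\<close> and
  \<open>t\<close> in two is to cut \<open>s\<close> and \<open>t\<close> separately and to shuffle
  the two left and the two right pieces.\<close>

lemma shuf_sum_conv:
  "shuf_sum (conv A B) s t =
     (\<Sum>i\<le>length s. \<Sum>j\<le>length t. shuf_sum A (take i s) (take j t) * shuf_sum B (drop i s) (drop j t))"
proof (induction A s t rule: shuf_sum.induct)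
  case (3 A x s y t)
  \<comment> \<open>\<open>P\<close> collects the cuts whose left piece begins with
    \<open>x\<close>, \<open>Q\<close> those whose left piece begins with \<open>y\<close>; the
    empty left piece is the separate term with \<open>A []\<close>.\<close>
  define P where "P i j = shuf_sum (\<lambda>u. A (x # u)) (take i s) (take j (y # t)) * shuf_sum B (drop i s) (drop j (y # t))" for i j
  define Q where "Q i j = shuf_sum (\<lambda>u. A (y # u)) (take i (x # s)) (take j t) * shuf_sum B (drop i (x # s)) (drop j t)" for i j
  let ?T = "\<lambda>i j. shuf_sum A (take i (x # s)) (take j (y # t)) * shuf_sum B (drop i (x # s)) (drop j (y # t))"
  have "shuf_sum (conv A B) (x # s) (y # t) = A [] * shuf_sum B (x # s) (y # t)
      + (\<Sum>i\<le>length s. \<Sum>j\<le>length (y # t). P i j) + (\<Sum>i\<le>length (x # s). \<Sum>j\<le>length t. Q i j)"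
    using 3 by (simp add: shuf_sum_add shuf_sum_cmult P_def Q_def algebra_simps)
  also have "\<dots> = A [] * shuf_sum B (x # s) (y # t)
      + ((\<Sum>i\<le>length s. P i 0) + (\<Sum>i\<le>length s. \<Sum>j\<le>length t. P i (Suc j)))
      + ((\<Sum>j\<le>length t. Q 0 j) + (\<Sum>i\<le>length s. \<Sum>j\<le>length t. Q (Suc i) j))"
    by (simp add: sum.atMost_Suc_shift sum.distrib del: sum.atMost_Suc)
  also have "(\<Sum>i\<le>length s. P i 0) = (\<Sum>i\<le>length s. ?T (Suc i) 0)"
    by (simp add: P_def)
  also have "(\<Sum>j\<le>length t. Q 0 j) = (\<Sum>j\<le>length t. ?T 0 (Suc j))"
    by (simp add: Q_def)
  also have "A [] * shuf_sum B (x # s) (y # t) + ((\<Sum>i\<le>length s. ?T (Suc i) 0)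
        + (\<Sum>i\<le>length s. \<Sum>j\<le>length t. P i (Suc j)))
        + ((\<Sum>j\<le>length t. ?T 0 (Suc j)) + (\<Sum>i\<le>length s. \<Sum>j\<le>length t. Q (Suc i) j))
      = ?T 0 0 + (\<Sum>j\<le>length t. ?T 0 (Suc j)) + ((\<Sum>i\<le>length s. ?T (Suc i) 0)
        + (\<Sum>i\<le>length s. \<Sum>j\<le>length t. ?T (Suc i) (Suc j)))"
    by (simp add: P_def Q_def algebra_simps sum.distrib)
  also have "\<dots> = (\<Sum>i\<le>length (x # s). \<Sum>j\<le>length (y # t). ?T i j)"
    unfolding length_Cons by (rule sum_atMost_Suc_shift2[symmetric])
  finally show ?case .
qed (auto simp: conv_sum)

definition counit :: "'a list \<Rightarrow> 'b::zero_neq_one" where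
  "counit u = (if u = [] then 1 else 0)"

lemma counit_simps [simp]: "counit [] = 1" "counit (x # u) = 0"
  by (auto simp: counit_def)

lemma conv_counit_left [simp]: "conv counit B u = B u"
proof (cases u)
  case (Cons x u')
  have "conv (\<lambda>v. 0) B u' = 0" by (simp add: conv_sum)
  then show ?thesis by (simp add: Cons)
qed auto

lemma conv_counit_right [simp]: "conv A counit u = A u"
  by (induction u arbitrary: A) auto

lemma shuf_sum_counit: "shuf_sum counit s t = counit s * (counit t :: 'b :: semiring_1)"
  by (cases s; cases t) (auto simp: counit_def[abs_def] shuf_sum_zero)

section \<open>Increasing words with constant label\<close>

definition incr :: "'g \<Rightarrow> (nat \<times> 'g) list \<Rightarrow> bool" where
  "incr g s \<longleftrightarrow> sorted_wrt (<) (map fst s) \<and> (\<forall>x\<in>set s. snd x = g)"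

lemma incr_Nil [simp]: "incr g []"
  by (simp add: incr_def)

lemma incr_Cons: "incr g (x # s) \<longleftrightarrow> snd x = g \<and> (\<forall>z\<in>set s. fst x < fst z) \<and> incr g s"
  by (auto simp: incr_def)

text \<open>Two strictly increasing words without common letters have exactly one increasing
  shuffle, their merge, and subwords of increasing words increase. With repeated letters this fails:
  \<open>[x]\<close> and \<open>[x]\<close> increase, but no shuffle of them does.\<close>

lemma shuf_sum_incr:
  assumes "distinct (map fst (s @ t))"
  shows "shuf_sum (\<lambda>u. of_bool (incr g u)) s t = (of_bool (incr g s) * of_bool (incr g t) :: 'b :: comm_semiring_1)"
  using assms
proof (induction s t rule: shuffles.induct)
  case (3 x s y t)
  have A: "shuf_sum (\<lambda>u. of_bool (incr g (z # u)) :: 'b) s' t'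
    = of_bool (snd z = g \<and> (\<forall>v\<in>set s' \<union> set t'. fst z < fst v)) * shuf_sum (\<lambda>u. of_bool (incr g u)) s' t'"
    for z s' t'
    unfolding shuf_sum_cmult[symmetric]
    by (rule shuf_sum_cong) (auto simp: incr_Cons dest: mset_eq_setD simp flip: set_mset_mset)
  have *: "shuf_sum (\<lambda>u. of_bool (incr g u)) s (y # t) = (of_bool (incr g s) * of_bool (incr g (y # t)) :: 'b)"
    "shuf_sum (\<lambda>u. of_bool (incr g u)) (x # s) t = (of_bool (incr g (x # s)) * of_bool (incr g t) :: 'b)"
    using 3 by auto
  have "fst x \<noteq> fst y" using 3(3) by auto
  then show ?case
    unfolding shuf_sum.simps(3) A *
    by (cases "fst x < fst y") (auto simp: incr_Cons of_bool_def dest: less_trans)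
qed auto

section \<open>Convolution powers, their interpolation, and the logarithm\<close>

fun convpow :: "('a list \<Rightarrow> 'b::comm_semiring_1) \<Rightarrow> nat \<Rightarrow> 'a list \<Rightarrow> 'b" where
  "convpow A 0 = counit"
| "convpow A (Suc k) = conv A (convpow A k)"

lemma convpow_add: "convpow A (M + N) = conv (convpow A M) (convpow A N)"
proof (induction M)
  case (Suc M)
  then have "convpow A (Suc M + N) = conv A (conv (convpow A M) (convpow A N))" by simp
  then show ?case by (simp add: fun_eq_iff conv_assoc)
qed (simp add: fun_eq_iff)

text \<open>This is \<open>A - counit\<close> when \<open>A [] = 1\<close>, written without
  subtraction since the values may lie in a semiring.\<close>

definition off_Nil :: "('a list \<Rightarrow> 'b::zero) \<Rightarrow> 'a list \<Rightarrow> 'b" where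
  "off_Nil A u = (if u = [] then 0 else A u)"

lemma conv_off_Nil:
  assumes "A [] = 1"
  shows "conv A F u = F u + conv (off_Nil A) F u"
proof -
  have "A = (\<lambda>v. counit v + off_Nil A v)"
    using assms by (auto simp: fun_eq_iff off_Nil_def counit_def)
  then show ?thesis
    using conv_add_left[of counit "off_Nil A" F u] by simp
qed

text \<open>Every factor vanishes on the empty word and so uses up at least one letter. This local
  nilpotence makes all series below finite.\<close>

lemma convpow_off_Nil_eq_0: "length u < d \<Longrightarrow> convpow (off_Nil A) d u = 0"
proof (induction d arbitrary: u)
  case (Suc d)
  have "off_Nil A (take i u) * convpow (off_Nil A) d (drop i u) = 0" if "i \<le> length u" for i
    using Suc that by (cases "i = 0 \<or> u = []") (auto simp: off_Nil_def[of A "[]"])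
  then show ?case by (simp add: conv_sum)
qed auto

text \<open>The binomial theorem for \<open>counit + off_Nil A\<close>. The upper limit
  \<open>M\<close> is left free, because the sum will be compared with one that stops at the length
  of the word.\<close>

lemma convpow_binomial:
  fixes A :: "'a list \<Rightarrow> 'b::comm_semiring_1"
  assumes "A [] = 1"
  shows "N \<le> M \<Longrightarrow> convpow A N u = (\<Sum>d\<le>M. of_nat (N choose d) * convpow (off_Nil A) d u)"
proof (induction N arbitrary: M u)
  case 0
  have "(\<Sum>d\<le>M. of_nat (0 choose d) * convpow (off_Nil A) d u)
      = (\<Sum>d\<in>{0}. of_nat (0 choose d) * convpow (off_Nil A) d u)"
    by (rule sum.mono_neutral_right) (auto simp: binomial_eq_0)
  then show ?case by simp
next
  case (Suc N)
  then obtain M' where M: "M = Suc M'" "N \<le> M'" by (cases M) auto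
  let ?c = "\<lambda>d. convpow (off_Nil A) d"
  have "convpow A (Suc N) u = convpow A N u + conv (off_Nil A) (convpow A N) u"
    by (simp add: conv_off_Nil assms)
  also have "convpow A N u = (\<Sum>d\<le>M. of_nat (N choose d) * ?c d u)"
    by (rule Suc.IH) (use M in auto)
  also have "conv (off_Nil A) (convpow A N) u
      = (\<Sum>d\<le>M'. of_nat (N choose d) * ?c (Suc d) u)"
  proof -
    have "convpow A N = (\<lambda>v. \<Sum>d\<le>M'. of_nat (N choose d) * ?c d v)"
      using Suc.IH M by auto
    then have "conv (off_Nil A) (convpow A N) u
      = (\<Sum>i\<le>length u. \<Sum>d\<le>M'. of_nat (N choose d) * (off_Nil A (take i u) * ?c d (drop i u)))"
      by (simp add: conv_sum sum_distrib_left algebra_simps)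
    also have "\<dots> = (\<Sum>d\<le>M'. of_nat (N choose d) * ?c (Suc d) u)"
      by (subst sum.swap) (simp add: conv_sum sum_distrib_left)
    finally show ?thesis .
  qed
  also have "(\<Sum>d\<le>M. of_nat (N choose d) * ?c d u) + (\<Sum>d\<le>M'. of_nat (N choose d) * ?c (Suc d) u)
     = (\<Sum>d\<le>M. of_nat (Suc N choose d) * ?c d u)"
    unfolding M sum.atMost_Suc_shift by (simp add: algebra_simps sum.distrib del: convpow.simps)
  finally show ?case .
qed

definition binom_poly :: "nat \<Rightarrow> complex poly" where
  "binom_poly d = smult (1 / fact d) (\<Prod>i<d. [:- of_nat i, 1:])"

lemma poly_binom_poly: "poly (binom_poly d) (of_nat N) = of_nat (N choose d)"
proof -
  have "of_nat (N choose d) = (of_nat N gchoose d :: complex)"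
    by (simp add: binomial_gbinomial)
  also have "\<dots> = poly (binom_poly d) (of_nat N)"
    by (simp add: binom_poly_def gbinomial_prod_rev poly_prod lessThan_atLeast0)
  finally show ?thesis by simp
qed

lemma degree_binom_poly: "degree (binom_poly d) \<le> d"
proof -
  have "degree (\<Prod>i<d. [:- of_nat i, 1 :: complex:]) \<le> (\<Sum>i<d. degree [:- of_nat i, 1 :: complex:])"
    using degree_prod_sum_le[of "{..<d}" "\<lambda>i. [:- of_nat i, 1 :: complex:]"] by (simp add: comp_def)
  then show ?thesis by (simp add: binom_poly_def)
qed

text \<open>The source of the logarithmic coefficients: in (1 + t)^x, the sum of (x choose d) t^d,
  the part linear in x is log(1 + t).\<close>

lemma coeff_binom_poly_1: "coeff (binom_poly (Suc d)) 1 = (-1) ^ d / of_nat (Suc d)"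
proof -
  have *: "coeff (\<Prod>i<d. [:- of_nat (Suc i), 1 :: complex:]) 0 = (-1) ^ d * fact d"
    by (induction d) (auto simp: coeff_mult algebra_simps)
  have "(\<Prod>i<Suc d. [:- of_nat i, 1 :: complex:]) = pCons 0 (\<Prod>i<d. [:- of_nat (Suc i), 1 :: complex:])"
    by (subst prod.lessThan_Suc_shift) simp
  then have "coeff (binom_poly (Suc d)) 1 = (-1) ^ d * fact d / fact (Suc d)"
    unfolding binom_poly_def using * by (simp del: prod.lessThan_Suc of_nat_Suc fact_Suc)
  also have "\<dots> = (-1) ^ d / of_nat (Suc d)" by (simp add: divide_simps)
  finally show ?thesis .
qed

text \<open>The transfer principle: an identity between interpolating polynomials only has to be
  checked at natural exponents.\<close>

lemma poly_eqI_nat: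
  fixes p q :: "complex poly"
  assumes "\<And>N::nat. poly p (of_nat N) = poly q (of_nat N)"
  shows "p = q"
proof (rule ccontr)
  assume "p \<noteq> q"
  then have "finite {x. poly (p - q) x = 0}" by (intro poly_roots_finite) auto
  moreover have "range (of_nat :: nat \<Rightarrow> complex) \<subseteq> {x. poly (p - q) x = 0}"
    using assms by auto
  ultimately have "finite (range (of_nat :: nat \<Rightarrow> complex))" by (rule rev_finite_subset)
  then show False using infinite_UNIV_char_0 by (simp add: finite_image_iff inj_of_nat)
qed

text \<open>
  The polynomial interpolating \<open>N \<mapsto> A\<^sup>N u\<close>. Its coefficient of degree \<open>k\<close> is that of
  \<open>exp (N log A)\<close>; in particular the linear one is the convolution logarithm of \<open>A\<close>.
\<close>

definition interpol :: "('a list \<Rightarrow> complex) \<Rightarrow> 'a list \<Rightarrow> complex poly" where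
  "interpol A u = (\<Sum>d\<le>length u. smult (convpow (off_Nil A) d u) (binom_poly d))"

definition clog :: "('a list \<Rightarrow> complex) \<Rightarrow> 'a list \<Rightarrow> complex" where
  "clog A u = coeff (interpol A u) 1"

lemma poly_interpol:
  assumes "A [] = 1"
  shows "poly (interpol A u) (of_nat N) = convpow A N u"
proof -
  let ?f = "\<lambda>d. of_nat (N choose d) * convpow (off_Nil A) d u"
  have "poly (interpol A u) (of_nat N) = (\<Sum>d\<le>length u. ?f d)"
    by (simp add: interpol_def poly_sum poly_binom_poly algebra_simps)
  \<comment> \<open>The truncation in \<open>interpol\<close> cannot depend on \<open>N\<close>;
    raising it to a common bound is harmless since powers beyond the length of \<open>u\<close>
    vanish.\<close>
  also have "\<dots> = (\<Sum>d\<le>max N (length u). ?f d)"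
    by (rule sum.mono_neutral_left) (auto simp: convpow_off_Nil_eq_0)
  also have "\<dots> = convpow A N u"
    by (rule convpow_binomial[symmetric]) (use assms in auto)
  finally show ?thesis .
qed

lemma degree_interpol: "degree (interpol A u) \<le> length u"
  unfolding interpol_def
  by (rule degree_sum_le) (use degree_binom_poly order.trans in \<open>auto intro: order.trans\<close>)

text \<open>The series of log(1 + t) at t = \<open>off_Nil A\<close>. Its signs and denominators
  become the signs and the degrees deg(q/p) in the definition of f.\<close>

lemma clog_sum: "clog A u = (\<Sum>d\<in>{1..length u}. (-1) ^ (d - 1) / of_nat d * convpow (off_Nil A) d u)"
proof -
  have "clog A u = (\<Sum>d\<le>length u. convpow (off_Nil A) d u * coeff (binom_poly d) 1)"
    by (simp add: clog_def interpol_def coeff_sum)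
  also have "\<dots> = (\<Sum>d\<in>{1..length u}. convpow (off_Nil A) d u * coeff (binom_poly d) 1)"
    by (rule sum.mono_neutral_right) (auto simp: binom_poly_def not_le)
  also have "\<dots> = (\<Sum>d\<in>{1..length u}. (-1) ^ (d - 1) / of_nat d * convpow (off_Nil A) d u)"
  proof (rule sum.cong[OF refl])
    fix d assume "d \<in> {1..length u}"
    then obtain e where "d = Suc e" by (cases d) auto
    then show "convpow (off_Nil A) d u * coeff (binom_poly d) 1
        = (-1) ^ (d - 1) / of_nat d * convpow (off_Nil A) d u"
      using coeff_binom_poly_1[of e] by (simp del: convpow.simps of_nat_Suc)
  qed
  finally show ?thesis .
qed

lemma clog_Nil [simp]: "clog A [] = 0"
  by (simp add: clog_sum)

lemma coeff_pcompose_1: "coeff (pcompose p [:c, 1:]) 1 = poly (pderiv p) (c :: complex)"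
proof -
  have "coeff (pcompose p [:c, 1:]) 1 = coeff (pderiv (pcompose p [:c, 1:])) 0"
    by (simp add: coeff_pderiv)
  also have "\<dots> = poly (pderiv (pcompose p [:c, 1:])) 0"
    by (rule poly_0_coeff_0[symmetric])
  also have "\<dots> = poly (pderiv p) c"
    by (simp add: pderiv_pcompose poly_pcompose pderiv_pCons)
  finally show ?thesis .
qed

text \<open>The differential equation (A^N)' = log A * A^N, obtained by comparing the terms linear
  in M in A^(M+N) = A^M * A^N.\<close>

lemma pderiv_interpol:
  assumes "A [] = 1"
  shows "pderiv (interpol A u) = (\<Sum>i\<le>length u. smult (clog A (take i u)) (interpol A (drop i u)))"
proof (rule poly_eqI_nat)
  fix N :: nat
  have "pcompose (interpol A u) [:of_nat N, 1:]
      = (\<Sum>i\<le>length u. smult (poly (interpol A (drop i u)) (of_nat N)) (interpol A (take i u)))"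
  proof (rule poly_eqI_nat)
    fix M :: nat
    have "poly (pcompose (interpol A u) [:of_nat N, 1:]) (of_nat M) = poly (interpol A u) (of_nat (M + N))"
      by (simp add: poly_pcompose add_ac)
    also have "\<dots> = conv (convpow A M) (convpow A N) u"
      by (simp only: poly_interpol[of A, OF assms] convpow_add)
    finally show "poly (pcompose (interpol A u) [:of_nat N, 1:]) (of_nat M) = poly (\<Sum>i\<le>length u. smult (poly (interpol A (drop i u)) (of_nat N)) (interpol A (take i u))) (of_nat M)"
      by (simp add: conv_sum poly_sum poly_interpol assms mult_ac)
  qed
  then have "coeff (pcompose (interpol A u) [:of_nat N, 1:]) 1
      = (\<Sum>i\<le>length u. poly (interpol A (drop i u)) (of_nat N) * clog A (take i u))"
    by (simp add: coeff_sum clog_def)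
  then show "poly (pderiv (interpol A u)) (of_nat N)
      = poly (\<Sum>i\<le>length u. smult (clog A (take i u)) (interpol A (drop i u))) (of_nat N)"
    unfolding coeff_pcompose_1 by (simp add: poly_sum mult_ac)
qed

text \<open>Iterating the differential equation gives the Taylor coefficients of exp(N log A) at N =
  0.\<close>

lemma coeff_interpol:
  assumes "A [] = 1"
  shows "coeff (interpol A u) k = convpow (clog A) k u / fact k"
proof (induction k arbitrary: u)
  case 0
  have "coeff (interpol A u) 0 = poly (interpol A u) (of_nat 0)"
    by (simp add: poly_0_coeff_0)
  then show ?case by (simp only: poly_interpol[of A, OF assms]) simp
next
  case (Suc k)
  have "of_nat (Suc k) * coeff (interpol A u) (Suc k) = coeff (pderiv (interpol A u)) k"
    by (simp add: coeff_pderiv)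
  also have "\<dots> = (\<Sum>i\<le>length u. clog A (take i u) * (convpow (clog A) k (drop i u) / fact k))"
    by (simp add: pderiv_interpol assms coeff_sum Suc)
  also have "\<dots> = convpow (clog A) (Suc k) u / fact k"
    by (simp add: conv_sum sum_divide_distrib)
  finally have "of_nat (Suc k) * coeff (interpol A u) (Suc k) = convpow (clog A) (Suc k) u / fact k" .
  moreover have "(of_nat (Suc k) :: complex) \<noteq> 0" by (simp del: of_nat_Suc)
  ultimately show ?case by (simp add: divide_simps mult_ac del: convpow.simps of_nat_Suc)
qed

text \<open>The interpolating polynomial at N = 1, written out in its coefficients.\<close>

lemma exp_clog:
  assumes "A [] = 1"
  shows "A u = (\<Sum>k\<le>length u. convpow (clog A) k u / fact k)"
proof -
  have "A u = poly (interpol A u) (of_nat 1)"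
    by (simp only: poly_interpol[of A, OF assms]) (simp add: fun_eq_iff)
  also have "\<dots> = (\<Sum>k\<le>degree (interpol A u). coeff (interpol A u) k)"
    by (simp add: poly_altdef)
  also have "\<dots> = (\<Sum>k\<le>length u. coeff (interpol A u) k)"
    by (rule sum.mono_neutral_left) (use degree_interpol in \<open>auto simp: not_le intro: coeff_eq_0\<close>)
  finally show ?thesis by (simp add: coeff_interpol assms)
qed

section \<open>Multiplicative and primitive functionals\<close>

definition multiplicative :: "((nat \<times> 'g) list \<Rightarrow> complex) \<Rightarrow> bool" where
  "multiplicative A \<longleftrightarrow> (\<forall>s t. distinct (map fst (s @ t)) \<longrightarrow> shuf_sum A s t = A s * A t)"

definition primitive :: "((nat \<times> 'g) list \<Rightarrow> complex) \<Rightarrow> bool" where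
  "primitive K \<longleftrightarrow> K [] = 0 \<and>
     (\<forall>s t. s \<noteq> [] \<longrightarrow> t \<noteq> [] \<longrightarrow> distinct (map fst (s @ t)) \<longrightarrow> shuf_sum K s t = 0)"

lemma distinct_take_drop:
  assumes "distinct (map fst (s @ t))"
  shows "distinct (map fst (take i s @ take j t))" "distinct (map fst (drop i s @ drop j t))"
  using assms set_take_subset[of i "map fst s"] set_take_subset[of j "map fst t"]
    set_drop_subset[of i "map fst s"] set_drop_subset[of j "map fst t"]
  by (auto simp: take_map[symmetric] drop_map[symmetric])

lemma multiplicative_conv:
  assumes "multiplicative A" "multiplicative B"
  shows "multiplicative (conv A B)"
  unfolding multiplicative_def
proof (intro allI impI)
  fix s t :: "(nat \<times> 'a) list" assume d: "distinct (map fst (s @ t))"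
  have "shuf_sum (conv A B) s t = (\<Sum>i\<le>length s. \<Sum>j\<le>length t.
      (A (take i s) * B (drop i s)) * (A (take j t) * B (drop j t)))"
    unfolding shuf_sum_conv
    using assms distinct_take_drop[OF d] by (intro sum.cong refl) (simp add: multiplicative_def)
  then show "shuf_sum (conv A B) s t = conv A B s * conv A B t"
    by (simp add: conv_sum sum_product)
qed

lemma multiplicative_convpow: "multiplicative A \<Longrightarrow> multiplicative (convpow A k)"
  by (induction k) (auto simp: multiplicative_conv, auto simp: multiplicative_def shuf_sum_counit)

text \<open>The functional \<open>interpol A\<close> with polynomial values is itself
  multiplicative, as its values at natural numbers are. On nonempty words its constant terms vanish,
  so a product of two values has no linear term.\<close>

lemma primitive_clog:
  assumes "multiplicative A" "A [] = 1"
  shows "primitive (clog A)"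
  unfolding primitive_def
proof (intro conjI allI impI)
  fix s t :: "(nat \<times> 'a) list" assume st: "s \<noteq> []" "t \<noteq> []" and d: "distinct (map fst (s @ t))"
  have "shuf_sum (interpol A) s t = interpol A s * interpol A t"
  proof (rule poly_eqI_nat)
    fix N :: nat
    have "poly (shuf_sum (interpol A) s t) (of_nat N) = shuf_sum (convpow A N) s t"
      using shuf_sum_hom[of "\<lambda>p. poly p (of_nat N)" "interpol A" s t] poly_interpol[of A, OF assms(2)] by simp
    also have "\<dots> = convpow A N s * convpow A N t"
      using multiplicative_convpow[OF assms(1)] d by (simp add: multiplicative_def)
    finally show "poly (shuf_sum (interpol A) s t) (of_nat N) = poly (interpol A s * interpol A t) (of_nat N)"
      by (simp add: poly_interpol assms)
  qed
  moreover have "shuf_sum (clog A) s t = coeff (shuf_sum (interpol A) s t) 1"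
    using shuf_sum_hom[of "\<lambda>p. coeff p 1" "interpol A" s t] by (simp add: clog_def[abs_def])
  moreover have "coeff (interpol A u) 0 = 0" if "u \<noteq> []" for u
    using that by (simp add: coeff_interpol assms(2) counit_def)
  ultimately show "shuf_sum (clog A) s t = 0"
    using st by (simp add: coeff_mult numeral_eq_Suc)
qed simp

section \<open>Convolution products of primitive functionals\<close>

fun cprod :: "(('a list) \<Rightarrow> 'b::comm_semiring_1) list \<Rightarrow> 'a list \<Rightarrow> 'b" where
  "cprod [] = counit"
| "cprod (k # ks) = conv k (cprod ks)"

lemma cprod_append: "cprod (ks @ ls) = conv (cprod ks) (cprod ls)"
proof (induction ks)
  case (Cons k ks)
  then have "cprod ((k # ks) @ ls) = conv k (conv (cprod ks) (cprod ls))" by simp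
  then show ?case by (simp add: fun_eq_iff conv_assoc)
qed (simp add: fun_eq_iff)

text \<open>The sum over the unshuffle coproduct of a list of factors: each factor goes to one of
  two sides, where the order is kept.\<close>

fun split_sum :: "('k list \<Rightarrow> 'k list \<Rightarrow> 'b::comm_monoid_add) \<Rightarrow> 'k list \<Rightarrow> 'b" where
  "split_sum G [] = G [] []"
| "split_sum G (x # ks) = split_sum (\<lambda>a c. G (x # a) c) ks + split_sum (\<lambda>a c. G a (x # c)) ks"

lemma split_sum_cong:
  assumes "\<And>a c. mset a + mset c = mset ks \<Longrightarrow> G a c = G' a c"
  shows "split_sum G ks = split_sum G' ks"
  using assms
proof (induction ks arbitrary: G G')
  case (Cons x ks)
  have "split_sum (\<lambda>a c. G (x # a) c) ks = split_sum (\<lambda>a c. G' (x # a) c) ks"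
    by (rule Cons.IH) (use Cons.prems in auto)
  moreover have "split_sum (\<lambda>a c. G a (x # c)) ks = split_sum (\<lambda>a c. G' a (x # c)) ks"
    by (rule Cons.IH) (use Cons.prems in auto)
  ultimately show ?case by simp
qed auto

lemma split_sum_zero: "split_sum (\<lambda>_ _. 0) ks = 0"
  by (induction ks) auto

lemma split_sum_hom:
  assumes "\<And>a b. h (a + b) = h a + h b"
  shows "split_sum (\<lambda>a c. h (G a c)) ks = h (split_sum G ks)"
  by (induction ks arbitrary: G) (auto simp: assms)

lemma split_sum_add: "split_sum (\<lambda>a c. G a c + G' a c) ks = split_sum G ks + split_sum G' ks"
  by (induction ks arbitrary: G G') (auto simp: add_ac)

lemma split_sum_sum: "split_sum (\<lambda>a c. \<Sum>i\<in>I. G i a c) ks = (\<Sum>i\<in>I. split_sum (G i) ks)"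
  by (induction I rule: infinite_finite_induct) (auto simp: split_sum_zero split_sum_add)

lemma split_sum_cmult: "split_sum (\<lambda>a c. x * G a c) ks = (x :: 'b :: semiring_0) * split_sum G ks"
  by (rule split_sum_hom) (rule distrib_left)

lemma split_sum_map: "split_sum G (map f ks) = split_sum (\<lambda>a c. G (map f a) (map f c)) ks"
  by (induction ks arbitrary: G) auto

text \<open>The pattern of cuts on which a primitive factor survives: its letters must all come from
  one of the two words. The corner, which belongs to both arms, contributes zero.\<close>

lemma sum_cross:
  fixes T :: "nat \<Rightarrow> nat \<Rightarrow> 'b::comm_monoid_add"
  assumes "T 0 0 = 0" "\<And>i j. i \<le> m \<Longrightarrow> j \<le> n \<Longrightarrow> 0 < i \<Longrightarrow> 0 < j \<Longrightarrow> T i j = 0"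
  shows "(\<Sum>i\<le>m. \<Sum>j\<le>n. T i j) = (\<Sum>i\<le>m. T i 0) + (\<Sum>j\<le>n. T 0 j)"
proof -
  have "(\<Sum>j\<le>n. T i j) = T i 0 + (if i = 0 then (\<Sum>j\<le>n. T 0 j) else 0)" if "i \<le> m" for i
  proof (cases "i = 0")
    case False
    have "(\<Sum>j\<le>n. T i j) = (\<Sum>j\<in>{0}. T i j)"
      by (rule sum.mono_neutral_right) (use assms False that in auto)
    then show ?thesis using False by simp
  qed (use assms in auto)
  then have "(\<Sum>i\<le>m. \<Sum>j\<le>n. T i j) = (\<Sum>i\<le>m. T i 0 + (if i = 0 then (\<Sum>j\<le>n. T 0 j) else 0))"
    by (intro sum.cong) auto
  then show ?thesis by (simp add: sum.distrib)
qed

text \<open>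
  Products of primitive functionals pull back along shuffles like products of primitive elements
  under the unshuffle coproduct.
\<close>

lemma shuf_sum_cprod:
  assumes "\<And>k. k \<in> set ks \<Longrightarrow> primitive k" "distinct (map fst (s @ t))"
  shows "shuf_sum (cprod ks) s t = split_sum (\<lambda>a c. cprod a s * cprod c t) ks"
  using assms
proof (induction ks arbitrary: s t)
  case Nil
  then show ?case by (simp add: shuf_sum_counit)
next
  case (Cons k ks)
  have k: "primitive k" using Cons.prems by simp
  let ?T = "\<lambda>i j. shuf_sum k (take i s) (take j t) * shuf_sum (cprod ks) (drop i s) (drop j t)"
  have IH: "shuf_sum (cprod ks) (drop i s) (drop j t) = split_sum (\<lambda>a c. cprod a (drop i s) * cprod c (drop j t)) ks" for i j
    by (rule Cons.IH) (simp_all only: Cons.prems list.set_intros distinct_take_drop(2)[OF Cons.prems(2)] not_False_eq_True)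
  have "shuf_sum (cprod (k # ks)) s t = (\<Sum>i\<le>length s. \<Sum>j\<le>length t. ?T i j)"
    by (simp add: shuf_sum_conv)
  also have "\<dots> = (\<Sum>i\<le>length s. ?T i 0) + (\<Sum>j\<le>length t. ?T 0 j)"
  proof (rule sum_cross)
    fix i j assume "i \<le> length s" "j \<le> length t" "0 < i" "0 < j"
    then have "take i s \<noteq> []" "take j t \<noteq> []" by auto
    then have "shuf_sum k (take i s) (take j t) = 0"
      using k distinct_take_drop(1)[OF Cons.prems(2)] unfolding primitive_def by blast
    then show "?T i j = 0" by simp
  qed (use k in \<open>auto simp: primitive_def\<close>)
  also have "(\<Sum>i\<le>length s. ?T i 0) = split_sum (\<lambda>a c. cprod (k # a) s * cprod c t) ks"
    unfolding IH
    by (simp add: conv_sum sum_distrib_right split_sum_sum mult.assoc split_sum_cmult)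
  also have "(\<Sum>j\<le>length t. ?T 0 j) = split_sum (\<lambda>a c. cprod a s * cprod (k # c) t) ks"
    unfolding IH
    by (simp add: conv_sum sum_distrib_left split_sum_sum mult.left_commute flip: split_sum_cmult)
  finally show ?case by simp
qed

definition commutator :: "('a list \<Rightarrow> complex) \<Rightarrow> ('a list \<Rightarrow> complex) \<Rightarrow> 'a list \<Rightarrow> complex" where
  "commutator A B u = conv A B u - conv B A u"

text \<open>On nonempty \<open>s\<close> and \<open>t\<close> only the mixed terms
  \<open>A s * B t + B s * A t\<close> of the coproduct survive, and these are symmetric in
  \<open>A\<close> and \<open>B\<close>.\<close>

lemma primitive_commutator:
  assumes "primitive A" "primitive B"
  shows "primitive (commutator A B)"
  unfolding primitive_def
proof (intro conjI allI impI)
  fix s t :: "(nat \<times> 'a) list" assume st: "s \<noteq> []" "t \<noteq> []" and d: "distinct (map fst (s @ t))"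
  have "conv K counit = K" for K :: "(nat \<times> 'a) list \<Rightarrow> complex"
    by (rule ext) simp
  then have *: "conv A B = cprod [A, B]" "conv B A = cprod [B, A]" by simp_all
  have "shuf_sum (commutator A B) s t = shuf_sum (conv A B) s t - shuf_sum (conv B A) s t"
    using shuf_sum_add[of "commutator A B" "conv B A" s t] by (simp add: commutator_def[abs_def])
  also have "\<dots> = 0"
    unfolding *
    by (subst (1 2) shuf_sum_cprod) (use assms d st in \<open>auto simp: counit_def conv_sum\<close>)
  finally show "shuf_sum (commutator A B) s t = 0" .
qed (use assms in \<open>auto simp: commutator_def primitive_def\<close>)

section \<open>Right multiplication by \<open>X\<close> on functionals\<close>

definition untwist :: "('g, 'm) monoid_scheme \<Rightarrow> 'g \<Rightarrow> (nat \<times> 'g) list \<Rightarrow> (nat \<times> 'g) list" where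
  "untwist G h = map (\<lambda>x. (fst x, snd x \<otimes>\<^bsub>G\<^esub> inv\<^bsub>G\<^esub> h))"

lemma map_fst_untwist [simp]: "map fst (untwist G h w) = map fst w"
  by (simp add: untwist_def)

lemma length_untwist [simp]: "length (untwist G h w) = length w"
  by (simp add: untwist_def)

lemma take_untwist: "take i (untwist G h w) = untwist G h (take i w)"
  by (simp add: untwist_def take_map)

lemma drop_untwist: "drop i (untwist G h w) = untwist G h (drop i w)"
  by (simp add: untwist_def drop_map)

text \<open>
  The value of the product \<open>F \<cdot> X\<^sub>p\<close> at \<open>w\<close>: cut \<open>w\<close> into segments according to \<open>p\<close>, strip the
  labels of \<open>p\<close> off the segments, and sum \<open>F\<close> over the shuffles of the results.
\<close>

fun seg_sum :: "('g, 'm) monoid_scheme \<Rightarrow> (nat \<times> 'g) list \<Rightarrow> ((nat \<times> 'g) list \<Rightarrow> complex)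
    \<Rightarrow> (nat \<times> 'g) list \<Rightarrow> complex" where
  "seg_sum G [] F w = (if w = [] then F [] else 0)"
| "seg_sum G ((b, h) # p) F w =
     (if b \<le> length w then seg_sum G p (\<lambda>u. shuf_sum F (untwist G h (take b w)) u) (drop b w) else 0)"

text \<open>Only the first entries of the arguments are controlled, since \<open>untwist\<close>
  changes the labels. This suffices to transport distinctness.\<close>

lemma seg_sum_cong:
  assumes "\<And>u. mset (map fst u) = mset (map fst w) \<Longrightarrow> F u = F' u"
  shows "seg_sum G p F w = seg_sum G p F' w"
  using assms
proof (induction p arbitrary: F F' w)
  case (Cons bh p)
  obtain b h where bh: "bh = (b, h)" by force
  show ?case
  proof (cases "b \<le> length w")
    case True
    have "seg_sum G p (\<lambda>u. shuf_sum F (untwist G h (take b w)) u) (drop b w)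
        = seg_sum G p (\<lambda>u. shuf_sum F' (untwist G h (take b w)) u) (drop b w)"
    proof (rule Cons.IH)
      fix u :: "(nat \<times> 'a) list" assume u: "mset (map fst u) = mset (map fst (drop b w))"
      show "shuf_sum F (untwist G h (take b w)) u = shuf_sum F' (untwist G h (take b w)) u"
      proof (rule shuf_sum_cong)
        fix v assume "mset v = mset (untwist G h (take b w)) + mset u"
        then have "mset (map fst v) = mset (map fst (take b w @ drop b w))"
          using u by (metis map_fst_untwist map_append mset_append mset_map)
        then show "F v = F' v" using Cons.prems by simp
      qed
    qed
    then show ?thesis using True bh by simp
  qed (use bh in auto)
qed auto

lemma seg_sum_zero: "seg_sum G p (\<lambda>u. 0) w = 0"
proof (induction p arbitrary: w)
  case (Cons bh p)
  have "shuf_sum (\<lambda>u. 0 :: complex) t = (\<lambda>u. 0)" for t :: "(nat \<times> 'a) list"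
    by (simp add: fun_eq_iff shuf_sum_zero)
  then show ?case using Cons by (cases bh) simp
qed simp

lemma seg_sum_add: "seg_sum G p (\<lambda>u. F u + F' u) w = seg_sum G p F w + seg_sum G p F' w"
proof (induction p arbitrary: F F' w)
  case (Cons bh p)
  have "shuf_sum (\<lambda>u. F u + F' u) t = (\<lambda>u. shuf_sum F t u + shuf_sum F' t u)" for t
    by (simp add: fun_eq_iff shuf_sum_add)
  then show ?case using Cons by (cases bh) simp
qed simp

lemma seg_sum_cmult: "seg_sum G p (\<lambda>u. c * F u) w = c * seg_sum G p F w"
proof (induction p arbitrary: F w)
  case (Cons bh p)
  have "shuf_sum (\<lambda>u. c * F u) t = (\<lambda>u. c * shuf_sum F t u)" for t
    by (simp add: fun_eq_iff shuf_sum_cmult)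
  then show ?case using Cons by (cases bh) simp
qed simp

lemma seg_sum_sum: "seg_sum G p (\<lambda>u. \<Sum>i\<in>I. F i u) w = (\<Sum>i\<in>I. seg_sum G p (F i) w)"
  by (induction I rule: infinite_finite_induct) (auto simp: seg_sum_zero seg_sum_add)

lemma seg_sum_split_sum: "seg_sum G p (\<lambda>u. split_sum (\<lambda>a c. F a c u) ks) w = split_sum (\<lambda>a c. seg_sum G p (F a c) w) ks"
  by (induction ks arbitrary: F) (auto simp: seg_sum_add)

text \<open>Each primitive factor is either evaluated on the first segment or handed on to the
  remaining ones. Both inductions over \<open>p\<close> below, for annihilation and for stability,
  use this as their step.\<close>

lemma seg_sum_Cons_cprod:
  assumes "\<And>k. k \<in> set ks \<Longrightarrow> primitive k" "distinct (map fst w)" "b \<le> length w"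
  shows "seg_sum G ((b, h) # p) (cprod ks) w =
    split_sum (\<lambda>a c. cprod a (untwist G h (take b w)) * seg_sum G p (cprod c) (drop b w)) ks"
proof -
  have "seg_sum G ((b, h) # p) (cprod ks) w
      = seg_sum G p (\<lambda>u. split_sum (\<lambda>a c. cprod a (untwist G h (take b w)) * cprod c u) ks) (drop b w)"
    using assms(3) unfolding seg_sum.simps if_P[OF assms(3)]
  proof (intro seg_sum_cong shuf_sum_cprod)
    fix u :: "(nat \<times> 'a) list" assume u: "mset (map fst u) = mset (map fst (drop b w))"
    have "mset (map fst (untwist G h (take b w) @ u)) = mset (map fst (take b w @ drop b w))"
      using u by (simp only: map_append mset_append map_fst_untwist)
    then show "distinct (map fst (untwist G h (take b w) @ u))"
      using assms(2) by (metis append_take_drop_id mset_eq_imp_distinct_iff)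
  qed (use assms in auto)
  then show ?thesis by (simp add: seg_sum_split_sum seg_sum_cmult)
qed

text \<open>Pigeonhole: a nonempty segment that receives no factor contributes
  \<open>counit\<close>, hence zero, and there are fewer factors than segments.\<close>

lemma seg_sum_cprod_eq_0:
  assumes "\<And>k. k \<in> set ks \<Longrightarrow> primitive k" "distinct (map fst w)"
    "\<And>x. x \<in> set p \<Longrightarrow> 0 < fst x" "length ks < length p"
  shows "seg_sum G p (cprod ks) w = 0"
  using assms
proof (induction p arbitrary: ks w)
  case (Cons bh p)
  obtain b h where bh: "bh = (b, h)" by force
  have b: "0 < b" using Cons.prems(3)[of bh] bh by simp
  show ?case
  proof (cases "b \<le> length w")
    case True
    have "seg_sum G (bh # p) (cprod ks) w = split_sum (\<lambda>a c. cprod a (untwist G h (take b w)) * seg_sum G p (cprod c) (drop b w)) ks"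
      unfolding bh by (rule seg_sum_Cons_cprod) (use Cons.prems True in auto)
    also have "\<dots> = split_sum (\<lambda>_ _. 0) ks"
    proof (rule split_sum_cong)
      fix a c assume ac: "mset a + mset c = mset ks"
      show "cprod a (untwist G h (take b w)) * seg_sum G p (cprod c) (drop b w) = 0"
      proof (cases "a = []")
        case True
        have "untwist G h (take b w) \<noteq> []" using b \<open>b \<le> length w\<close> by (auto simp: untwist_def)
        then show ?thesis using True by (simp add: counit_def)
      next
        case False
        have "length a + length c = length ks" using ac by (metis size_mset size_union)
        moreover have "set c \<subseteq> set ks" using ac by (metis mset_subset_eq_add_right set_mset_mono set_mset_mset)
        ultimately have "seg_sum G p (cprod c) (drop b w) = 0"
          using Cons.prems False
          by (intro Cons.IH) (auto simp: drop_map[symmetric] subset_iff simp flip: length_greater_0_conv)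
        then show ?thesis by simp
      qed
    qed
    finally show ?thesis by (simp add: split_sum_zero)
  qed (use bh in auto)
qed auto

lemma cprod_swap: "cprod (xs @ [A, B] @ ys) u - cprod (xs @ [B, A] @ ys) u = cprod (xs @ [commutator A B] @ ys) u"
proof (induction xs arbitrary: u)
  case Nil
  have "commutator A B = (\<lambda>v. conv A B v + (-1) * conv B A v)" by (simp add: fun_eq_iff commutator_def)
  then have "conv (commutator A B) (cprod ys) u = conv (conv A B) (cprod ys) u - conv (conv B A) (cprod ys) u"
    by (simp only: conv_add_left conv_cmult_left) simp
  then show ?case by (simp add: conv_assoc)
next
  case (Cons x xs)
  have "cprod ((x # xs) @ [A, B] @ ys) u - cprod ((x # xs) @ [B, A] @ ys) u =
      (\<Sum>i\<le>length u. x (take i u) * (cprod (xs @ [A, B] @ ys) (drop i u) - cprod (xs @ [B, A] @ ys) (drop i u)))"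
    by (simp add: conv_sum sum_subtractf algebra_simps)
  also have "\<dots> = cprod ((x # xs) @ [commutator A B] @ ys) u"
    unfolding Cons by (simp add: conv_sum)
  finally show ?case .
qed

text \<open>The two products differ by one in which the primitive \<open>commutator A B\<close>
  replaces two factors. It has fewer factors than \<open>p\<close> has parts and is
  annihilated.\<close>

lemma seg_sum_cprod_swap:
  assumes "\<And>k. k \<in> set (xs @ [A, B] @ ys) \<Longrightarrow> primitive k" "distinct (map fst w)"
    "\<And>x. x \<in> set p \<Longrightarrow> 0 < fst x" "length (xs @ [A, B] @ ys) \<le> length p"
  shows "seg_sum G p (cprod (xs @ [A, B] @ ys)) w = seg_sum G p (cprod (xs @ [B, A] @ ys)) w"
proof -
  have "cprod (xs @ [A, B] @ ys) = (\<lambda>u. cprod (xs @ [B, A] @ ys) u + cprod (xs @ [commutator A B] @ ys) u)"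
    unfolding cprod_swap[symmetric] by simp
  then have "seg_sum G p (cprod (xs @ [A, B] @ ys)) w
      = seg_sum G p (cprod (xs @ [B, A] @ ys)) w + seg_sum G p (cprod (xs @ [commutator A B] @ ys)) w"
    by (simp only: seg_sum_add)
  also have "seg_sum G p (cprod (xs @ [commutator A B] @ ys)) w = 0"
    by (rule seg_sum_cprod_eq_0) (use assms primitive_commutator[of A B] in auto)
  finally show ?thesis by simp
qed

text \<open>Adjacent transpositions generate all rearrangements.\<close>

lemma mset_eq_swap_invariant:
  assumes "\<And>xs x y ys. mset (xs @ [x, y] @ ys) = M \<Longrightarrow> F (xs @ [x, y] @ ys) = F (xs @ [y, x] @ ys)"
    and "mset as = M" "mset bs = M"
  shows "F as = F bs"
proof -
  \<comment> \<open>The letter \<open>x\<close> travels to the left across \<open>zs\<close>, one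
    transposition at a time.\<close>
  have front: "F (pre @ zs @ [x] @ ys) = F (pre @ [x] @ zs @ ys)" if "mset (pre @ zs @ [x] @ ys) = M" for pre zs x ys
    using that
  proof (induction zs arbitrary: ys rule: rev_induct)
    case (snoc z zs)
    have "F (pre @ (zs @ [z]) @ [x] @ ys) = F (pre @ zs @ [x] @ [z] @ ys)"
      using assms(1)[of "pre @ zs" z x ys] snoc.prems by simp
    also have "\<dots> = F (pre @ [x] @ zs @ [z] @ ys)"
      using snoc.IH[of "z # ys"] snoc.prems by (simp add: add_ac add_mset_commute)
    finally show ?case by simp
  qed simp
  \<comment> \<open>The prefix \<open>pre\<close> holds the letters already brought into their final
    place.\<close>
  have "F (pre @ as) = F (pre @ bs)" if "mset as = mset bs" "mset (pre @ as) = M" for pre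
    using that
  proof (induction as arbitrary: bs pre)
    case (Cons x as)
    then have "x \<in> set bs" by (metis list.set_intros(1) set_mset_mset)
    then obtain zs ys where bs: "bs = zs @ x # ys" by (meson split_list)
    have "F (pre @ (x # as)) = F ((pre @ [x]) @ as)" by simp
    also have "\<dots> = F ((pre @ [x]) @ zs @ ys)"
      by (rule Cons.IH) (use Cons.prems bs in auto)
    also have "\<dots> = F (pre @ bs)"
      using front[of pre zs x ys] Cons.prems bs by simp
    finally show ?case .
  qed simp
  from this[of "[]"] show ?thesis using assms by simp
qed

text \<open>The identity is demanded on \<open>W\<close> only, because the results on shuffles are
  available only for words without repeated first entries.\<close>

definition combs :: "'w set \<Rightarrow> 'k set \<Rightarrow> ('k \<Rightarrow> 'w \<Rightarrow> complex) \<Rightarrow> ('w \<Rightarrow> complex) set" where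
  "combs W A E = {F. \<exists>c. \<forall>w\<in>W. F w = (\<Sum>\<beta>\<in>A. c \<beta> * E \<beta> w)}"

lemma combs_zero: "(\<lambda>w. 0) \<in> combs W A E"
  unfolding combs_def by (auto intro!: exI[of _ "\<lambda>_. 0"])

lemma combs_add: "F \<in> combs W A E \<Longrightarrow> F' \<in> combs W A E \<Longrightarrow> (\<lambda>w. F w + F' w) \<in> combs W A E"
  unfolding combs_def
proof clarify
  fix c c' assume "\<forall>w\<in>W. F w = (\<Sum>\<beta>\<in>A. c \<beta> * E \<beta> w)" "\<forall>w\<in>W. F' w = (\<Sum>\<beta>\<in>A. c' \<beta> * E \<beta> w)"
  then show "\<exists>c. \<forall>w\<in>W. F w + F' w = (\<Sum>\<beta>\<in>A. c \<beta> * E \<beta> w)"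
    by (intro exI[of _ "\<lambda>\<beta>. c \<beta> + c' \<beta>"]) (auto simp: algebra_simps sum.distrib)
qed

lemma combs_cmult: "F \<in> combs W A E \<Longrightarrow> (\<lambda>w. x * F w) \<in> combs W A E"
  unfolding combs_def
proof clarify
  fix c assume "\<forall>w\<in>W. F w = (\<Sum>\<beta>\<in>A. c \<beta> * E \<beta> w)"
  then show "\<exists>c. \<forall>w\<in>W. x * F w = (\<Sum>\<beta>\<in>A. c \<beta> * E \<beta> w)"
    by (intro exI[of _ "\<lambda>\<beta>. x * c \<beta>"]) (auto simp: algebra_simps sum_distrib_left)
qed

lemma combs_sum: "(\<And>i. i \<in> I \<Longrightarrow> F i \<in> combs W A E) \<Longrightarrow> (\<lambda>w. \<Sum>i\<in>I. F i w) \<in> combs W A E"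
  by (induction I rule: infinite_finite_induct) (auto simp: combs_zero combs_add)

lemma combs_base: "finite A \<Longrightarrow> \<beta> \<in> A \<Longrightarrow> E \<beta> \<in> combs W A E"
  unfolding combs_def
  by (auto intro!: exI[of _ "\<lambda>\<gamma>. if \<gamma> = \<beta> then 1 else 0"] simp: if_distrib[of "\<lambda>x. x * _"] sum.delta cong: if_cong)

lemma combs_cong: "F \<in> combs W A E \<Longrightarrow> (\<And>w. w \<in> W \<Longrightarrow> F' w = F w) \<Longrightarrow> F' \<in> combs W A E"
  unfolding combs_def by auto

lemma combs_split_sum:
  "(\<And>a c. mset a + mset c = mset ks \<Longrightarrow> F a c \<in> combs W A E) \<Longrightarrow>
    (\<lambda>w. split_sum (\<lambda>a c. F a c w) ks) \<in> combs W A E"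
proof (induction ks arbitrary: F)
  case (Cons x ks)
  show ?case unfolding split_sum.simps
    by (intro combs_add Cons.IH Cons.prems) auto
qed simp

lemma finite_mset_eq: "finite {xs. mset xs = M}"
  using finite_permutations_of_multiset[of M] by (simp add: permutations_of_multiset_def)

text \<open>Unlike the carrier of the wreath product, this set is closed under taking segments, as
  the inductions over segments require.\<close>

definition Words :: "('g, 'm) monoid_scheme \<Rightarrow> (nat \<times> 'g) list set" where
  "Words G = {w. distinct (map fst w) \<and> snd ` set w \<subseteq> carrier G}"

lemma Words_take_drop: "w \<in> Words G \<Longrightarrow> take b w \<in> Words G" "w \<in> Words G \<Longrightarrow> drop b w \<in> Words G"
  by (auto simp: Words_def take_map[symmetric] drop_map[symmetric] dest: in_set_takeD in_set_dropD)

lemma cprod_eq_0: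
  assumes "\<And>x s. length s \<noteq> sz x \<Longrightarrow> k x s = 0"
  shows "length w \<noteq> sum_list (map sz a) \<Longrightarrow> cprod (map k a) w = 0"
proof (induction a arbitrary: w)
  case (Cons x a)
  have "k x (take i w) * cprod (map k a) (drop i w) = 0" if "i \<le> length w" for i
    using assms[of "take i w" x] Cons.IH[of "drop i w"] Cons.prems that by (cases "i = sz x") auto
  then show ?case by (simp add: conv_sum)
qed (auto simp: counit_def)

text \<open>When every factor lives in a single degree, only one cut of the word contributes to the
  convolution.\<close>

lemma cprod_map_append:
  assumes "\<And>x s. length s \<noteq> sz x \<Longrightarrow> k x s = 0"
  shows "cprod (map k (a @ c)) w = (if sum_list (map sz a) \<le> length w
    then cprod (map k a) (take (sum_list (map sz a)) w) * cprod (map k c) (drop (sum_list (map sz a)) w) else 0)"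
proof -
  let ?m = "sum_list (map sz a)"
  have z: "cprod (map k a) (take i w) * cprod (map k c) (drop i w) = 0" if "i \<le> length w" "i \<noteq> ?m" for i
    using cprod_eq_0[of sz k "take i w" a] assms that by auto
  have "cprod (map k (a @ c)) w = (\<Sum>i\<le>length w. cprod (map k a) (take i w) * cprod (map k c) (drop i w))"
    by (simp add: cprod_append conv_sum)
  also have "\<dots> = (\<Sum>i\<in>(if ?m \<le> length w then {?m} else {}). cprod (map k a) (take i w) * cprod (map k c) (drop i w))"
    by (rule sum.mono_neutral_right) (use z in \<open>auto split: if_splits\<close>)
  finally show ?thesis by simp
qed

lemma cprod_map_untwist:
  assumes "\<And>x s. x \<in> set a \<Longrightarrow> s \<in> Words G \<Longrightarrow> k x (untwist G h s) = \<chi> x * k x s"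
  shows "s \<in> Words G \<Longrightarrow> cprod (map k a) (untwist G h s) = prod_list (map \<chi> a) * cprod (map k a) s"
  using assms
proof (induction a arbitrary: s)
  case (Cons x a)
  have "k x (untwist G h (take i s)) * cprod (map k a) (untwist G h (drop i s))
      = prod_list (map \<chi> (x # a)) * (k x (take i s) * cprod (map k a) (drop i s))" for i
    using Cons.IH[of "drop i s"] Cons.prems(2)[of x "take i s"] Words_take_drop[OF Cons.prems(1)] Cons.prems(2)
    by (simp add: mult_ac)
  then show ?case by (simp add: conv_sum take_untwist drop_untwist sum_distrib_left del: prod_list.Cons)
qed (auto simp: counit_def untwist_def)

text \<open>The reason why the span for a fixed support is a right ideal. The factors
  \<open>a\<close> given to the first segment are eigenvectors of \<open>untwist\<close> and produce
  a scalar; by induction the others, \<open>c\<close>, give combinations of rearrangements \<beta>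
  of \<open>c\<close>; homogeneity glues the values of \<open>a\<close> and \<beta> on the two
  pieces into the product for \<open>a @ \<beta>\<close>.\<close>

lemma seg_sum_cprod_combs:
  assumes sz: "\<And>x s. length s \<noteq> sz x \<Longrightarrow> k x s = 0"
    and prim: "\<And>x. x \<in> set \<alpha> \<Longrightarrow> primitive (k x)"
    and untwist: "\<And>x h s. x \<in> set \<alpha> \<Longrightarrow> h \<in> snd ` set p \<Longrightarrow> s \<in> Words G \<Longrightarrow> k x (untwist G h s) = \<chi> x h * k x s"
  shows "seg_sum G p (cprod (map k \<alpha>)) \<in> combs (Words G) {\<beta>. mset \<beta> = mset \<alpha>} (\<lambda>\<beta>. cprod (map k \<beta>))"
  using prim untwist
proof (induction p arbitrary: \<alpha>)
  case Nil
  show ?case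
  proof (cases "\<alpha> = []")
    case True
    then show ?thesis
      by (intro combs_cong[OF combs_base[where \<beta> = "[]"]]) (auto simp: counit_def)
  next
    case False
    then obtain x \<alpha>' where \<alpha>: "\<alpha> = x # \<alpha>'" by (cases \<alpha>) auto
    then have "k x [] = 0" using Nil by (auto simp: primitive_def)
    then show ?thesis
      by (intro combs_cong[OF combs_zero]) (auto simp: \<alpha>)
  qed
next
  case (Cons bh p)
  obtain b h where bh: "bh = (b, h)" by force
  let ?C = "combs (Words G) {\<beta>. mset \<beta> = mset \<alpha>} (\<lambda>\<beta>. cprod (map k \<beta>))"
  define F where "F a c w = (if b \<le> length w then prod_list (map (\<lambda>x. \<chi> x h) a) *
     (cprod (map k a) (take b w) * seg_sum G p (cprod (map k c)) (drop b w)) else 0)" for a c w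
  have F: "F a c \<in> ?C" if ac: "mset a + mset c = mset \<alpha>" for a c
  proof -
    have "set c \<subseteq> set \<alpha>" using ac by (metis mset_subset_eq_add_right set_mset_mono set_mset_mset)
    then have "seg_sum G p (cprod (map k c)) \<in> combs (Words G) {\<beta>. mset \<beta> = mset c} (\<lambda>\<beta>. cprod (map k \<beta>))"
    proof (intro Cons.IH)
      fix x h s assume "set c \<subseteq> set \<alpha>" "x \<in> set c" "h \<in> snd ` set p" "s \<in> Words G"
      then show "k x (untwist G h s) = \<chi> x h * k x s" by (intro Cons.prems(2)) auto
    qed (use Cons.prems(1) in auto)
    then obtain d where d: "\<And>w. w \<in> Words G \<Longrightarrow>
        seg_sum G p (cprod (map k c)) w = (\<Sum>\<beta>\<in>{\<beta>. mset \<beta> = mset c}. d \<beta> * cprod (map k \<beta>) w)"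
      unfolding combs_def by blast
    \<comment> \<open>If the sizes in \<open>a\<close> do not add up to the length \<open>b\<close>
      of the segment, then \<open>a\<close> vanishes on it. Otherwise the cut after \<open>b\<close>
      letters is exactly the one that contributes for \<open>a @ \<beta>\<close>.\<close>
    let ?s = "if b = sum_list (map sz a) then prod_list (map (\<lambda>x. \<chi> x h) a) else 0"
    have eq: "F a c w = ?s * (\<Sum>\<beta>\<in>{\<beta>. mset \<beta> = mset c}. d \<beta> * cprod (map k (a @ \<beta>)) w)" if w: "w \<in> Words G" for w
    proof (cases "b = sum_list (map sz a)")
      case True
      show ?thesis
        using d[OF Words_take_drop(2)[OF w, of b]] True
        by (auto simp: F_def cprod_map_append[of sz k, OF sz] sum_distrib_left mult_ac simp del: map_append)
    next
      case False
      then have "b \<le> length w \<Longrightarrow> cprod (map k a) (take b w) = 0"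
        by (intro cprod_eq_0[of sz]) (use sz in auto)
      then show ?thesis using False by (simp add: F_def)
    qed
    show ?thesis
    proof (rule combs_cong[OF _ eq], intro combs_cmult combs_sum)
      fix \<beta> assume "\<beta> \<in> {\<beta>. mset \<beta> = mset c}"
      then show "cprod (map k (a @ \<beta>)) \<in> ?C"
        by (intro combs_base[where \<beta> = "a @ \<beta>"] finite_mset_eq) (simp add: ac)
    qed
  qed
  show ?case
  proof (rule combs_cong[OF combs_split_sum[OF F]])
    fix w assume w: "w \<in> Words G"
    show "seg_sum G (bh # p) (cprod (map k \<alpha>)) w = split_sum (\<lambda>a c. F a c w) \<alpha>"
    proof (cases "b \<le> length w")
      case True
      have "seg_sum G (bh # p) (cprod (map k \<alpha>)) w
        = split_sum (\<lambda>a c. cprod (map k a) (untwist G h (take b w)) * seg_sum G p (cprod (map k c)) (drop b w)) \<alpha>"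
        using seg_sum_Cons_cprod[of "map k \<alpha>" w b G h p] Cons.prems(1) True w
        by (auto simp: Words_def split_sum_map bh simp del: seg_sum.simps)
      also have "\<dots> = split_sum (\<lambda>a c. F a c w) \<alpha>"
      proof (rule split_sum_cong)
        fix a c assume ac: "mset a + mset c = mset \<alpha>"
        have "set a \<subseteq> set \<alpha>" using ac by (metis mset_subset_eq_add_left set_mset_mono set_mset_mset)
        then have "cprod (map k a) (untwist G h (take b w)) = prod_list (map (\<lambda>x. \<chi> x h) a) * cprod (map k a) (take b w)"
          using Cons.prems(2) bh w by (intro cprod_map_untwist) (auto simp: Words_take_drop)
        then show "cprod (map k a) (untwist G h (take b w)) * seg_sum G p (cprod (map k c)) (drop b w) = F a c w"
          using True by (simp add: F_def)
      qed
      finally show ?thesis .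
    next
      case False
      then show ?thesis by (simp add: bh F_def split_sum_zero)
    qed
  qed
qed

section \<open>Compositions\<close>

lemma compatible_Nil: "compatible w [] \<longleftrightarrow> w = []"
  by (auto simp: compatible_def)

lemma compatible_Cons:
  "compatible w ((a, h) # p) \<longleftrightarrow> a \<le> length w \<and> incr h (take a w) \<and> compatible (drop a w) p"
proof
  assume "compatible w ((a, h) # p)"
  then show "a \<le> length w \<and> incr h (take a w) \<and> compatible (drop a w) p"
    by (auto simp: compatible_def list_all2_Cons1 incr_def)
next
  assume *: "a \<le> length w \<and> incr h (take a w) \<and> compatible (drop a w) p"
  then obtain ws where "concat ws = drop a w"
    "list_all2 (\<lambda>(a, h) s. length s = a \<and> sorted_wrt (<) (map fst s) \<and> (\<forall>x\<in>set s. snd x = h)) p ws"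
    by (auto simp: compatible_def)
  with * show "compatible w ((a, h) # p)"
    unfolding compatible_def by (intro exI[of _ "take a w # ws"]) (auto simp: incr_def)
qed

lemma compatible_length: "compatible w q \<Longrightarrow> length w = sum_list (map fst q)"
proof (induction q arbitrary: w)
  case (Cons x q)
  then show ?case using Cons.IH[of "drop (fst x) w"] by (cases x) (auto simp: compatible_Cons)
qed (simp add: compatible_Nil)

lemma compatible_append:
  "compatible w (q @ q') \<longleftrightarrow> sum_list (map fst q) \<le> length w \<and>
     compatible (take (sum_list (map fst q)) w) q \<and> compatible (drop (sum_list (map fst q)) w) q'"
proof (induction q arbitrary: w)
  case (Cons x q)
  show ?case
    by (cases x) (auto simp: compatible_Cons Cons.IH take_drop add.commute min_def)
qed (auto simp: compatible_Nil)

definition block :: "nat \<times> 'l \<Rightarrow> (nat \<times> 'l) list \<Rightarrow> bool" where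
  "block x b \<longleftrightarrow> sum_list (map fst b) = fst x \<and> (\<forall>y\<in>set b. snd y = snd x)"

lemma splitting_iff: "splitting p q qs \<longleftrightarrow> concat qs = q \<and> list_all2 block p qs"
  by (auto simp: splitting_def block_def[abs_def] case_prod_unfold)

lemma refines_Nil: "[] \<preceq> q \<longleftrightarrow> q = []"
  by (auto simp: refines_def splitting_iff)

lemma refines_Cons: "x # p \<preceq> q \<longleftrightarrow> (\<exists>q1 q2. q = q1 @ q2 \<and> block x q1 \<and> p \<preceq> q2)"
proof
  assume "x # p \<preceq> q"
  then show "\<exists>q1 q2. q = q1 @ q2 \<and> block x q1 \<and> p \<preceq> q2"
    by (fastforce simp: refines_def splitting_iff list_all2_Cons1)
next
  assume "\<exists>q1 q2. q = q1 @ q2 \<and> block x q1 \<and> p \<preceq> q2"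
  then obtain q1 qs where "q = q1 @ concat qs" "block x q1" "list_all2 block p qs"
    by (auto simp: refines_def splitting_iff)
  then show "x # p \<preceq> q"
    unfolding refines_def splitting_iff by (intro exI[of _ "q1 # qs"]) auto
qed

definition positive :: "(nat \<times> 'l) list \<Rightarrow> bool" where
  "positive p \<longleftrightarrow> (\<forall>x\<in>set p. 0 < fst x)"

lemma positive_simps [simp]: "positive []" "positive (x # p) \<longleftrightarrow> 0 < fst x \<and> positive p"
  "positive (p @ q) \<longleftrightarrow> positive p \<and> positive q"
  by (auto simp: positive_def)

lemma block_length: "block x b \<Longrightarrow> 0 < fst x \<Longrightarrow> 0 < length b"
  by (auto simp: block_def)

lemma refines_length: "p \<preceq> q \<Longrightarrow> positive p \<Longrightarrow> length p \<le> length q"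
proof (induction p arbitrary: q)
  case (Cons x p)
  then obtain q1 q2 where q: "q = q1 @ q2" "block x q1" "p \<preceq> q2" by (auto simp: refines_Cons)
  have "0 < length q1" using q Cons.prems by (intro block_length[of x]) auto
  moreover have "length p \<le> length q2" using Cons.IH[of q2] Cons.prems q by auto
  ultimately show ?case unfolding q(1) length_append length_Cons by linarith
qed auto

text \<open>Proper refinement strictly increases the number of parts. Besides antisymmetry, this
  supplies the induction measure of all triangularity arguments below.\<close>

lemma refines_length_eq: "p \<preceq> q \<Longrightarrow> positive p \<Longrightarrow> length q \<le> length p \<Longrightarrow> p = q"
proof (induction p arbitrary: q)
  case (Cons x p)
  then obtain q1 q2 where q: "q = q1 @ q2" "block x q1" "p \<preceq> q2" by (auto simp: refines_Cons)
  have "length p \<le> length q2" using q Cons.prems refines_length by auto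
  moreover have "0 < length q1" using q Cons.prems by (intro block_length[of x]) auto
  moreover have "length q1 + length q2 \<le> Suc (length p)" using q Cons.prems by simp
  ultimately have "length q1 = 1" "length q2 \<le> length p" by linarith+
  then obtain y where "q1 = [y]" by (auto simp: length_Suc_conv)
  then show ?case using q Cons.IH[of q2] \<open>length q2 \<le> length p\<close> Cons.prems
    by (auto simp: block_def prod_eq_iff)
qed (auto simp: refines_Nil)

lemma refines_antisym: "p \<preceq> q \<Longrightarrow> q \<preceq> p \<Longrightarrow> positive p \<Longrightarrow> positive q \<Longrightarrow> p = q"
  using refines_length refines_length_eq by blast

lemma refines_refl: "p \<preceq> p"
proof (induction p)
  case (Cons x p)
  then show ?case unfolding refines_Cons by (intro exI[of _ "[x]"] exI[of _ p]) (auto simp: block_def)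
qed (simp add: refines_Nil)

lemma compatible_block:
  "incr h s \<Longrightarrow> block (length s, h) q \<Longrightarrow> compatible s q"
proof (induction q arbitrary: s)
  case (Cons x q)
  obtain b where x: "x = (b, h)" using Cons.prems by (cases x) (auto simp: block_def)
  have "incr h (take b s)" "incr h (drop b s)"
    using Cons.prems by (auto simp: incr_def sorted_wrt_take sorted_wrt_drop take_map[symmetric] drop_map[symmetric]
        dest: in_set_takeD in_set_dropD)
  then show ?case using Cons x by (auto simp: compatible_Cons block_def)
qed (auto simp: compatible_Nil block_def)

lemma compatible_refines: "compatible w p \<Longrightarrow> p \<preceq> q \<Longrightarrow> compatible w q"
proof (induction p arbitrary: w q)
  case (Cons x p)
  then obtain q1 q2 where q: "q = q1 @ q2" "block x q1" "p \<preceq> q2" by (auto simp: refines_Cons)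
  obtain a h where x: "x = (a, h)" by force
  then show ?case
    using Cons q compatible_block[of h "take a w" q1]
    by (auto simp: compatible_Cons compatible_append block_def)
qed (auto simp: refines_Nil)

section \<open>Runs of a word, the explicit form of \<open>co\<close>\<close>

fun runs :: "(nat \<times> 'g) list \<Rightarrow> (nat \<times> 'g) list" where
  "runs [] = []"
| "runs (x # w) = (case runs w of
      [] \<Rightarrow> [(1, snd x)]
    | (a, g) # p \<Rightarrow> if snd x = g \<and> fst x < fst (hd w) then (Suc a, g) # p else (1, snd x) # (a, g) # p)"

lemma runs_props:
  "compatible w (runs w)" "positive (runs w)" "snd ` set (runs w) \<subseteq> snd ` set w"
proof (induction w)
  case (Cons x w)
  have "compatible (x # w) (runs (x # w)) \<and> positive (runs (x # w)) \<and> snd ` set (runs (x # w)) \<subseteq> snd ` set (x # w)"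
  proof (cases "runs w")
    case Nil
    then show ?thesis using Cons by (auto simp: compatible_Cons compatible_Nil incr_Cons)
  next
    case (Cons y p)
    obtain a g where y: "y = (a, g)" by force
    have w: "a \<le> length w" "0 < a" "incr g (take a w)" "compatible (drop a w) p"
      using Cons.IH Cons y by (auto simp: compatible_Cons)
    \<comment> \<open>The first run increases, so a comparison of \<open>x\<close> with the head of
      \<open>w\<close> settles the comparison with the whole run.\<close>
    then have "fst (hd w) \<le> fst z" if "z \<in> set (take a w)" for z
      using that by (cases w; cases a) (auto simp: incr_Cons)
    then have "\<forall>z\<in>set (take a w). fst x < fst z" if "fst x < fst (hd w)"
      using that by fastforce
    then show ?thesis using Cons.IH Cons y w
      by (auto simp: compatible_Cons incr_Cons)
  qed
  then show "compatible (x # w) (runs (x # w))" "positive (runs (x # w))"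
    "snd ` set (runs (x # w)) \<subseteq> snd ` set (x # w)" by auto
qed (auto simp: compatible_Nil)

lemma runs_refines: "compatible w q \<Longrightarrow> positive q \<Longrightarrow> runs w \<preceq> q"
proof (induction w arbitrary: q)
  case Nil
  then show ?case by (cases q) (auto simp: compatible_Cons refines_Nil)
next
  case (Cons x w)
  obtain b h q' where q: "q = (Suc b, h) # q'"
    using Cons.prems by (cases q; cases "fst (hd q)") (auto simp: compatible_Nil prod_eq_iff)
  have *: "b \<le> length w" "incr h (x # take b w)" "compatible (drop b w) q'"
    using Cons.prems q by (auto simp: compatible_Cons)
  show ?case
  proof (cases "b = 0")
    case True
    then have r: "runs w \<preceq> q'" using * Cons q by auto
    have "(1, snd x) # runs w \<preceq> q"
      unfolding refines_Cons using True * r q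
      by (intro exI[of _ "[(1, h)]"] exI[of _ q']) (auto simp: block_def incr_Cons)
    \<comment> \<open>Here \<open>q\<close> cuts directly after \<open>x\<close> although
      \<open>x\<close> belongs to the run that follows. The part \<open>(1, h)\<close> is then added
      to the block refining that run.\<close>
    moreover have "(Suc a, snd x) # p \<preceq> q" if rw: "runs w = (a, snd x) # p" for a p
    proof -
      obtain q1 q2 where "q' = q1 @ q2" "block (a, snd x) q1" "p \<preceq> q2"
        using r unfolding rw refines_Cons by blast
      then show ?thesis
        unfolding refines_Cons using True * q
        by (intro exI[of _ "(1, h) # q1"] exI[of _ q2]) (auto simp: block_def incr_Cons)
    qed
    ultimately show ?thesis by (auto split: list.splits)
  next
    case False
    \<comment> \<open>The first segment of \<open>q\<close> contains both \<open>x\<close> and the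
      next letter, so \<open>runs\<close> joins \<open>x\<close> to the following run; removing
      \<open>x\<close> from both sides permits induction.\<close>
    have "compatible w ((b, h) # q')" using * by (auto simp: compatible_Cons incr_Cons)
    then have r: "runs w \<preceq> (b, h) # q'" using Cons False q by auto
    have "w \<noteq> []" using * False by auto
    have "runs w \<noteq> []" using r by (auto simp: refines_Nil)
    then obtain a g p where rw: "runs w = (a, g) # p" by (cases "runs w") auto
    then have "0 < a" using runs_props(2)[of w] by simp
    obtain q1 q2 where q12: "(b, h) # q' = q1 @ q2" "block (a, g) q1" "p \<preceq> q2"
      using r rw by (auto simp: refines_Cons)
    moreover have "q1 \<noteq> []" using block_length[OF q12(2)] \<open>0 < a\<close> by auto
    ultimately obtain q1' where q1: "q1 = (b, h) # q1'" "q' = q1' @ q2" by (cases q1) auto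
    have "g = h" "snd x = h" using q12(2) q1 * by (auto simp: block_def incr_Cons)
    moreover have "fst x < fst (hd w)"
      using *(2) \<open>w \<noteq> []\<close> False by (cases w; cases b) (auto simp: incr_Cons)
    moreover have "(Suc a, g) # p \<preceq> q"
      unfolding refines_Cons using q12 q1 q \<open>g = h\<close>
      by (intro exI[of _ "(Suc b, h) # q1'"] exI[of _ q2]) (auto simp: block_def)
    ultimately show ?thesis using rw by simp
  qed
qed

lemma Gamma_iff: "p \<in> Gamma n L \<longleftrightarrow> positive p \<and> snd ` set p \<subseteq> L \<and> sum_list (map fst p) = n"
  by (auto simp: Gamma_def positive_def)

lemma finite_Gamma:
  assumes "finite L"
  shows "finite (Gamma n L)"
proof (rule finite_subset)
  show "Gamma n L \<subseteq> {p. set p \<subseteq> {..n} \<times> L \<and> length p \<le> n}"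
  proof
    fix p assume "p \<in> Gamma n L"
    then have p: "positive p" "snd ` set p \<subseteq> L" "sum_list (map fst p) = n" by (auto simp: Gamma_iff)
    have "fst x \<le> n" if "x \<in> set p" for x
      using p(3) member_le_sum_list[of "fst x" "map fst p"] that by auto
    moreover have "length p \<le> sum_list (map fst p)" using p(1)
      by (induction p) auto
    ultimately show "p \<in> {p. set p \<subseteq> {..n} \<times> L \<and> length p \<le> n}" using p by auto
  qed
  show "finite {p. set p \<subseteq> {..n} \<times> L \<and> length p \<le> n}"
    using assms by (intro finite_lists_length_le) auto
qed

lemma wreath_carrier_iff:
  "w \<in> carrier (wreath n G) \<longleftrightarrow>
     distinct (map fst w) \<and> fst ` set w = {1..n} \<and> snd ` set w \<subseteq> carrier G"
  by (auto simp: wreath_def permutations_of_set_def)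

lemma wreath_length: "w \<in> carrier (wreath n G) \<Longrightarrow> length w = n"
  using distinct_card[of "map fst w"] by (simp add: wreath_carrier_iff)

lemma wreath_Words: "w \<in> carrier (wreath n G) \<Longrightarrow> w \<in> Words G"
  by (simp add: wreath_carrier_iff Words_def)

lemma finite_wreath:
  assumes "finite (carrier G)"
  shows "finite (carrier (wreath n G))"
proof (rule finite_subset)
  show "carrier (wreath n G) \<subseteq> {w. set w \<subseteq> {1..n} \<times> carrier G \<and> length w = n}"
  proof
    fix w assume w: "w \<in> carrier (wreath n G)"
    then have "set w \<subseteq> (fst ` set w) \<times> (snd ` set w)" by force
    then show "w \<in> {w. set w \<subseteq> {1..n} \<times> carrier G \<and> length w = n}"
      using w wreath_length[OF w] unfolding wreath_carrier_iff by blast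
  qed
  show "finite {w. set w \<subseteq> {1..n} \<times> carrier G \<and> length w = n}"
    using assms by (intro finite_lists_length_eq) auto
qed

lemma runs_Gamma: "w \<in> carrier (wreath n G) \<Longrightarrow> runs w \<in> Gamma n (carrier G)"
  using runs_props[of w] compatible_length[OF runs_props(1)[of w]] wreath_length[of w n G]
  by (auto simp: Gamma_iff wreath_carrier_iff)

lemma co_eq_runs:
  assumes "w \<in> carrier (wreath n G)"
  shows "co n G w = runs w"
  unfolding co_def
proof (rule the_equality)
  show "runs w \<in> Gamma n (carrier G) \<and> compatible w (runs w) \<and>
      (\<forall>q\<in>Gamma n (carrier G). compatible w q \<longrightarrow> runs w \<preceq> q)"
    using runs_Gamma[OF assms] runs_props[of w] runs_refines by (auto simp: Gamma_iff)
next
  fix p assume "p \<in> Gamma n (carrier G) \<and> compatible w p \<and>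
      (\<forall>q\<in>Gamma n (carrier G). compatible w q \<longrightarrow> p \<preceq> q)"
  then show "p = runs w"
    using runs_Gamma[OF assms] runs_props[of w] runs_refines[of w p]
    by (intro refines_antisym) (auto simp: Gamma_iff)
qed

lemma sum_fun_apply: "sum f A x = (\<Sum>a\<in>A. f a x)"
  by (induction A rule: infinite_finite_induct) auto

lemma Y_apply:
  assumes "finite (carrier G)"
  shows "Y n G p w = of_bool (w \<in> carrier (wreath n G) \<and> runs w = p)"
proof -
  let ?S = "{w \<in> carrier (wreath n G). co n G w = p}"
  have "finite ?S" using finite_wreath[OF assms] by simp
  then have "Y n G p w = of_bool (w \<in> ?S)"
    by (simp add: Y_def sum_fun_apply basis_elt_def of_bool_def)
  then show ?thesis by (auto simp: co_eq_runs)
qed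

text \<open>The composition of a word is its least compatible one, and compatibility passes to
  refinements. Hence \<open>co\<close> of \<open>w\<close> lies below \<open>p\<close> exactly when
  \<open>w\<close> is compatible with \<open>p\<close>, and the sum over \<open>q\<close> collapses
  to an indicator.\<close>

lemma X_apply:
  assumes "finite (carrier G)" "p \<in> Gamma n (carrier G)"
  shows "X n G p w = of_bool (w \<in> carrier (wreath n G) \<and> compatible w p)"
proof -
  let ?S = "{q \<in> Gamma n (carrier G). q \<preceq> p}"
  have fin: "finite ?S" using finite_Gamma[OF assms(1)] by simp
  have "X n G p w = (\<Sum>q\<in>?S. if q = runs w then of_bool (w \<in> carrier (wreath n G)) else 0)"
    unfolding X_def sum_fun_apply by (intro sum.cong) (auto simp: Y_apply assms)
  also have "\<dots> = of_bool (w \<in> carrier (wreath n G) \<and> runs w \<in> ?S)"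
    using fin by (subst sum.delta) auto
  also have "\<dots> = of_bool (w \<in> carrier (wreath n G) \<and> compatible w p)"
    using runs_Gamma[of w n G] compatible_refines[OF runs_props(1)[of w], of p] runs_refines[of w p] assms(2)
    by (auto simp: Gamma_iff)
  finally show ?thesis .
qed

text \<open>A permutation with prescribed runs: the values of a block exceed those of all later
  blocks, so there is a descent at each border even if the labels agree.\<close>

fun run_word :: "(nat \<times> 'g) list \<Rightarrow> (nat \<times> 'g) list" where
  "run_word [] = []"
| "run_word ((a, g) # q) =
     map (\<lambda>i. (i, g)) [Suc (sum_list (map fst q))..<Suc (sum_list (map fst q) + a)] @ run_word q"

lemma runs_upt:
  "0 < a \<Longrightarrow> w = [] \<or> fst (hd w) \<le> m \<Longrightarrow>
    runs (map (\<lambda>i. (i, g)) [Suc m..<Suc (m + a)] @ w) = (a, g) # runs w"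
proof (induction a arbitrary: m)
  case (Suc a)
  have eq: "[Suc m..<Suc (m + Suc a)] = Suc m # [Suc (Suc m)..<Suc (Suc m + a)]"
    by (subst upt_conv_Cons) auto
  show ?case
  proof (cases "a = 0")
    case True
    have "runs w = [] \<or> w \<noteq> []" by (cases w) auto
    then show ?thesis using True Suc.prems by (auto simp: not_less split: list.splits)
  next
    case False
    then have "runs (map (\<lambda>i. (i, g)) [Suc (Suc m)..<Suc (Suc m + a)] @ w) = (a, g) # runs w"
      using Suc.prems by (intro Suc.IH) auto
    moreover have "fst (hd (map (\<lambda>i. (i, g)) [Suc (Suc m)..<Suc (Suc m + a)] @ w)) = Suc (Suc m)"
      using False by (simp add: upt_conv_Cons del: upt_Suc)
    ultimately show ?thesis unfolding eq by simp
  qed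
qed simp

lemma run_word_set:
  "distinct (map fst (run_word q)) \<and> fst ` set (run_word q) = {1..sum_list (map fst q)} \<and>
    snd ` set (run_word q) \<subseteq> snd ` set q"
proof (induction q)
  case (Cons x q)
  obtain a g where x: "x = (a, g)" by force
  let ?m = "sum_list (map fst q)"
  have "map fst (run_word (x # q)) = [Suc ?m..<Suc (?m + a)] @ map fst (run_word q)"
    by (simp add: x o_def del: upt_Suc)
  moreover from this have "fst ` set (run_word (x # q)) = {Suc ?m..<Suc (?m + a)} \<union> {1..?m}"
    using Cons by (metis list.set_map set_append set_upt)
  moreover have "{Suc ?m..<Suc (?m + a)} \<union> {1..?m} = {1..sum_list (map fst (x # q))}" by (auto simp: x)
  moreover have "snd ` set (run_word (x # q)) \<subseteq> snd ` set (x # q)" using Cons by (auto simp: x)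
  moreover have "{Suc ?m..<Suc (?m + a)} \<inter> {Suc 0..?m} = {}" by auto
  ultimately show ?case using Cons by (simp del: upt_Suc)
qed auto

lemma runs_run_word: "positive q \<Longrightarrow> runs (run_word q) = q"
proof (induction q)
  case (Cons x q)
  obtain a g where x: "x = (a, g)" by force
  have "run_word q = [] \<or> fst (hd (run_word q)) \<le> sum_list (map fst q)"
  proof (cases "run_word q")
    case (Cons y ys)
    then have "fst y \<in> {1..sum_list (map fst q)}" using run_word_set[of q] by (metis image_eqI list.set_intros(1))
    then show ?thesis using Cons by simp
  qed simp
  then show ?case using Cons x runs_upt[of a "run_word q" "sum_list (map fst q)" g] by simp
qed simp

lemma run_word_wreath: "q \<in> Gamma n (carrier G) \<Longrightarrow> run_word q \<in> carrier (wreath n G)"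
  using run_word_set[of q] unfolding Gamma_iff wreath_carrier_iff by blast

text \<open>Triangularity: \<open>run_word q\<close> is compatible only with refinements of
  \<open>q\<close>, and these are longer than \<open>q\<close> unless equal to it. The induction
  descends from the longest compositions.\<close>

lemma compatible_indep:
  assumes fin: "finite (carrier G)"
    and z: "\<And>w. w \<in> carrier (wreath n G) \<Longrightarrow> (\<Sum>q\<in>Gamma n (carrier G). d q * of_bool (compatible w q)) = (0::complex)"
    and q: "q \<in> Gamma n (carrier G)"
  shows "d q = 0"
proof -
  have "q \<in> Gamma n (carrier G) \<Longrightarrow> d q = 0" if "n - length q = m" for m q
    using that
  proof (induction m arbitrary: q rule: less_induct)
    case (less m)
    have len: "length p \<le> n" if "p \<in> Gamma n (carrier G)" for p
    proof -
      have "positive p \<Longrightarrow> length p \<le> sum_list (map fst p)" by (induction p) auto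
      then show ?thesis using that by (auto simp: Gamma_iff)
    qed
    have zero: "d p * of_bool (compatible (run_word q) p) = 0" if p: "p \<in> Gamma n (carrier G)" "p \<noteq> q" for p
    proof (cases "compatible (run_word q) p")
      case True
      then have "q \<preceq> p" using runs_refines[OF True] runs_run_word[of q] p less.prems by (auto simp: Gamma_iff)
      then have "length q < length p"
        using refines_length_eq[of q p] p less.prems by (auto simp: Gamma_iff not_less[symmetric])
      then have "d p = 0" using less.IH[of "n - length p" p] less.prems len[OF p(1)] p by auto
      then show ?thesis by simp
    qed simp
    have "compatible (run_word q) q"
      using runs_props(1)[of "run_word q"] runs_run_word[of q] less.prems by (simp add: Gamma_iff)
    then have "d q = (\<Sum>p\<in>{q}. d p * of_bool (compatible (run_word q) p))" by simp
    also have "\<dots> = (\<Sum>p\<in>Gamma n (carrier G). d p * of_bool (compatible (run_word q) p))"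
      by (rule sum.mono_neutral_left) (use zero less.prems finite_Gamma[OF fin] in auto)
    also have "\<dots> = 0" by (rule z[OF run_word_wreath[OF less.prems(1)]])
    finally show ?case .
  qed
  then show ?thesis using q by blast
qed

section \<open>The inner sums of f as products of logarithms\<close>

definition inc_ind :: "'g \<Rightarrow> (nat \<times> 'g) list \<Rightarrow> complex" where
  "inc_ind g u = of_bool (incr g u)"

lemma inc_ind_Nil [simp]: "inc_ind g [] = 1"
  by (simp add: inc_ind_def)

lemma multiplicative_inc_ind: "multiplicative (inc_ind g)"
  unfolding multiplicative_def inc_ind_def[abs_def] by (intro allI impI shuf_sum_incr)

text \<open>The homogeneous component of the logarithm in degree \<open>fst x\<close>. Keeping one
  degree per factor makes a product of such factors remember the sizes of the parts.\<close>

definition log_part :: "nat \<times> 'g \<Rightarrow> (nat \<times> 'g) list \<Rightarrow> complex" where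
  "log_part x s = (if length s = fst x then clog (inc_ind (snd x)) s else 0)"

lemma log_part_length: "length s \<noteq> fst x \<Longrightarrow> log_part x s = 0"
  by (simp add: log_part_def)

definition blocks :: "nat \<Rightarrow> nat \<times> 'g \<Rightarrow> (nat \<times> 'g) list set" where
  "blocks d x = {q. positive q \<and> length q = d \<and> block x q}"

lemma blocks_0: "blocks 0 x = (if fst x = 0 then {[]} else {})"
  by (auto simp: blocks_def block_def)

lemma blocks_Suc: "blocks (Suc d) (m, g) = (\<Union>i\<in>{1..m}. (\<lambda>q. (i, g) # q) ` blocks d (m - i, g))"
proof (intro equalityI subsetI)
  fix q assume "q \<in> blocks (Suc d) (m, g)"
  then obtain y q' where "q = y # q'" "fst y \<in> {1..m}" "snd y = g" "q' \<in> blocks d (m - fst y, g)"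
    by (cases q) (auto simp: blocks_def block_def)
  then show "q \<in> (\<Union>i\<in>{1..m}. (\<lambda>q. (i, g) # q) ` blocks d (m - i, g))"
    by (cases y) auto
qed (auto simp: blocks_def block_def)

lemma finite_blocks: "finite (blocks d x)"
proof (induction d arbitrary: x)
  case (Suc d)
  then show ?case by (cases x) (simp add: blocks_Suc)
qed (simp add: blocks_0)

text \<open>The power counts the ways to cut \<open>s\<close> into \<open>d\<close> nonempty
  increasing pieces labelled \<open>g\<close>. Recording the lengths of the pieces turns the cuts
  into compositions compatible with \<open>s\<close>.\<close>

lemma convpow_blocks:
  "convpow (off_Nil (inc_ind g)) d s = (\<Sum>q\<in>blocks d (length s, g). of_bool (compatible s q))"
proof (induction d arbitrary: s)
  case 0
  then show ?case by (auto simp: blocks_0 counit_def compatible_Nil)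
next
  case (Suc d)
  let ?f = "\<lambda>i. off_Nil (inc_ind g) (take i s) * convpow (off_Nil (inc_ind g)) d (drop i s)"
  have "convpow (off_Nil (inc_ind g)) (Suc d) s = (\<Sum>i\<le>length s. ?f i)"
    by (simp add: conv_sum)
  also have "\<dots> = (\<Sum>i\<in>{1..length s}. ?f i)"
    by (rule sum.mono_neutral_right) (auto simp: off_Nil_def not_le)
  also have "\<dots> = (\<Sum>i\<in>{1..length s}. \<Sum>q\<in>(\<lambda>q. (i, g) # q) ` blocks d (length s - i, g). of_bool (compatible s q))"
  proof (rule sum.cong[OF refl])
    fix i assume i: "i \<in> {1..length s}"
    have "(\<Sum>q\<in>(\<lambda>q. (i, g) # q) ` blocks d (length s - i, g). of_bool (compatible s q))
        = (\<Sum>q\<in>blocks d (length s - i, g). inc_ind g (take i s) * of_bool (compatible (drop i s) q))"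
      using i by (subst sum.reindex) (auto simp: inj_on_def compatible_Cons inc_ind_def intro!: sum.cong)
    also have "\<dots> = ?f i"
    proof -
      have "take i s \<noteq> []" using i by auto
      then show ?thesis using Suc.IH[of "drop i s"] by (simp add: off_Nil_def[of _ "take i s"] sum_distrib_left)
    qed
    finally show "?f i = (\<Sum>q\<in>(\<lambda>q. (i, g) # q) ` blocks d (length s - i, g). of_bool (compatible s q))" ..
  qed
  also have "\<dots> = (\<Sum>q\<in>blocks (Suc d) (length s, g). of_bool (compatible s q))"
    unfolding blocks_Suc by (rule sum.UNION_disjoint[symmetric]) (auto simp: finite_blocks)
  finally show ?case .
qed

definition all_blocks :: "nat \<times> 'g \<Rightarrow> (nat \<times> 'g) list set" where
  "all_blocks x = {q. positive q \<and> block x q}"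

lemma all_blocks_UN: "0 < fst x \<Longrightarrow> all_blocks x = (\<Union>d\<in>{1..fst x}. blocks d x)"
proof (intro equalityI subsetI)
  fix q assume x: "0 < fst x" and q: "q \<in> all_blocks x"
  have "positive q \<Longrightarrow> length q \<le> sum_list (map fst q)" by (induction q) auto
  moreover have "1 \<le> length q" using q x block_length[of x q] by (simp add: all_blocks_def Suc_le_eq)
  ultimately have "length q \<in> {1..fst x}" using q by (auto simp: all_blocks_def block_def)
  then show "q \<in> (\<Union>d\<in>{1..fst x}. blocks d x)" using q by (auto simp: all_blocks_def blocks_def)
qed (auto simp: all_blocks_def blocks_def)

lemma finite_all_blocks: "0 < fst x \<Longrightarrow> finite (all_blocks x)"
  by (simp add: all_blocks_UN finite_blocks)

lemma log_part_expand:
  assumes "0 < fst x"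
  shows "log_part x s = (\<Sum>q\<in>all_blocks x. (-1) ^ (length q - 1) / of_nat (length q) * of_bool (compatible s q))"
proof (cases "length s = fst x")
  case True
  have "log_part x s = (\<Sum>d\<in>{1..fst x}. \<Sum>q\<in>blocks d x. (-1) ^ (d - 1) / of_nat d * of_bool (compatible s q))"
    using True by (cases x) (simp add: log_part_def clog_sum convpow_blocks sum_distrib_left)
  also have "\<dots> = (\<Sum>d\<in>{1..fst x}. \<Sum>q\<in>blocks d x. (-1) ^ (length q - 1) / of_nat (length q) * of_bool (compatible s q))"
    by (intro sum.cong refl) (auto simp: blocks_def)
  also have "\<dots> = (\<Sum>q\<in>all_blocks x. (-1) ^ (length q - 1) / of_nat (length q) * of_bool (compatible s q))"
    unfolding all_blocks_UN[OF assms]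
    by (rule sum.UNION_disjoint[symmetric]) (auto simp: finite_blocks, auto simp: blocks_def)
  finally show ?thesis .
next
  case False
  then have "\<not> compatible s q" if "q \<in> all_blocks x" for q
    using that compatible_length[of s q] by (auto simp: all_blocks_def block_def)
  then show ?thesis using False by (simp add: log_part_def)
qed

lemma prefix_unique:
  "positive q1 \<Longrightarrow> positive q1' \<Longrightarrow> q1 @ q2 = q1' @ q2' \<Longrightarrow>
    sum_list (map fst q1) = sum_list (map fst q1') \<Longrightarrow> q1 = q1'"
proof (induction q1 arbitrary: q1')
  case (Cons x q1)
  then show ?case by (cases q1') auto
next
  case Nil
  then show ?case by (cases q1') auto
qed

lemma splitting_unique:
  "positive q \<Longrightarrow> splitting p q qs \<Longrightarrow> splitting p q qs' \<Longrightarrow> qs = qs'"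
proof (induction p arbitrary: q qs qs')
  case (Cons x p)
  then obtain b bs b' bs' where b: "qs = b # bs" "qs' = b' # bs'" "block x b" "block x b'"
      "list_all2 block p bs" "list_all2 block p bs'" "q = b @ concat bs" "q = b' @ concat bs'"
    by (auto simp: splitting_iff list_all2_Cons1)
  have pos: "positive b" "positive b'" "positive (concat bs)"
    using b(7,8) Cons.prems(1) by (metis positive_simps(3))+
  moreover have "b = b'"
    by (rule prefix_unique[of b b' "concat bs" "concat bs'"]) (use b pos in \<open>auto simp: block_def\<close>)
  ultimately have "bs = bs'"
    using b by (intro Cons.IH[of "concat bs"]) (auto simp: splitting_iff)
  then show ?case using b \<open>b = b'\<close> by simp
qed (auto simp: splitting_iff)

lemma split_degree_eq:
  assumes "positive q" "splitting p q qs"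
  shows "split_degree q p = prod_list (map length qs)"
proof -
  have "(THE qs. splitting p q qs) = qs"
    using assms splitting_unique by (intro the_equality) blast+
  then show ?thesis by (simp add: split_degree_def)
qed

lemma split_degree_Nil: "split_degree [] [] = 1"
  using split_degree_eq[of "[]" "[]" "[]"] by (simp add: splitting_iff)

lemma split_degree_append:
  assumes "positive (q1 @ q2)" "block x q1" "p \<preceq> q2"
  shows "split_degree (q1 @ q2) (x # p) = length q1 * split_degree q2 p"
proof -
  obtain qs where qs: "splitting p q2 qs" using assms(3) by (auto simp: refines_def)
  then have "splitting (x # p) (q1 @ q2) (q1 # qs)" using assms(2) by (auto simp: splitting_iff)
  then show ?thesis using split_degree_eq[of "q1 @ q2"] split_degree_eq[of q2 p qs] assms(1) qs by simp
qed

lemma split_degree_refl: "positive p \<Longrightarrow> split_degree p p = 1"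
proof (induction p)
  case (Cons x p)
  then show ?case using split_degree_append[of "[x]" p x p] by (simp add: block_def refines_refl)
qed (simp add: split_degree_Nil)

definition refinements :: "(nat \<times> 'g) list \<Rightarrow> (nat \<times> 'g) list set" where
  "refinements p = {q. positive q \<and> p \<preceq> q}"

lemma refinements_Cons:
  "bij_betw (\<lambda>(q1, q2). q1 @ q2) (all_blocks x \<times> refinements p) (refinements (x # p))"
  unfolding bij_betw_def
proof
  show "inj_on (\<lambda>(q1, q2). q1 @ q2) (all_blocks x \<times> refinements p)"
  proof (rule inj_onI, clarify)
    fix q1 q2 q1' q2' :: "(nat \<times> 'a) list"
    assume *: "q1 \<in> all_blocks x" "q1' \<in> all_blocks x" "q1 @ q2 = q1' @ q2'"
    then have "q1 = q1'"
      using prefix_unique[of q1 q1' q2 q2'] by (auto simp: all_blocks_def block_def)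
    then show "q1 = q1' \<and> q2 = q2'" using * by simp
  qed
  show "(\<lambda>(q1, q2). q1 @ q2) ` (all_blocks x \<times> refinements p) = refinements (x # p)"
    by (fastforce simp: refinements_def all_blocks_def refines_Cons image_iff)
qed

definition refine_coeff :: "(nat \<times> 'g) list \<Rightarrow> (nat \<times> 'g) list \<Rightarrow> complex" where
  "refine_coeff q p = (-1) ^ (length q - length p) / of_nat (split_degree q p)"

text \<open>A refinement of \<open>p\<close> is an independent choice of a block for each part. The
  coefficients of the logarithms multiply: their denominators are the block lengths, with product
  \<open>split_degree\<close>.\<close>

lemma cprod_log_part_expand:
  "positive p \<Longrightarrow> finite (refinements p) \<and>
    cprod (map log_part p) w = (\<Sum>q\<in>refinements p. refine_coeff q p * of_bool (compatible w q))"
proof (induction p arbitrary: w)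
  case Nil
  have "refinements [] = {[] :: (nat \<times> 'a) list}" by (auto simp: refinements_def refines_Nil)
  then show ?case by (simp add: refine_coeff_def split_degree_Nil counit_def compatible_Nil)
next
  case (Cons x p)
  have x: "0 < fst x" and p: "positive p" using Cons.prems by auto
  have fin: "finite (refinements (x # p))"
    using bij_betw_finite[OF refinements_Cons[of x p]] Cons.IH[OF p] finite_all_blocks[OF x] by auto
  have "cprod (map log_part (x # p)) w
      = (if fst x \<le> length w then log_part x (take (fst x) w) * cprod (map log_part p) (drop (fst x) w) else 0)"
    using cprod_map_append[of fst log_part "[x]" p w, OF log_part_length] by simp
  also have "\<dots> = (\<Sum>q1\<in>all_blocks x. \<Sum>q2\<in>refinements p.
      refine_coeff (q1 @ q2) (x # p) * of_bool (compatible w (q1 @ q2)))"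
  proof -
    have "refine_coeff (q1 @ q2) (x # p) * of_bool (compatible w (q1 @ q2))
      = (if fst x \<le> length w then ((-1) ^ (length q1 - 1) / of_nat (length q1) * of_bool (compatible (take (fst x) w) q1))
          * (refine_coeff q2 p * of_bool (compatible (drop (fst x) w) q2)) else 0)"
      if q: "q1 \<in> all_blocks x" "q2 \<in> refinements p" for q1 q2
    proof -
      have "0 < length q1" "length p \<le> length q2"
        using q x p block_length[of x q1] refines_length[of p q2] by (auto simp: all_blocks_def refinements_def)
      \<comment> \<open>The inequalities just shown keep the truncated subtractions exact, so the
        exponents of the signs add up.\<close>
      then have len: "length (q1 @ q2) - length (x # p) = (length q1 - 1) + (length q2 - length p)"
        unfolding length_append length_Cons by linarith
      have deg: "split_degree (q1 @ q2) (x # p) = length q1 * split_degree q2 p"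
        using q by (intro split_degree_append) (auto simp: all_blocks_def refinements_def)
      have "compatible w (q1 @ q2) \<longleftrightarrow> fst x \<le> length w \<and> compatible (take (fst x) w) q1 \<and> compatible (drop (fst x) w) q2"
        using q by (auto simp: compatible_append all_blocks_def block_def)
      then show ?thesis
        unfolding refine_coeff_def len deg by (simp add: power_add)
    qed
    then have "(\<Sum>q1\<in>all_blocks x. \<Sum>q2\<in>refinements p.
        refine_coeff (q1 @ q2) (x # p) * of_bool (compatible w (q1 @ q2)))
      = (\<Sum>q1\<in>all_blocks x. \<Sum>q2\<in>refinements p. (if fst x \<le> length w then
          ((-1) ^ (length q1 - 1) / of_nat (length q1) * of_bool (compatible (take (fst x) w) q1))
          * (refine_coeff q2 p * of_bool (compatible (drop (fst x) w) q2)) else 0))"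
      by (intro sum.cong refl) blast
    moreover have "cprod (map log_part p) (drop (fst x) w)
      = (\<Sum>q\<in>refinements p. refine_coeff q p * of_bool (compatible (drop (fst x) w) q))"
      using Cons.IH[OF p] by blast
    ultimately show ?thesis
      by (simp only: log_part_expand[OF x] sum_product if_True if_False sum.neutral_const split: if_split)
        (intro conjI impI; simp)
  qed
  also have "\<dots> = (\<Sum>q\<in>refinements (x # p). refine_coeff q (x # p) * of_bool (compatible w q))"
    unfolding sum.cartesian_product
    by (subst sum.reindex_bij_betw[OF refinements_Cons, symmetric]) (simp add: case_prod_unfold)
  finally show ?case using fin by blast
qed

lemma block_labels: "block x b \<Longrightarrow> snd ` set b \<subseteq> {snd x}"
  by (auto simp: block_def)

lemma refines_Gamma: "p \<in> Gamma n L \<Longrightarrow> p \<preceq> q \<Longrightarrow> positive q \<Longrightarrow> q \<in> Gamma n L"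
proof (induction p arbitrary: q n)
  case (Cons x p)
  then obtain q1 q2 where q: "q = q1 @ q2" "block x q1" "p \<preceq> q2" by (auto simp: refines_Cons)
  have "q2 \<in> Gamma (sum_list (map fst p)) L"
    by (rule Cons.IH) (use Cons.prems q in \<open>auto simp: Gamma_iff\<close>)
  moreover have "snd x \<in> L" using Cons.prems by (simp add: Gamma_iff)
  then have "snd ` set q1 \<subseteq> L" by (intro order.trans[OF block_labels[OF q(2)]]) simp
  ultimately show ?case using q(1,2) Cons.prems(1,3) by (simp add: Gamma_iff block_def image_Un)
qed (auto simp: refines_Nil)

lemma refinements_Gamma: "p \<in> Gamma n L \<Longrightarrow> refinements p = {q \<in> Gamma n L. p \<preceq> q}"
  using refines_Gamma[of p n L] by (auto simp: refinements_def Gamma_iff)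

lemma cprod_log_part_X:
  assumes "finite (carrier G)" "p \<in> Gamma n (carrier G)" "w \<in> carrier (wreath n G)"
  shows "cprod (map log_part p) w = (\<Sum>q\<in>{q \<in> Gamma n (carrier G). p \<preceq> q}. refine_coeff q p * X n G q w)"
proof -
  have "positive p" using assms(2) by (simp add: Gamma_iff)
  then show ?thesis
    using cprod_log_part_expand[of p w] assms
    by (auto simp: refinements_Gamma[OF assms(2)] X_apply intro!: sum.cong)
qed

text \<open>After collecting by \<open>q\<close>, all coefficients \<open>d q\<close> vanish by
  \<open>compatible_indep\<close>. Since \<open>d p\<close> is \<open>b p\<close> plus contributions
  of strictly coarser, hence shorter, compositions, induction on the length gives the claim.\<close>

lemma cprod_log_part_indep:
  assumes fin: "finite (carrier G)"
    and z: "\<And>w. w \<in> carrier (wreath n G) \<Longrightarrow> (\<Sum>p\<in>Gamma n (carrier G). b p * cprod (map log_part p) w) = (0::complex)"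
    and p: "p \<in> Gamma n (carrier G)"
  shows "b p = 0"
proof -
  let ?\<Gamma> = "Gamma n (carrier G)"
  define d where "d q = (\<Sum>p\<in>?\<Gamma>. if p \<preceq> q then b p * refine_coeff q p else 0)" for q
  have finG: "finite ?\<Gamma>" by (rule finite_Gamma[OF fin])
  have d0: "d q = 0" if "q \<in> ?\<Gamma>" for q
  proof (rule compatible_indep[OF fin _ that])
    fix w assume w: "w \<in> carrier (wreath n G)"
    have "(\<Sum>q\<in>?\<Gamma>. d q * of_bool (compatible w q))
        = (\<Sum>p\<in>?\<Gamma>. \<Sum>q\<in>?\<Gamma>. (if p \<preceq> q then b p * (refine_coeff q p * of_bool (compatible w q)) else 0))"
      unfolding d_def by (subst sum.swap) (auto simp: sum_distrib_right intro!: sum.cong)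
    also have "\<dots> = (\<Sum>p\<in>?\<Gamma>. b p * cprod (map log_part p) w)"
    proof (rule sum.cong[OF refl])
      fix p assume p: "p \<in> ?\<Gamma>"
      have "b p * cprod (map log_part p) w
          = (\<Sum>q\<in>{q \<in> ?\<Gamma>. p \<preceq> q}. b p * (refine_coeff q p * of_bool (compatible w q)))"
        unfolding cprod_log_part_X[OF fin p w] sum_distrib_left
        by (intro sum.cong refl) (simp add: X_apply[OF fin] w)
      also have "\<dots> = (\<Sum>q\<in>?\<Gamma>. (if p \<preceq> q then b p * (refine_coeff q p * of_bool (compatible w q)) else 0))"
        by (rule sum.inter_filter[OF finG])
      finally show "(\<Sum>q\<in>?\<Gamma>. (if p \<preceq> q then b p * (refine_coeff q p * of_bool (compatible w q)) else 0)) = b p * cprod (map log_part p) w" ..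
    qed
    also have "\<dots> = 0" by (rule z[OF w])
    finally show "(\<Sum>q\<in>?\<Gamma>. d q * of_bool (compatible w q)) = 0" .
  qed
  have "p \<in> ?\<Gamma> \<Longrightarrow> b p = 0" for p
  proof (induction "length p" arbitrary: p rule: less_induct)
    case less
    have "d p = (\<Sum>p'\<in>{p}. if p' \<preceq> p then b p' * refine_coeff p p' else 0)"
      unfolding d_def
    proof (rule sum.mono_neutral_right)
      show "\<forall>i\<in>?\<Gamma> - {p}. (if i \<preceq> p then b i * refine_coeff p i else 0) = 0"
      proof
        fix i assume i: "i \<in> ?\<Gamma> - {p}"
        have "b i = 0" if "i \<preceq> p"
        proof (rule less.hyps)
          show "length i < length p"
            using refines_length_eq[OF that] i by (auto simp: Gamma_iff not_less[symmetric])
        qed (use i in auto)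
        then show "(if i \<preceq> p then b i * refine_coeff p i else 0) = 0" by simp
      qed
    qed (use less finG in auto)
    also have "\<dots> = b p"
      using less.prems by (simp add: refines_refl refine_coeff_def split_degree_refl Gamma_iff)
    finally show ?case using d0[OF less.prems] by simp
  qed
  then show ?thesis using p .
qed

section \<open>The product in the wreath product algebra\<close>

text \<open>In general \<open>shuf_sum\<close> counts shuffles with multiplicity. For words without
  common letters the first letter reveals its origin, so each shuffle arises once.\<close>

lemma shuf_sum_eq_sum_shuffles:
  assumes "distinct (map fst (s @ t))"
  shows "shuf_sum F s t = (\<Sum>u\<in>shuffles s t. F u)"
  using assms
proof (induction F s t rule: shuf_sum.induct)
  case (3 F x s y t)
  have xy: "x \<noteq> y" using 3(3) by auto
  have "(\<Sum>u\<in>shuffles (x # s) (y # t). F u)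
      = (\<Sum>u\<in>(#) x ` shuffles s (y # t). F u) + (\<Sum>u\<in>(#) y ` shuffles (x # s) t. F u)"
    unfolding shuffles.simps by (rule sum.union_disjoint) (use xy in auto)
  also have "\<dots> = shuf_sum F (x # s) (y # t)"
    using 3 by (simp add: sum.reindex)
  finally show ?case ..
qed auto

text \<open>The words over which \<open>seg_sum\<close> sums. They will turn out to be the left
  factors u in w = u v with v compatible with \<open>p\<close>.\<close>

fun seg_shuffles :: "('g, 'm) monoid_scheme \<Rightarrow> (nat \<times> 'g) list \<Rightarrow> (nat \<times> 'g) list \<Rightarrow> (nat \<times> 'g) list set" where
  "seg_shuffles G [] w = (if w = [] then {[]} else {})"
| "seg_shuffles G ((b, h) # p) w =
     (if b \<le> length w then (\<Union>u\<in>seg_shuffles G p (drop b w). shuffles (untwist G h (take b w)) u) else {})"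

lemma seg_shuffles_mset: "u \<in> seg_shuffles G p w \<Longrightarrow> mset (map fst u) = mset (map fst w)"
proof (induction p arbitrary: u w)
  case (Cons bh p)
  obtain b h where bh: "bh = (b, h)" by force
  obtain v where v: "v \<in> seg_shuffles G p (drop b w)" "u \<in> shuffles (untwist G h (take b w)) v"
    using Cons.prems by (auto simp: bh split: if_splits)
  have "mset u = mset (untwist G h (take b w)) + mset v"
    using v(2) by (rule mset_shuffles)
  then have "mset (map fst u) = mset (map fst (untwist G h (take b w))) + mset (map fst v)"
    by (simp only: mset_map image_mset_union)
  also have "\<dots> = mset (map fst (take b w @ drop b w))"
    using Cons.IH[OF v(1)] by (simp only: map_fst_untwist map_append mset_append)
  finally show ?case by simp
qed (auto split: if_splits)

lemma seg_shuffles_labels: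
  assumes "group G"
  shows "u \<in> seg_shuffles G p w \<Longrightarrow> snd ` set w \<subseteq> carrier G \<Longrightarrow> snd ` set p \<subseteq> carrier G \<Longrightarrow> snd ` set u \<subseteq> carrier G"
proof (induction p arbitrary: u w)
  case (Cons bh p)
  interpret group G by fact
  obtain b h where bh: "bh = (b, h)" by force
  obtain v where v: "v \<in> seg_shuffles G p (drop b w)" "u \<in> shuffles (untwist G h (take b w)) v"
    using Cons.prems by (auto simp: bh split: if_splits)
  have "snd ` set v \<subseteq> carrier G"
    by (rule Cons.IH[OF v(1)]) (use Cons.prems in \<open>auto dest: in_set_dropD\<close>)
  moreover have "snd ` set (untwist G h (take b w)) \<subseteq> carrier G"
    using Cons.prems by (auto simp: untwist_def bh dest!: in_set_takeD)
  moreover have "set u = set (untwist G h (take b w)) \<union> set v" using v(2) by (rule set_shuffles)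
  ultimately show ?case by (simp add: image_Un)
qed (auto split: if_splits)

lemma filter_shuffle:
  assumes "v \<in> shuffles s t" "\<And>x. x \<in> set s \<Longrightarrow> P x" "\<And>x. x \<in> set t \<Longrightarrow> \<not> P x"
  shows "filter P v = s"
proof -
  have "filter P v \<in> filter P ` shuffles s t" using assms(1) by (rule imageI)
  also have "\<dots> = shuffles (filter P s) (filter P t)" by (rule filter_shuffles)
  also have "filter P s = s" using assms(2) by (auto intro: filter_True)
  also have "filter P t = []" using assms(3) by (auto intro: filter_False)
  finally show ?thesis by simp
qed

lemma seg_sum_eq_sum_seg_shuffles:
  "distinct (map fst w) \<Longrightarrow> finite (seg_shuffles G p w) \<and> seg_sum G p F w = (\<Sum>u\<in>seg_shuffles G p w. F u)"
proof (induction p arbitrary: F w)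
  case (Cons bh p)
  obtain b h where bh: "bh = (b, h)" by force
  show ?case
  proof (cases "b \<le> length w")
    case True
    let ?t = "untwist G h (take b w)"
    have d: "distinct (map fst (drop b w))" using Cons.prems by (simp add: drop_map[symmetric])
    have *: "distinct (map fst (?t @ u))" if "u \<in> seg_shuffles G p (drop b w)" for u
    proof -
      have "mset (map fst (?t @ u)) = mset (map fst (take b w @ drop b w))"
        using seg_shuffles_mset[OF that] by (simp only: map_append mset_append map_fst_untwist)
      then show ?thesis using Cons.prems by (metis append_take_drop_id mset_eq_imp_distinct_iff)
    qed
    \<comment> \<open>The word \<open>u\<close> is recovered from a shuffle by deleting the letters
      of the first segment. The union over \<open>u\<close> is therefore disjoint and no word is
      counted twice.\<close>
    have "shuffles ?t u \<inter> shuffles ?t u' = {}" if u: "u \<in> seg_shuffles G p (drop b w)" "u' \<in> seg_shuffles G p (drop b w)" "u \<noteq> u'" for u u'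
    proof -
      have "u' = u" if v: "v \<in> shuffles ?t u" "v \<in> shuffles ?t u'" for v
      proof -
        have "filter (\<lambda>x. fst x \<notin> fst ` set (take b w)) v = z" if "v \<in> shuffles ?t z" "z \<in> seg_shuffles G p (drop b w)" for z
        proof (rule filter_shuffle[of v z ?t])
          show "v \<in> shuffles z ?t" using that(1) by (simp add: shuffles_commutes)
          show "fst x \<notin> fst ` set (take b w)" if "x \<in> set z" for x
            using *[OF \<open>z \<in> seg_shuffles G p (drop b w)\<close>] that by auto
          show "\<not> fst x \<notin> fst ` set (take b w)" if "x \<in> set ?t" for x
            using that by (force simp: untwist_def)
        qed
        then show ?thesis using v u by blast
      qed
      then show ?thesis using u(3) by blast
    qed
    then have "seg_sum G (bh # p) F w = (\<Sum>u\<in>seg_shuffles G (bh # p) w. F u)"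
      using Cons.IH[OF d] True
      by (simp add: bh sum.UNION_disjoint shuf_sum_eq_sum_shuffles[OF *])
    then show ?thesis using Cons.IH[OF d] True by (simp add: bh)
  qed (simp add: bh)
qed simp

text \<open>The product of the wreath product freed from \<open>n\<close>, so that the right factor
  may be a mere segment of a permutation.\<close>

definition wmult :: "('g, 'm) monoid_scheme \<Rightarrow> (nat \<times> 'g) list \<Rightarrow> (nat \<times> 'g) list \<Rightarrow> (nat \<times> 'g) list" where
  "wmult G u v = map (\<lambda>(t, h). (fst (u ! (t - 1)), snd (u ! (t - 1)) \<otimes>\<^bsub>G\<^esub> h)) v"

lemma wreath_mult: "u \<otimes>\<^bsub>wreath n G\<^esub> v = wmult G u v"
  by (simp add: wreath_def wmult_def)

lemma filter_eq_map_nth: "filter P u = map ((!) u) (filter (\<lambda>i. P (u ! i)) [0..<length u])"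
  by (subst (1) map_nth[symmetric]) (simp add: filter_map o_def)

text \<open>An increasing \<open>v\<close> labelled \<open>h\<close> lists positions of
  \<open>u\<close> from left to right; the product reads off the letters there and multiplies their
  labels by \<open>h\<close>. It equals \<open>s\<close> for some \<open>v\<close> exactly when the
  letters of \<open>s\<close> occur in \<open>u\<close> in this order, with labels that
  \<open>untwist\<close> restores.\<close>

lemma incr_positions:
  assumes "group G" and u: "u \<in> Words G" and h: "h \<in> carrier G" and s: "snd ` set s \<subseteq> carrier G"
  shows "filter (\<lambda>x. fst x \<in> fst ` set s) u = untwist G h s \<longleftrightarrow>
    (\<exists>v. incr h v \<and> fst ` set v \<subseteq> {1..length u} \<and> wmult G u v = s)"
proof
  interpret group G by fact
  define Is where "Is = filter (\<lambda>i. fst (u ! i) \<in> fst ` set s) [0..<length u]"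
  have uc: "snd (u ! i) \<in> carrier G" if "i < length u" for i
    using u that by (auto simp: Words_def)
  {
    assume *: "filter (\<lambda>x. fst x \<in> fst ` set s) u = untwist G h s"
    define v where "v = map (\<lambda>i. (Suc i, h)) Is"
    have "sorted_wrt (<) Is" unfolding Is_def by (intro sorted_wrt_filter) simp
    then have "incr h v" by (auto simp: v_def incr_def sorted_wrt_map)
    moreover have "fst ` set v \<subseteq> {1..length u}" by (auto simp: v_def Is_def)
    moreover have "wmult G u v = s"
    proof -
      have "wmult G u v = map (\<lambda>x. (fst x, snd x \<otimes>\<^bsub>G\<^esub> h)) (map ((!) u) Is)"
        by (simp add: wmult_def v_def o_def)
      also have "map ((!) u) Is = untwist G h s"
        using * filter_eq_map_nth[of "\<lambda>x. fst x \<in> fst ` set s" u] by (simp add: Is_def)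
      also have "map (\<lambda>x. (fst x, snd x \<otimes>\<^bsub>G\<^esub> h)) (untwist G h s) = map id s"
        unfolding untwist_def map_map by (rule map_cong) (use s h in \<open>auto simp: m_assoc\<close>)
      finally show ?thesis by simp
    qed
    ultimately show "\<exists>v. incr h v \<and> fst ` set v \<subseteq> {1..length u} \<and> wmult G u v = s" by blast
  }
  {
    assume "\<exists>v. incr h v \<and> fst ` set v \<subseteq> {1..length u} \<and> wmult G u v = s"
    then obtain v where v: "incr h v" "fst ` set v \<subseteq> {1..length u}" and sv: "s = wmult G u v" by auto
    have inr: "fst y - 1 < length u" "0 < fst y" if "y \<in> set v" for y
    proof -
      have "fst y \<in> {1..length u}" using v(2) that by blast
      then show "fst y - 1 < length u" "0 < fst y" by auto
    qed
    have fs: "fst ` set s = (\<lambda>y. fst (u ! (fst y - 1))) ` set v"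
      by (simp add: sv wmult_def image_image case_prod_unfold)
    \<comment> \<open>Both lists enumerate the same positions of \<open>u\<close> in increasing
      order. The shift by one passes from one-line notation to list indices.\<close>
    have "Is = map (\<lambda>y. fst y - 1) v"
    proof (rule sorted_distinct_set_unique)
      have sw: "sorted_wrt (<) (map (\<lambda>y. fst y - 1) v)"
        unfolding sorted_wrt_map
        by (rule sorted_wrt_mono_rel[OF _ v(1)[unfolded incr_def sorted_wrt_map, THEN conjunct1]])
          (use inr in \<open>auto simp: less_diff_conv\<close>)
      show "sorted (map (\<lambda>y. fst y - 1) v)" "distinct (map (\<lambda>y. fst y - 1) v)"
        using sw by (simp_all add: strict_sorted_iff)
      show "sorted Is" "distinct Is" by (auto simp: Is_def sorted_wrt_filter)
      show "set Is = set (map (\<lambda>y. fst y - 1) v)"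
      proof (intro equalityI subsetI)
        fix i assume "i \<in> set Is"
        then obtain y where y: "i < length u" "y \<in> set v" "fst (u ! i) = fst (u ! (fst y - 1))"
          by (auto simp: Is_def fs)
        then have "i = fst y - 1"
          using u inr[OF y(2)] nth_eq_iff_index_eq[of "map fst u" i "fst y - 1"] by (auto simp: Words_def)
        then show "i \<in> set (map (\<lambda>y. fst y - 1) v)" using y by auto
      next
        fix i assume "i \<in> set (map (\<lambda>y. fst y - 1) v)"
        then show "i \<in> set Is" using inr by (auto simp: Is_def fs)
      qed
    qed
    then have "filter (\<lambda>x. fst x \<in> fst ` set s) u = map (\<lambda>y. u ! (fst y - 1)) v"
      using filter_eq_map_nth[of "\<lambda>x. fst x \<in> fst ` set s" u] by (simp add: Is_def o_def)
    also have "\<dots> = untwist G h s"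
    proof -
      have "snd (u ! (fst y - 1)) \<otimes>\<^bsub>G\<^esub> snd y \<otimes>\<^bsub>G\<^esub> inv\<^bsub>G\<^esub> h = snd (u ! (fst y - 1))" if "y \<in> set v" for y
        using uc[OF inr(1)[OF that]] v(1) that h by (auto simp: incr_def m_assoc)
      then show ?thesis by (auto simp: sv untwist_def wmult_def case_prod_unfold o_def)
    qed
    finally show "filter (\<lambda>x. fst x \<in> fst ` set s) u = untwist G h s" .
  }
qed

text \<open>The two pieces of \<open>w\<close> have disjoint letters, so a shuffle is determined by
  its restrictions to these sets of letters, and the conditions on them are independent.\<close>

lemma filter_mem_seg_shuffles_Cons:
  assumes w: "distinct (map fst w)" and u: "fst ` set w \<subseteq> fst ` set u"
  shows "filter (\<lambda>x. fst x \<in> fst ` set w) u \<in> seg_shuffles G ((b, h) # p) w \<longleftrightarrow>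
    b \<le> length w \<and> filter (\<lambda>x. fst x \<in> fst ` set (take b w)) u = untwist G h (take b w) \<and>
    filter (\<lambda>x. fst x \<in> fst ` set (drop b w)) u \<in> seg_shuffles G p (drop b w)"
proof -
  let ?A = "fst ` set (take b w)" and ?B = "fst ` set (drop b w)" and ?t = "untwist G h (take b w)"
  have un: "fst ` set w = ?A \<union> ?B"
    by (metis append_take_drop_id image_Un set_append)
  have dis: "?A \<inter> ?B = {}"
    using w distinct_append[of "map fst (take b w)" "map fst (drop b w)"]
    by (metis append_take_drop_id list.set_map map_append)
  have t: "fst ` set ?t = ?A" by (metis list.set_map map_fst_untwist)
  let ?F = "filter (\<lambda>x. fst x \<in> fst ` set w) u"
  have FA: "filter (\<lambda>x. fst x \<in> ?A) ?F = filter (\<lambda>x. fst x \<in> ?A) u"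
    unfolding filter_filter by (rule filter_cong) (use un in auto)
  have FB: "filter (\<lambda>x. fst x \<in> ?B) ?F = filter (\<lambda>x. fst x \<in> ?B) u"
    unfolding filter_filter by (rule filter_cong) (use un in auto)
  have FnA: "filter (\<lambda>x. fst x \<notin> ?A) ?F = filter (\<lambda>x. fst x \<in> ?B) u"
    unfolding filter_filter by (rule filter_cong) (use un dis in auto)
  show ?thesis
  proof
    assume "?F \<in> seg_shuffles G ((b, h) # p) w"
    then obtain v where b: "b \<le> length w" and v: "v \<in> seg_shuffles G p (drop b w)" "?F \<in> shuffles ?t v"
      by (auto split: if_splits)
    have vB: "fst ` set v = ?B" using mset_eq_setD[OF seg_shuffles_mset[OF v(1)]] by simp
    have tA: "fst x \<in> ?A" if "x \<in> set ?t" for x using t that by blast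
    have vB': "fst x \<in> ?B" if "x \<in> set v" for x using vB that by blast
    have "filter (\<lambda>x. fst x \<in> ?A) ?F = ?t"
      by (rule filter_shuffle[OF v(2)]) (use tA vB' dis in blast)+
    moreover have "filter (\<lambda>x. fst x \<in> ?B) ?F = v"
      by (rule filter_shuffle[OF v(2)[unfolded shuffles_commutes[of ?t v]]]) (use tA vB' dis in blast)+
    ultimately show "b \<le> length w \<and> filter (\<lambda>x. fst x \<in> ?A) u = ?t \<and> filter (\<lambda>x. fst x \<in> ?B) u \<in> seg_shuffles G p (drop b w)"
      using b v(1) FA FB by simp
  next
    assume *: "b \<le> length w \<and> filter (\<lambda>x. fst x \<in> ?A) u = ?t \<and> filter (\<lambda>x. fst x \<in> ?B) u \<in> seg_shuffles G p (drop b w)"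
    have "?F \<in> shuffles (filter (\<lambda>x. fst x \<in> ?A) ?F) (filter (\<lambda>x. fst x \<notin> ?A) ?F)"
      by (rule partition_in_shuffles)
    then show "?F \<in> seg_shuffles G ((b, h) # p) w"
      unfolding FA FnA using * by auto
  qed
qed

text \<open>The induction shortens \<open>w\<close> while \<open>u\<close> stays fixed. Hence
  \<open>u\<close> is restricted to the letters of \<open>w\<close>, and \<open>v\<close> lists only
  some of the positions of \<open>u\<close>.\<close>

lemma filter_mem_seg_shuffles_iff:
  assumes "group G" and u: "u \<in> Words G"
  shows "w \<in> Words G \<Longrightarrow> fst ` set w \<subseteq> fst ` set u \<Longrightarrow> snd ` set p \<subseteq> carrier G \<Longrightarrow>
    filter (\<lambda>x. fst x \<in> fst ` set w) u \<in> seg_shuffles G p w \<longleftrightarrow>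
    (\<exists>v. compatible v p \<and> fst ` set v \<subseteq> {1..length u} \<and> wmult G u v = w)"
proof (induction p arbitrary: w)
  case Nil
  then show ?case by (auto simp: compatible_Nil wmult_def)
next
  case (Cons bh p)
  obtain b h where bh: "bh = (b, h)" by force
  have sub: "fst ` set (drop b w) \<subseteq> fst ` set u" using Cons.prems(2) by (auto dest: in_set_dropD)
  have h: "h \<in> carrier G" and p: "snd ` set p \<subseteq> carrier G" using Cons.prems bh by auto
  have "filter (\<lambda>x. fst x \<in> fst ` set w) u \<in> seg_shuffles G (bh # p) w \<longleftrightarrow> b \<le> length w \<and>
      (\<exists>v. incr h v \<and> fst ` set v \<subseteq> {1..length u} \<and> wmult G u v = take b w) \<and>
      (\<exists>v. compatible v p \<and> fst ` set v \<subseteq> {1..length u} \<and> wmult G u v = drop b w)"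
    unfolding bh
    using Cons.prems Words_take_drop[OF Cons.prems(1), of b]
      incr_positions[OF assms(1) u h, of "take b w"] Cons.IH[OF _ sub p]
    by (subst filter_mem_seg_shuffles_Cons) (auto simp: Words_def)
  also have "\<dots> \<longleftrightarrow> (\<exists>v. compatible v (bh # p) \<and> fst ` set v \<subseteq> {1..length u} \<and> wmult G u v = w)"
  proof (intro iffI; elim conjE exE)
    fix v1 v2 assume b: "b \<le> length w" and v1: "incr h v1" "fst ` set v1 \<subseteq> {1..length u}" "wmult G u v1 = take b w"
      and v2: "compatible v2 p" "fst ` set v2 \<subseteq> {1..length u}" "wmult G u v2 = drop b w"
    have "length v1 = length (wmult G u v1)" by (simp add: wmult_def)
    then have len: "length v1 = b" using b v1(3) by simp
    have "wmult G u (v1 @ v2) = wmult G u v1 @ wmult G u v2" by (simp add: wmult_def)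
    then have "wmult G u (v1 @ v2) = w" using v1(3) v2(3) by simp
    moreover have "compatible (v1 @ v2) (bh # p)" using v1 v2 len by (simp add: bh compatible_Cons)
    moreover have "fst ` set (v1 @ v2) \<subseteq> {1..length u}" using v1 v2 by (simp add: image_Un)
    ultimately show "\<exists>v. compatible v (bh # p) \<and> fst ` set v \<subseteq> {1..length u} \<and> wmult G u v = w"
      by blast
  next
    fix v assume v: "compatible v (bh # p)" "fst ` set v \<subseteq> {1..length u}" and w: "wmult G u v = w"
    then have v': "b \<le> length v" "incr h (take b v)" "compatible (drop b v) p" by (auto simp: bh compatible_Cons)
    have "fst ` set (take b v) \<subseteq> {1..length u}" "fst ` set (drop b v) \<subseteq> {1..length u}"
      using v(2) by (auto dest: in_set_takeD in_set_dropD)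
    moreover have "wmult G u (take b v) = take b w" "wmult G u (drop b v) = drop b w" "length w = length v"
      by (simp_all add: wmult_def take_map drop_map flip: w)
    ultimately show "b \<le> length w \<and>
      (\<exists>v. incr h v \<and> fst ` set v \<subseteq> {1..length u} \<and> wmult G u v = take b w) \<and>
      (\<exists>v. compatible v p \<and> fst ` set v \<subseteq> {1..length u} \<and> wmult G u v = drop b w)"
      using v' by metis
  qed
  finally show ?case .
qed

lemma compatible_labels: "compatible v p \<Longrightarrow> snd ` set v \<subseteq> snd ` set p"
proof (induction p arbitrary: v)
  case (Cons x p)
  obtain a h where x: "x = (a, h)" by force
  have "set v = set (take a v) \<union> set (drop a v)" by (metis append_take_drop_id set_append)
  moreover have "snd ` set (drop a v) \<subseteq> snd ` set p" "\<forall>y\<in>set (take a v). snd y = h"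
    using Cons x by (auto simp: compatible_Cons incr_def)
  ultimately show ?case using x by auto
qed (simp add: compatible_Nil)

lemma wmult_closed:
  assumes "group G" "u \<in> carrier (wreath n G)" "v \<in> carrier (wreath n G)"
  shows "wmult G u v \<in> carrier (wreath n G)"
proof -
  interpret group G by fact
  have lu: "length u = n" using wreath_length[OF assms(2)] .
  have u: "distinct (map fst u)" "fst ` set u = {1..n}" "snd ` set u \<subseteq> carrier G"
    and v: "distinct (map fst v)" "fst ` set v = {1..n}" "snd ` set v \<subseteq> carrier G"
    using assms(2,3) by (auto simp: wreath_carrier_iff)
  let ?f = "\<lambda>t. fst (u ! (t - 1))"
  have map_fst: "map fst (wmult G u v) = map ?f (map fst v)"
    by (simp add: wmult_def case_prod_unfold)
  have inj: "inj_on ?f {1..n}"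
  proof (rule inj_onI)
    fix s t assume st: "s \<in> {1..n}" "t \<in> {1..n}" "?f s = ?f t"
    then have "map fst u ! (s - 1) = map fst u ! (t - 1)" using lu by auto
    then have "s - 1 = t - 1"
      using u(1) st lu by (subst (asm) nth_eq_iff_index_eq) auto
    then show "s = t" using st by auto
  qed
  have im: "?f ` {1..n} = {1..n}"
  proof (rule card_subset_eq)
    show "?f ` {1..n} \<subseteq> {1..n}"
      using u(2) lu nth_mem[of _ u] by force
    show "card (?f ` {1..n}) = card {1..n}" by (rule card_image[OF inj])
  qed simp
  have "distinct (map fst (wmult G u v))"
    unfolding map_fst distinct_map[of ?f] list.set_map v(2) using v(1) inj by (rule conjI)
  moreover have "fst ` set (wmult G u v) = {1..n}"
    using arg_cong[OF map_fst, of set] im unfolding list.set_map v(2) by simp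
  moreover have "snd ` set (wmult G u v) \<subseteq> carrier G"
  proof -
    have "snd (u ! (t - 1)) \<otimes>\<^bsub>G\<^esub> g \<in> carrier G" if "(t, g) \<in> set v" for t g
    proof -
      have "t \<in> {1..n}" using that v(2) by force
      then have "u ! (t - 1) \<in> set u" using lu by auto
      then show ?thesis using u(3) v(3) that by force
    qed
    then show ?thesis by (auto simp: wmult_def)
  qed
  ultimately show ?thesis by (simp add: wreath_carrier_iff)
qed

lemma wmult_left_cancel:
  assumes "group G" "u \<in> carrier (wreath n G)" "v \<in> carrier (wreath n G)" "v' \<in> carrier (wreath n G)"
    and "wmult G u v = wmult G u v'"
  shows "v = v'"
proof -
  interpret group G by fact
  have lu: "length u = n" using wreath_length[OF assms(2)] .
  have "inj_on (\<lambda>(t, h). (fst (u ! (t - 1)), snd (u ! (t - 1)) \<otimes>\<^bsub>G\<^esub> h)) ({1..n} \<times> carrier G)"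
  proof (rule inj_onI, clarify)
    fix s t g h assume st: "s \<in> {1..n}" "t \<in> {1..n}" "g \<in> carrier G" "h \<in> carrier G"
      "fst (u ! (s - 1)) = fst (u ! (t - 1))" "snd (u ! (s - 1)) \<otimes>\<^bsub>G\<^esub> g = snd (u ! (t - 1)) \<otimes>\<^bsub>G\<^esub> h"
    then have "map fst u ! (s - 1) = map fst u ! (t - 1)" using lu by auto
    then have "s - 1 = t - 1"
      using assms(2) st lu by (subst (asm) nth_eq_iff_index_eq) (auto simp: wreath_carrier_iff)
    then have "s = t" using st by auto
    moreover have "u ! (t - 1) \<in> set u" using st lu by auto
    then have "snd (u ! (t - 1)) \<in> carrier G" using assms(2) by (auto simp: wreath_carrier_iff)
    ultimately show "s = t \<and> g = h" using st by auto
  qed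
  moreover have "set v \<subseteq> {1..n} \<times> carrier G" if "v \<in> carrier (wreath n G)" for v
    using that unfolding wreath_carrier_iff by force
  ultimately have "inj_on (\<lambda>(t, h). (fst (u ! (t - 1)), snd (u ! (t - 1)) \<otimes>\<^bsub>G\<^esub> h)) (set v \<union> set v')"
    using assms(3,4) by (elim inj_on_subset) auto
  then show ?thesis using assms(5) unfolding wmult_def by (simp add: inj_on_map_eq_map)
qed

lemma mem_seg_shuffles_iff:
  assumes "group G" and u: "u \<in> carrier (wreath n G)" and w: "w \<in> carrier (wreath n G)"
    and p: "snd ` set p \<subseteq> carrier G"
  shows "u \<in> seg_shuffles G p w \<longleftrightarrow> (\<exists>v\<in>carrier (wreath n G). compatible v p \<and> wmult G u v = w)"
proof -
  have "fst ` set w = fst ` set u" using u w by (simp add: wreath_carrier_iff)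
  then have "filter (\<lambda>x. fst x \<in> fst ` set w) u = u" by (intro filter_True) auto
  then have "u \<in> seg_shuffles G p w \<longleftrightarrow> (\<exists>v. compatible v p \<and> fst ` set v \<subseteq> {1..length u} \<and> wmult G u v = w)"
    using filter_mem_seg_shuffles_iff[OF assms(1) wreath_Words[OF u] wreath_Words[OF w] _ p] \<open>fst ` set w = fst ` set u\<close> by simp
  also have "\<dots> \<longleftrightarrow> (\<exists>v\<in>carrier (wreath n G). compatible v p \<and> wmult G u v = w)"
  proof safe
    fix v assume v: "compatible v p" "fst ` set v \<subseteq> {1..length u}" and wv: "w = wmult G u v"
    \<comment> \<open>Compatibility alone does not make \<open>v\<close> a permutation. Its
      positions are distinct because the letters of \<open>w\<close> are, and counting shows that
      they exhaust {1..n}.\<close>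
    have lv: "length v = n" using wreath_length[OF w] by (simp add: wv wmult_def)
    have "map fst w = map (\<lambda>t. fst (u ! (t - 1))) (map fst v)"
      by (simp add: wv wmult_def case_prod_unfold)
    moreover have "distinct (map fst w)" using w by (simp add: wreath_carrier_iff)
    ultimately have d: "distinct (map fst v)" by (metis distinct_map)
    have "fst ` set v = {1..n}"
      by (rule card_subset_eq) (use v(2) wreath_length[OF u] distinct_card[OF d] lv in auto)
    then have "v \<in> carrier (wreath n G)"
      using d compatible_labels[OF v(1)] p by (auto simp: wreath_carrier_iff)
    then show "\<exists>va\<in>carrier (wreath n G). compatible va p \<and> wmult G u va = wmult G u v"
      using v by blast
  next
    fix v assume "v \<in> carrier (wreath n G)" "compatible v p" "w = wmult G u v"
    then show "\<exists>va. compatible va p \<and> fst ` set va \<subseteq> {1..length u} \<and> wmult G u va = wmult G u v"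
      using wreath_length[OF u] by (auto simp: wreath_carrier_iff)
  qed
  finally show ?thesis .
qed

lemma seg_shuffles_wreath:
  assumes "group G" and w: "w \<in> carrier (wreath n G)" and p: "snd ` set p \<subseteq> carrier G" and u: "u \<in> seg_shuffles G p w"
  shows "u \<in> carrier (wreath n G)"
proof -
  have "mset (map fst u) = mset (map fst w)" using seg_shuffles_mset[OF u] .
  then have "distinct (map fst u)" "fst ` set u = {1..n}"
    using w mset_eq_setD[of "map fst u" "map fst w"] mset_eq_imp_distinct_iff[of "map fst u" "map fst w"]
    by (auto simp: wreath_carrier_iff)
  then show ?thesis
    using seg_shuffles_labels[OF assms(1) u _ p] w by (auto simp: wreath_carrier_iff)
qed

abbreviation gmult :: "nat \<Rightarrow> ('g, 'm) monoid_scheme \<Rightarrow> ((nat \<times> 'g) list \<Rightarrow> complex) \<Rightarrow>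
    ((nat \<times> 'g) list \<Rightarrow> complex) \<Rightarrow> (nat \<times> 'g) list \<Rightarrow> complex" where
  "gmult n G x y \<equiv> x \<otimes>\<^bsub>group_algebra (wreath n G)\<^esub> y"

lemma gmult_apply:
  "gmult n G x y w = (\<Sum>u\<in>carrier (wreath n G). \<Sum>v\<in>carrier (wreath n G).
     x u * y v * of_bool (wmult G u v = w))"
  unfolding group_algebra_def
  by (auto simp: sum_fun_apply scale_def basis_elt_def wreath_mult intro!: sum.cong)

text \<open>By left cancellation each \<open>u\<close> has at most one compatible right factor
  leading to \<open>w\<close>, so the inner sum is an indicator. The \<open>u\<close> that have one
  are the segmentwise shuffles.\<close>

lemma gmult_X:
  assumes G: "group G" "finite (carrier G)" and p: "p \<in> Gamma n (carrier G)"
  shows "gmult n G x (X n G p) w = (if w \<in> carrier (wreath n G) then seg_sum G p x w else 0)"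
proof -
  let ?W = "carrier (wreath n G)"
  have fin: "finite ?W" by (rule finite_wreath[OF G(2)])
  have labels: "snd ` set p \<subseteq> carrier G" using p by (simp add: Gamma_iff)
  have inner: "(\<Sum>v\<in>?W. x u * X n G p v * of_bool (wmult G u v = w))
      = x u * of_bool (\<exists>v\<in>?W. compatible v p \<and> wmult G u v = w)" if u: "u \<in> ?W" for u
  proof (cases "\<exists>v\<in>?W. compatible v p \<and> wmult G u v = w")
    case True
    then obtain v0 where v0: "v0 \<in> ?W" "compatible v0 p" "wmult G u v0 = w" by blast
    have "(\<Sum>v\<in>?W. x u * X n G p v * of_bool (wmult G u v = w))
        = (\<Sum>v\<in>{v0}. x u * X n G p v * of_bool (wmult G u v = w))"
      by (rule sum.mono_neutral_right)
        (use fin v0 wmult_left_cancel[OF G(1) u] in auto)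
    then show ?thesis using v0 True by (simp add: X_apply[OF G(2) p])
  next
    case False
    have "x u * X n G p v * of_bool (wmult G u v = w) = 0" if "v \<in> ?W" for v
      using False that by (auto simp: X_apply[OF G(2) p])
    then have "(\<Sum>v\<in>?W. x u * X n G p v * of_bool (wmult G u v = w)) = 0" by (rule sum.neutral[rule_format])
    then show ?thesis using False by simp
  qed
  have "gmult n G x (X n G p) w = (\<Sum>u\<in>?W. x u * of_bool (\<exists>v\<in>?W. compatible v p \<and> wmult G u v = w))"
    unfolding gmult_apply by (rule sum.cong[OF refl inner])
  also have "\<dots> = (if w \<in> ?W then seg_sum G p x w else 0)"
  proof (cases "w \<in> ?W")
    case True
    have "(\<Sum>u\<in>?W. x u * of_bool (\<exists>v\<in>?W. compatible v p \<and> wmult G u v = w))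
        = (\<Sum>u\<in>?W. if u \<in> seg_shuffles G p w then x u else 0)"
      using mem_seg_shuffles_iff[OF G(1) _ True labels] by (intro sum.cong) auto
    also have "\<dots> = (\<Sum>u\<in>{u \<in> ?W. u \<in> seg_shuffles G p w}. x u)"
      by (rule sum.inter_filter[symmetric, OF fin])
    also have "{u \<in> ?W. u \<in> seg_shuffles G p w} = seg_shuffles G p w"
      using seg_shuffles_wreath[OF G(1) True labels] by auto
    also have "(\<Sum>u\<in>seg_shuffles G p w. x u) = seg_sum G p x w"
      using seg_sum_eq_sum_seg_shuffles[of w G p x] True by (simp add: wreath_carrier_iff)
    finally show ?thesis using True by simp
  next
    case False
    have "x u * of_bool (\<exists>v\<in>?W. compatible v p \<and> wmult G u v = w) = 0" if "u \<in> ?W" for u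
      using False wmult_closed[OF G(1) that] by auto
    then show ?thesis using False by (simp add: sum.neutral)
  qed
  finally show ?thesis .
qed

section \<open>Characters of finite abelian groups\<close>

lemma characters_iff:
  "\<phi> \<in> characters G \<longleftrightarrow> (\<forall>x\<in>carrier G. \<phi> x \<noteq> 0) \<and>
     (\<forall>x\<in>carrier G. \<forall>y\<in>carrier G. \<phi> (x \<otimes>\<^bsub>G\<^esub> y) = \<phi> x * \<phi> y) \<and> \<phi> \<in> extensional (carrier G)"
  by (auto simp: characters_def hom_def complex_units_def)

lemma complex_root_exists:
  assumes "0 < m"
  shows "\<exists>z::complex. z ^ m = c"
proof -
  have "(rcis (root m (cmod c)) (Arg c / of_nat m)) ^ m = rcis (cmod c) (Arg c)"
    using assms by (simp add: DeMoivre2 real_root_pow_pos2)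
  then show ?thesis by (metis rcis_cmod_Arg)
qed

context comm_group
begin

text \<open>A character known on the subgroup \<open>H\<close> only; its values elsewhere are
  unconstrained, so extending it means changing them.\<close>

definition pchar :: "'a set \<Rightarrow> ('a \<Rightarrow> complex) \<Rightarrow> bool" where
  "pchar H \<phi> \<longleftrightarrow> subgroup H G \<and> (\<forall>x\<in>H. \<phi> x \<noteq> 0) \<and> (\<forall>x\<in>H. \<forall>y\<in>H. \<phi> (x \<otimes> y) = \<phi> x * \<phi> y)"

lemma pchar_one: "pchar H \<phi> \<Longrightarrow> \<phi> \<one> = 1"
  unfolding pchar_def using subgroup.one_closed[of H G] by (metis l_one mult_cancel_left1 one_closed)

lemma subgroup_nat_pow_closed: "subgroup H G \<Longrightarrow> x \<in> H \<Longrightarrow> x [^] (k::nat) \<in> H"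
  by (induction k) (auto simp: subgroup.m_closed subgroup.one_closed)

lemma pchar_pow: "pchar H \<phi> \<Longrightarrow> x \<in> H \<Longrightarrow> \<phi> (x [^] (k::nat)) = \<phi> x ^ k"
proof (induction k)
  case (Suc k)
  then have "x [^] k \<in> H" by (simp add: subgroup_nat_pow_closed pchar_def)
  then show ?case using Suc by (simp add: pchar_def)
qed (simp add: pchar_one)

text \<open>Adjoins \<open>x\<close>, whose order modulo \<open>H\<close> is \<open>m\<close>, by
  sending h x^k to \<phi>(h) z^k. Any root \<open>z\<close> of the stated equation will do, and this
  freedom is what later separates elements.\<close>

lemma pchar_extend:
  assumes H: "pchar H \<phi>" and x: "x \<in> carrier G" and m: "0 < m" "x [^] m \<in> H"
    and least: "\<And>k. 0 < k \<Longrightarrow> k < m \<Longrightarrow> x [^] k \<notin> H" and z: "z ^ m = \<phi> (x [^] m)"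
  obtains H' \<psi> where "pchar H' \<psi>" "H \<subseteq> H'" "x \<in> H'" "\<And>h. h \<in> H \<Longrightarrow> \<psi> h = \<phi> h" "\<psi> x = z"
proof -
  have sub: "subgroup H G" using H by (simp add: pchar_def)
  have Hc: "h \<in> carrier G" if "h \<in> H" for h using sub that by (rule subgroup.mem_carrier)
  have mH: "a \<otimes> b \<in> H" if "a \<in> H" "b \<in> H" for a b using sub that by (rule subgroup.m_closed)
  have iH: "inv a \<in> H" if "a \<in> H" for a using sub that by (rule subgroup.m_inv_closed)
  \<comment> \<open>Division with remainder: the remainder would be a smaller exponent whose power
    lies in \<open>H\<close>.\<close>
  have dvd: "m dvd a" if "x [^] a \<in> H" for a
  proof -
    have "x [^] a = x [^] (a mod m) \<otimes> (x [^] m) [^] (a div m)"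
      using x by (simp add: nat_pow_mult nat_pow_pow)
    then have "x [^] (a mod m) = x [^] a \<otimes> inv ((x [^] m) [^] (a div m))"
      using x by (simp add: m_assoc)
    also have "\<dots> \<in> H" by (intro mH iH that subgroup_nat_pow_closed sub m)
    finally have "x [^] (a mod m) \<in> H" .
    then have "a mod m = 0" using least[of "a mod m"] m(1) by (cases "a mod m = 0") auto
    then show ?thesis by (rule mod_0_imp_dvd)
  qed
  have z0: "z \<noteq> 0" using z H m by (auto simp: pchar_def zero_power)
  \<comment> \<open>Cancelling x^k leaves a power of \<open>x\<close> that lies in \<open>H\<close>.
    Its exponent is a multiple of \<open>m\<close>, so the equation for \<open>z\<close>
    applies.\<close>
  have uniq: "\<phi> h * z ^ j = \<phi> h' * z ^ k" if h: "h \<in> H" "h' \<in> H" "h \<otimes> x [^] j = h' \<otimes> x [^] k" "k \<le> j" for h h' j k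
  proof -
    have "h \<otimes> x [^] (j - k) \<otimes> x [^] k = h' \<otimes> x [^] k"
      using h x Hc by (simp add: m_assoc nat_pow_mult)
    then have eq: "h \<otimes> x [^] (j - k) = h'" using h x Hc by simp
    have "x [^] (j - k) = inv h \<otimes> h'" using h x Hc by (simp add: eq[symmetric] m_assoc[symmetric])
    then have xH: "x [^] (j - k) \<in> H" using mH iH h by simp
    then obtain t where t: "j - k = m * t" using dvd by (auto simp: dvd_def)
    have "\<phi> (x [^] (j - k)) = z ^ (j - k)"
      using pchar_pow[OF H m(2), of t] x z by (simp add: t nat_pow_pow power_mult)
    then have "\<phi> h' = \<phi> h * z ^ (j - k)"
      using H h xH by (simp add: eq[symmetric] pchar_def)
    then show ?thesis using h(4) by (simp add: mult.assoc power_add[symmetric])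
  qed
  define P where "P y c \<longleftrightarrow> (\<exists>h\<in>H. \<exists>k::nat. y = h \<otimes> x [^] k \<and> c = \<phi> h * z ^ k)" for y c
  have P_unique: "c = c'" if P: "P y c" "P y c'" for y c c'
  proof -
    obtain h j h' k where "h \<in> H" "h' \<in> H" "y = h \<otimes> x [^] (j::nat)" "y = h' \<otimes> x [^] (k::nat)"
      "c = \<phi> h * z ^ j" "c' = \<phi> h' * z ^ k"
      using P unfolding P_def by blast
    then show ?thesis using uniq[of h h' j k] uniq[of h' h k j] by (cases "k \<le> j") auto
  qed
  define \<psi> where "\<psi> y = (THE c. P y c)" for y
  have \<psi>: "\<psi> y = c" if "P y c" for y c
    unfolding \<psi>_def using that P_unique by blast
  define H' where "H' = {h \<otimes> x [^] (k::nat) | h k. h \<in> H}"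
  have P_H': "P (h \<otimes> x [^] k) (\<phi> h * z ^ k)" if "h \<in> H" for h and k :: nat
    unfolding P_def using that by blast
  have P_mult: "P (a \<otimes> b) (c * d)" if P: "P a c" "P b d" for a b c d
  proof -
    obtain h j h' k where *: "h \<in> H" "h' \<in> H" "a = h \<otimes> x [^] (j::nat)" "b = h' \<otimes> x [^] (k::nat)"
      "c = \<phi> h * z ^ j" "d = \<phi> h' * z ^ k"
      using P unfolding P_def by blast
    have "a \<otimes> b = (h \<otimes> h') \<otimes> x [^] (j + k)"
      using * x Hc by (simp add: nat_pow_mult[symmetric] m_ac)
    moreover have "c * d = \<phi> (h \<otimes> h') * z ^ (j + k)"
      using * H by (simp add: pchar_def power_add)
    ultimately show ?thesis using P_H'[OF mH[OF *(1,2)], of "j + k"] by simp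
  qed
  have H'_P: "P y (\<psi> y)" if y: "y \<in> H'" for y
  proof -
    obtain h and k :: nat where "h \<in> H" "y = h \<otimes> x [^] k" using y by (auto simp: H'_def)
    then have "P y (\<phi> h * z ^ k)" using P_H' by simp
    then show ?thesis using \<psi> by simp
  qed
  have P_in: "y \<in> H'" if "P y c" for y c
    using that unfolding P_def H'_def by blast
  have sub': "subgroup H' G"
  proof (rule subgroupI)
    show "H' \<subseteq> carrier G" using Hc x by (auto simp: H'_def)
    show "H' \<noteq> {}" using subgroup.one_closed[OF sub] by (auto simp: H'_def)
    show "a \<otimes> b \<in> H'" if "a \<in> H'" "b \<in> H'" for a b
      using P_in P_mult H'_P that by blast
    show "inv a \<in> H'" if a: "a \<in> H'" for a
    proof -
      obtain h and k :: nat where hk: "h \<in> H" "a = h \<otimes> x [^] k" using a by (auto simp: H'_def)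
      \<comment> \<open>Only natural exponents are in use, so the inverse of x^k is written as
        x^((m-1)k) times the inverse of x^(mk), and the latter lies in \<open>H\<close>.\<close>
      have xm: "x [^] (m * k) \<in> H" using subgroup_nat_pow_closed[OF sub m(2), of k] x by (simp add: nat_pow_pow)
      have "x [^] k \<otimes> x [^] ((m - 1) * k) = x [^] (m * k)"
        using x m(1) by (simp add: nat_pow_mult add_mult_distrib[symmetric] flip: mult_Suc)
      moreover have "(h \<otimes> A) \<otimes> (C \<otimes> D \<otimes> B) = (h \<otimes> C) \<otimes> ((A \<otimes> B) \<otimes> D)"
        if "A \<in> carrier G" "B \<in> carrier G" "C \<in> carrier G" "D \<in> carrier G" for A B C D
        using that Hc[OF hk(1)] by (simp add: m_ac)
      ultimately have "a \<otimes> (inv h \<otimes> inv (x [^] (m * k)) \<otimes> x [^] ((m - 1) * k)) = \<one>"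
        using hk x Hc by simp
      then have "inv a = inv h \<otimes> inv (x [^] (m * k)) \<otimes> x [^] ((m - 1) * k)"
        using hk x Hc by (intro comm_inv_char) auto
      then show ?thesis using iH[OF hk(1)] iH[OF xm] mH unfolding H'_def by blast
    qed
  qed
  show ?thesis
  proof (rule that[of H' \<psi>])
    show "pchar H' \<psi>"
      unfolding pchar_def
    proof (intro conjI ballI sub')
      show "\<psi> y \<noteq> 0" if "y \<in> H'" for y
        using H'_P[OF that] z0 H by (auto simp: P_def pchar_def)
      show "\<psi> (a \<otimes> b) = \<psi> a * \<psi> b" if "a \<in> H'" "b \<in> H'" for a b
        by (rule \<psi>[OF P_mult[OF H'_P[OF that(1)] H'_P[OF that(2)]]])
    qed
    have Ph: "P h (\<phi> h)" if "h \<in> H" for h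
      using P_H'[OF that, of 0] Hc[OF that] by simp
    then show "H \<subseteq> H'" "\<And>h. h \<in> H \<Longrightarrow> \<psi> h = \<phi> h" using P_in \<psi> by blast+
    have "P x z"
      using P_H'[OF subgroup.one_closed[OF sub], of 1] x pchar_one[OF H] by simp
    then show "x \<in> H'" "\<psi> x = z" using P_in \<psi> by blast+
  qed
qed

lemma ex_pow_eq_one:
  assumes "finite (carrier G)" "x \<in> carrier G"
  shows "\<exists>k::nat. 0 < k \<and> x [^] k = \<one>"
proof -
  have "finite (range (\<lambda>k::nat. x [^] k))"
    by (rule finite_subset[OF _ assms(1)]) (use assms(2) in auto)
  then have "\<not> inj (\<lambda>k::nat. x [^] k)" using range_inj_infinite by blast
  then obtain i j :: nat where ij: "i < j" "x [^] i = x [^] j"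
    unfolding inj_def by (metis linorder_neq_iff)
  have "x [^] i \<otimes> x [^] (j - i) = x [^] j"
    using assms(2) ij(1) by (simp add: nat_pow_mult)
  also have "\<dots> = x [^] i \<otimes> \<one>" using assms(2) ij(2) by simp
  finally have "x [^] (j - i) = \<one>" using assms(2) by simp
  then show ?thesis using ij(1) by (intro exI[of _ "j - i"]) auto
qed

text \<open>Adjoins one element at a time; each step is possible since every complex number has
  roots of all positive orders.\<close>

lemma pchar_total:
  assumes "finite (carrier G)" "pchar H \<phi>"
  shows "\<exists>\<psi>. pchar (carrier G) \<psi> \<and> (\<forall>h\<in>H. \<psi> h = \<phi> h)"
  using assms(2)
proof (induction "card (carrier G) - card H" arbitrary: H \<phi> rule: less_induct)
  case less
  have sub: "H \<subseteq> carrier G" using less.prems subgroup.subset by (auto simp: pchar_def)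
  show ?case
  proof (cases "H = carrier G")
    case False
    then obtain x where x: "x \<in> carrier G" "x \<notin> H" using sub by blast
    let ?Q = "\<lambda>m::nat. 0 < m \<and> x [^] m \<in> H"
    have "\<exists>m. ?Q m"
      using ex_pow_eq_one[OF assms(1) x(1)] less.prems subgroup.one_closed[of H G]
      by (auto simp: pchar_def)
    then have Q: "?Q (LEAST m. ?Q m)" by (rule LeastI_ex)
    obtain z where "z ^ (LEAST m. ?Q m) = \<phi> (x [^] (LEAST m. ?Q m))"
      using complex_root_exists Q by blast
    then obtain H' \<psi> where H': "pchar H' \<psi>" "H \<subseteq> H'" "x \<in> H'" "\<And>h. h \<in> H \<Longrightarrow> \<psi> h = \<phi> h"
      using pchar_extend[OF less.prems x(1), of "LEAST m. ?Q m" z] Q not_less_Least[of _ ?Q] by metis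
    have "H' \<subseteq> carrier G" using H'(1) subgroup.subset[of H' G] unfolding pchar_def by blast
    then have "card H' \<le> card (carrier G)" "finite H'" using assms(1) card_mono finite_subset by blast+
    moreover have "card H < card H'" using H' x \<open>finite H'\<close> by (intro psubset_card_mono) auto
    ultimately have "card (carrier G) - card H' < card (carrier G) - card H" by linarith
    then obtain \<chi> where "pchar (carrier G) \<chi>" "\<forall>h\<in>H'. \<chi> h = \<psi> h"
      using less.hyps[of H' \<psi>] H'(1) by blast
    then show ?thesis using H' by (intro exI[of _ \<chi>]) auto
  qed (use less.prems in blast)
qed

text \<open>Starting from the trivial subgroup, \<open>g\<close> of order m \<ge> 2 may be sent to
  any m-th root of unity, in particular to one other than 1, and the result extends to the whole
  group.\<close>

lemma characters_separate:
  assumes fin: "finite (carrier G)" and g: "g \<in> carrier G" "g \<noteq> \<one>"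
  shows "\<exists>\<phi>\<in>characters G. \<phi> g \<noteq> 1"
proof -
  let ?Q = "\<lambda>m::nat. 0 < m \<and> g [^] m \<in> {\<one>}"
  have "\<exists>m. ?Q m" using ex_pow_eq_one[OF fin g(1)] by auto
  then have Q: "?Q (LEAST m. ?Q m)" by (rule LeastI_ex)
  define m where "m = (LEAST m. ?Q m)"
  have "m \<noteq> 1" using Q[folded m_def] g by auto
  then have m: "2 \<le> m" using Q[folded m_def] by auto
  have "card {z::complex. z ^ m = 1} = m" using m by (intro card_roots_unity_eq) auto
  then have "\<not> {z::complex. z ^ m = 1} \<subseteq> {1}"
    using m card_mono[of "{1::complex}" "{z. z ^ m = 1}"] by auto
  then obtain z :: complex where z: "z ^ m = 1" "z \<noteq> 1" by auto
  have triv: "pchar {\<one>} (\<lambda>_. 1)" by (auto simp: pchar_def triv_subgroup)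
  obtain H \<psi> where H: "pchar H \<psi>" "g \<in> H" "\<psi> g = z"
    using pchar_extend[OF triv g(1), of m z] Q not_less_Least[of _ ?Q] z unfolding m_def by metis
  then obtain \<chi> where \<chi>: "pchar (carrier G) \<chi>" "\<forall>h\<in>H. \<chi> h = \<psi> h"
    using pchar_total[OF fin] by blast
  have "restrict \<chi> (carrier G) \<in> characters G"
    using \<chi>(1) by (auto simp: characters_iff pchar_def)
  moreover have "restrict \<chi> (carrier G) g \<noteq> 1" using H \<chi>(2) z g by simp
  ultimately show ?thesis by blast
qed

lemma character_pchar: "\<phi> \<in> characters G \<Longrightarrow> pchar (carrier G) \<phi>"
  by (simp add: pchar_def characters_iff subgroup_self)

lemma bij_betw_translate:
  assumes "x \<in> carrier G"
  shows "bij_betw ((\<otimes>) x) (carrier G) (carrier G)"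
  by (rule bij_betw_byWitness[where f' = "(\<otimes>) (inv x)"])
    (use assms in \<open>auto simp: m_assoc[symmetric]\<close>)

text \<open>Translation by \<open>x\<close> permutes the factors of the product of \<phi> over the
  group, while it multiplies that nonzero product by the power in question.\<close>

lemma character_pow_card:
  assumes "finite (carrier G)" and \<phi>: "\<phi> \<in> characters G" and x: "x \<in> carrier G"
  shows "\<phi> x ^ card (carrier G) = 1"
proof -
  have "(\<Prod>g\<in>carrier G. \<phi> g) = (\<Prod>g\<in>carrier G. \<phi> (x \<otimes> g))"
    by (rule prod.reindex_bij_betw[OF bij_betw_translate[OF x], symmetric])
  also have "\<dots> = \<phi> x ^ card (carrier G) * (\<Prod>g\<in>carrier G. \<phi> g)"
    using \<phi> x by (simp add: characters_iff prod.distrib)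
  finally have "\<phi> x ^ card (carrier G) * (\<Prod>g\<in>carrier G. \<phi> g) = 1 * (\<Prod>g\<in>carrier G. \<phi> g)"
    by simp
  moreover have "(\<Prod>g\<in>carrier G. \<phi> g) \<noteq> 0"
    using \<phi> assms(1) by (simp add: characters_iff)
  ultimately show ?thesis by (simp only: mult_cancel_right) simp
qed

lemma card_carrier_pos: "finite (carrier G) \<Longrightarrow> 0 < card (carrier G)"
  using one_closed card_gt_0_iff by blast

lemma character_cnj:
  assumes "finite (carrier G)" "\<phi> \<in> characters G" "x \<in> carrier G"
  shows "\<phi> x * cnj (\<phi> x) = 1"
proof -
  have "cmod (\<phi> x) ^ card (carrier G) = 1"
    using character_pow_card[OF assms] by (metis norm_one norm_power)
  then have "cmod (\<phi> x) = 1"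
    using card_carrier_pos[OF assms(1)] power_eq_imp_eq_base[of "cmod (\<phi> x)" "card (carrier G)" 1] by simp
  then show ?thesis by (simp add: complex_norm_square[symmetric])
qed

lemma finite_characters:
  assumes "finite (carrier G)"
  shows "finite (characters G)"
proof (rule finite_subset)
  have "finite {z::complex. z ^ card (carrier G) = 1}"
    using card_carrier_pos[OF assms] by (intro finite_roots_unity) auto
  then show "finite (PiE (carrier G) (\<lambda>_. {z::complex. z ^ card (carrier G) = 1}))"
    using assms by (intro finite_PiE) auto
  show "characters G \<subseteq> PiE (carrier G) (\<lambda>_. {z::complex. z ^ card (carrier G) = 1})"
  proof
    fix \<phi> assume \<phi>: "\<phi> \<in> characters G"
    show "\<phi> \<in> PiE (carrier G) (\<lambda>_. {z::complex. z ^ card (carrier G) = 1})"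
      using character_pow_card[OF assms \<phi>] \<phi> by (auto simp: characters_iff PiE_def)
  qed
qed

lemma sum_translate:
  assumes "x \<in> carrier G"
  shows "(\<Sum>g\<in>carrier G. f (x \<otimes> g)) = (\<Sum>g\<in>carrier G. f g)"
  by (rule sum.reindex_bij_betw[OF bij_betw_translate[OF assms]])

lemma character_orthogonality:
  assumes fin: "finite (carrier G)" and \<phi>: "\<phi> \<in> characters G" and \<chi>: "\<chi> \<in> characters G"
  shows "(\<Sum>g\<in>carrier G. \<phi> g * cnj (\<chi> g)) = (if \<phi> = \<chi> then of_nat (card (carrier G)) else 0)"
proof (cases "\<phi> = \<chi>")
  case True
  then show ?thesis using character_cnj[OF fin \<chi>] by simp
next
  case False
  then obtain x where x: "x \<in> carrier G" "\<phi> x \<noteq> \<chi> x"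
    using \<phi> \<chi> by (meson characters_iff extensionalityI)
  let ?S = "\<Sum>g\<in>carrier G. \<phi> g * cnj (\<chi> g)"
  have "?S = (\<Sum>g\<in>carrier G. \<phi> (x \<otimes> g) * cnj (\<chi> (x \<otimes> g)))"
    by (rule sum_translate[symmetric, OF x(1)])
  also have "\<dots> = \<phi> x * cnj (\<chi> x) * ?S"
    using \<phi> \<chi> x by (simp add: characters_iff sum_distrib_left mult_ac)
  finally have "(1 - \<phi> x * cnj (\<chi> x)) * ?S = 0" by (simp add: algebra_simps)
  moreover have "\<phi> x * cnj (\<chi> x) \<noteq> 1"
    using character_cnj[OF fin \<chi> x(1)] x(2) by (metis mult_cancel_right mult_zero_right zero_neq_one)
  ultimately show ?thesis using False by simp
qed

text \<open>Multiplication by a character \<psi> with \<psi>(g) different from 1 permutes the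
  characters and multiplies the sum by a factor other than 1.\<close>

lemma character_dual_orthogonality_aux:
  assumes fin: "finite (carrier G)" and g: "g \<in> carrier G" "g \<noteq> \<one>"
  shows "(\<Sum>\<phi>\<in>characters G. cnj (\<phi> g)) = 0"
proof -
  obtain \<psi> where \<psi>: "\<psi> \<in> characters G" "\<psi> g \<noteq> 1"
    using characters_separate[OF fin g] by blast
  let ?m = "\<lambda>\<phi>. restrict (\<lambda>x. \<psi> x * \<phi> x) (carrier G)"
  let ?S = "\<Sum>\<phi>\<in>characters G. cnj (\<phi> g)"
  have inj: "inj_on ?m (characters G)"
  proof (rule inj_onI)
    fix \<phi> \<chi> assume *: "\<phi> \<in> characters G" "\<chi> \<in> characters G" "?m \<phi> = ?m \<chi>"
    have "\<phi> x = \<chi> x" if "x \<in> carrier G" for x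
      using fun_cong[OF *(3), of x] that \<psi>(1) by (auto simp: characters_iff)
    then show "\<phi> = \<chi>" using * by (meson characters_iff extensionalityI)
  qed
  have sub: "?m ` characters G \<subseteq> characters G"
    using \<psi>(1) by (auto simp: characters_iff)
  have "?m ` characters G = characters G"
    by (rule card_subset_eq[OF finite_characters[OF fin] sub card_image[OF inj]])
  then have "?S = (\<Sum>\<phi>\<in>characters G. cnj (?m \<phi> g))"
    using sum.reindex[OF inj, of "\<lambda>\<phi>. cnj (\<phi> g)"] by simp
  also have "\<dots> = cnj (\<psi> g) * ?S"
    using g by (simp add: sum_distrib_left)
  finally have "(1 - cnj (\<psi> g)) * ?S = 0" by (simp add: algebra_simps)
  then show ?thesis using \<psi>(2) by (auto simp: complex_cnj_one_iff)
qed

text \<open>At the unit the sum is the number of characters. That this is the order of the group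
  follows by summing over elements and characters in both orders.\<close>

lemma character_dual_orthogonality:
  assumes fin: "finite (carrier G)" and g: "g \<in> carrier G"
  shows "(\<Sum>\<phi>\<in>characters G. cnj (\<phi> g)) = (if g = \<one> then of_nat (card (carrier G)) else 0)"
proof -
  have one: "(\<Sum>\<phi>\<in>characters G. cnj (\<phi> \<one>)) = of_nat (card (characters G))"
    by (simp add: pchar_one[OF character_pchar])
  let ?t = "restrict (\<lambda>_. 1) (carrier G) :: 'a \<Rightarrow> complex"
  have t: "?t \<in> characters G" by (auto simp: characters_iff)
  have "of_nat (card (characters G)) = (\<Sum>g\<in>{\<one>}. \<Sum>\<phi>\<in>characters G. cnj (\<phi> g))"
    using one by simp
  also have "\<dots> = (\<Sum>g\<in>carrier G. \<Sum>\<phi>\<in>characters G. cnj (\<phi> g))"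
    by (rule sum.mono_neutral_left) (use fin character_dual_orthogonality_aux in auto)
  also have "\<dots> = (\<Sum>\<phi>\<in>characters G. \<Sum>g\<in>carrier G. ?t g * cnj (\<phi> g))"
    by (subst sum.swap) simp
  also have "\<dots> = (\<Sum>\<phi>\<in>characters G. if \<phi> = ?t then of_nat (card (carrier G)) else 0)"
    by (rule sum.cong[OF refl], subst character_orthogonality[OF fin t]) (auto simp: eq_commute)
  also have "\<dots> = of_nat (card (carrier G))"
    using t finite_characters[OF fin] by simp
  finally show ?thesis using one g character_dual_orthogonality_aux[OF fin g] by auto
qed

end

section \<open>The idempotents\<close>

lemma primitive_log_part: "primitive (log_part x)"
  unfolding primitive_def
proof (intro conjI allI impI)
  fix s t :: "(nat \<times> 'a) list" assume st: "s \<noteq> []" "t \<noteq> []" "distinct (map fst (s @ t))"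
  have "shuf_sum (log_part x) s t = shuf_sum (\<lambda>u. of_bool (length s + length t = fst x) * clog (inc_ind (snd x)) u) s t"
    by (rule shuf_sum_cong) (auto simp: log_part_def simp flip: size_mset)
  also have "\<dots> = 0"
  proof -
    have "primitive (clog (inc_ind (snd x)))"
      by (rule primitive_clog[OF multiplicative_inc_ind inc_ind_Nil])
    then have "shuf_sum (clog (inc_ind (snd x))) s t = 0"
      using st unfolding primitive_def by (elim conjE allE impE)
    then show ?thesis by (simp only: shuf_sum_cmult mult_zero_right)
  qed
  finally show "shuf_sum (log_part x) s t = 0" .
qed (simp add: log_part_def)

text \<open>The Fourier transform of \<open>log_part\<close> in the label, which diagonalises
  \<open>untwist\<close>.\<close>

definition char_log :: "('g, 'm) monoid_scheme \<Rightarrow> nat \<times> ('g \<Rightarrow> complex) \<Rightarrow> (nat \<times> 'g) list \<Rightarrow> complex" where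
  "char_log G x s = (\<Sum>g\<in>carrier G. cnj (snd x g) * log_part (fst x, g) s)"

abbreviation char_prod :: "('g, 'm) monoid_scheme \<Rightarrow> (nat \<times> ('g \<Rightarrow> complex)) list \<Rightarrow> (nat \<times> 'g) list \<Rightarrow> complex" where
  "char_prod G \<alpha> \<equiv> cprod (map (char_log G) \<alpha>)"

lemma char_log_length: "length s \<noteq> fst x \<Longrightarrow> char_log G x s = 0"
  by (simp add: char_log_def log_part_length)

lemma primitive_char_log:
  fixes G :: "('g, 'm) monoid_scheme"
  shows "primitive (char_log G x)"
proof -
  have "log_part (fst x, g) [] = 0" for g :: 'g using primitive_log_part[of "(fst x, g)"] by (simp add: primitive_def)
  moreover have "shuf_sum (log_part (fst x, g)) s t = 0"
    if "s \<noteq> []" "t \<noteq> []" "distinct (map fst (s @ t))" for g :: 'g and s t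
    using primitive_log_part[of "(fst x, g)"] that unfolding primitive_def by (elim conjE allE impE)
  ultimately show ?thesis
    unfolding primitive_def char_log_def[abs_def] shuf_sum_sum shuf_sum_cmult by (auto intro!: sum.neutral)
qed

lemma incr_untwist:
  assumes "group G" "s \<in> Words G" "h \<in> carrier G" "g \<in> carrier G"
  shows "incr g (untwist G h s) \<longleftrightarrow> incr (g \<otimes>\<^bsub>G\<^esub> h) s"
proof -
  interpret group G by fact
  have "snd x \<otimes>\<^bsub>G\<^esub> inv\<^bsub>G\<^esub> h = g \<longleftrightarrow> snd x = g \<otimes>\<^bsub>G\<^esub> h" if "x \<in> set s" for x
    using assms(2-4) that inv_solve_right'[of "snd x" g h] by (auto simp: Words_def m_assoc)
  then show ?thesis by (auto simp: incr_def untwist_def o_def)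
qed

lemma convpow_untwist:
  assumes "group G" "h \<in> carrier G" "g \<in> carrier G"
  shows "s \<in> Words G \<Longrightarrow> convpow (off_Nil (inc_ind g)) d (untwist G h s)
    = convpow (off_Nil (inc_ind (g \<otimes>\<^bsub>G\<^esub> h))) d s"
proof (induction d arbitrary: s)
  case (Suc d)
  have "off_Nil (inc_ind g) (untwist G h u) = off_Nil (inc_ind (g \<otimes>\<^bsub>G\<^esub> h)) u" if "u \<in> Words G" for u
    using incr_untwist[OF assms(1) that assms(2,3)] by (auto simp: off_Nil_def inc_ind_def untwist_def)
  then show ?case
    using Suc Words_take_drop[OF Suc.prems] by (simp add: conv_sum take_untwist drop_untwist)
qed (simp add: counit_def untwist_def)

lemma log_part_untwist:
  assumes "group G" "h \<in> carrier G" "g \<in> carrier G" "s \<in> Words G"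
  shows "log_part (a, g) (untwist G h s) = log_part (a, g \<otimes>\<^bsub>G\<^esub> h) s"
  using convpow_untwist[OF assms(1-3)] assms(4) by (simp add: log_part_def clog_sum)

text \<open>Stripping \<open>h\<close> translates the label of the logarithm by \<open>h\<close>.
  Reindexing the sum over the group moves this translation onto the character, where it becomes a
  scalar.\<close>

lemma char_log_untwist:
  assumes G: "comm_group G" "finite (carrier G)" and x: "snd x \<in> characters G" and h: "h \<in> carrier G"
    and s: "s \<in> Words G"
  shows "char_log G x (untwist G h s) = snd x h * char_log G x s"
proof -
  interpret comm_group G by fact
  let ?\<phi> = "snd x"
  have *: "cnj (?\<phi> g) * log_part (fst x, g) (untwist G h s)
      = ?\<phi> h * (cnj (?\<phi> (h \<otimes>\<^bsub>G\<^esub> g)) * log_part (fst x, h \<otimes>\<^bsub>G\<^esub> g) s)" if g: "g \<in> carrier G" for g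
  proof -
    have "?\<phi> h * cnj (?\<phi> (h \<otimes>\<^bsub>G\<^esub> g)) = (?\<phi> h * cnj (?\<phi> h)) * cnj (?\<phi> g)"
      using x h g by (simp add: characters_iff)
    then have "?\<phi> h * cnj (?\<phi> (h \<otimes>\<^bsub>G\<^esub> g)) = cnj (?\<phi> g)"
      using character_cnj[OF G(2) x h] by simp
    then show ?thesis
      using log_part_untwist[OF is_group h g s, of "fst x"] g h by (simp add: m_comm mult.assoc[symmetric])
  qed
  have "char_log G x (untwist G h s) = (\<Sum>g\<in>carrier G. ?\<phi> h * (cnj (?\<phi> (h \<otimes>\<^bsub>G\<^esub> g)) * log_part (fst x, h \<otimes>\<^bsub>G\<^esub> g) s))"
    unfolding char_log_def by (rule sum.cong[OF refl *])
  also have "\<dots> = (\<Sum>g\<in>carrier G. ?\<phi> h * (cnj (?\<phi> g) * log_part (fst x, g) s))"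
    by (rule sum_translate[OF h])
  finally show ?thesis by (simp add: char_log_def sum_distrib_left)
qed

section \<open>Expansion and linear independence of the twisted products\<close>

definition labellings :: "('g, 'm) monoid_scheme \<Rightarrow> (nat \<times> 'l) list \<Rightarrow> (nat \<times> 'g) list set" where
  "labellings G \<alpha> = {p. map fst p = map fst \<alpha> \<and> snd ` set p \<subseteq> carrier G}"

lemma labellings_Nil: "labellings G [] = {[]}"
  by (auto simp: labellings_def)

lemma labellings_Cons: "labellings G (x # \<alpha>) = (\<lambda>(g, p). (fst x, g) # p) ` (carrier G \<times> labellings G \<alpha>)"
proof (intro equalityI subsetI)
  fix q assume "q \<in> labellings G (x # \<alpha>)"
  then obtain y p where "q = y # p" "fst y = fst x" "snd y \<in> carrier G" "p \<in> labellings G \<alpha>"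
    by (cases q) (auto simp: labellings_def)
  then show "q \<in> (\<lambda>(g, p). (fst x, g) # p) ` (carrier G \<times> labellings G \<alpha>)"
    by (intro image_eqI[of _ _ "(snd y, p)"]) (auto simp: prod_eq_iff)
qed (auto simp: labellings_def image_subset_iff)

lemma sum_labellings_Cons:
  "(\<Sum>p\<in>labellings G (x # \<alpha>). F p) = (\<Sum>g\<in>carrier G. \<Sum>p\<in>labellings G \<alpha>. F ((fst x, g) # p))"
  unfolding labellings_Cons sum.cartesian_product
  by (subst sum.reindex) (auto simp: inj_on_def case_prod_unfold)

lemma labellings_Gamma:
  fixes G :: "('g, 'm) monoid_scheme"
  assumes "\<alpha> \<in> Gamma n L"
  shows "{p \<in> Gamma n (carrier G). map fst p = map fst \<alpha>} = labellings G \<alpha>"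
proof -
  have "positive p" if "map fst p = map fst \<alpha>" for p :: "(nat \<times> 'g) list"
  proof -
    have "set (map fst p) = set (map fst \<alpha>)" using that by simp
    then show ?thesis using assms unfolding Gamma_iff positive_def
      by (metis (no_types, lifting) imageE image_eqI list.set_map)
  qed
  then show ?thesis using assms by (auto simp: labellings_def Gamma_iff)
qed

lemma char_eval_Nil: "char_eval [] [] = 1"
  by (simp add: char_eval_def)

lemma char_eval_Cons: "char_eval (x # \<alpha>) (y # p) = snd x (snd y) * char_eval \<alpha> p"
  by (simp add: char_eval_def prod.lessThan_Suc_shift del: prod.lessThan_Suc)

lemma cprod_char_log_expand:
  "char_prod G \<alpha> w = (\<Sum>p\<in>labellings G \<alpha>. cnj (char_eval \<alpha> p) * cprod (map log_part p) w)"
proof (induction \<alpha> arbitrary: w)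
  case Nil
  then show ?case by (simp add: labellings_Nil char_eval_Nil)
next
  case (Cons x \<alpha>)
  let ?T = "\<lambda>i g p. cnj (snd x g) * cnj (char_eval \<alpha> p) * (log_part (fst x, g) (take i w) * cprod (map log_part p) (drop i w))"
  have "char_prod G (x # \<alpha>) w = (\<Sum>i\<le>length w. \<Sum>g\<in>carrier G. \<Sum>p\<in>labellings G \<alpha>. ?T i g p)"
    by (simp add: conv_sum Cons char_log_def sum_product mult_ac)
  also have "\<dots> = (\<Sum>g\<in>carrier G. \<Sum>i\<le>length w. \<Sum>p\<in>labellings G \<alpha>. ?T i g p)"
    by (rule sum.swap)
  also have "\<dots> = (\<Sum>g\<in>carrier G. \<Sum>p\<in>labellings G \<alpha>. \<Sum>i\<le>length w. ?T i g p)"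
    by (intro sum.cong refl sum.swap)
  also have "\<dots> = (\<Sum>p\<in>labellings G (x # \<alpha>). cnj (char_eval (x # \<alpha>) p) * cprod (map log_part p) w)"
    by (simp add: sum_labellings_Cons char_eval_Cons conv_sum sum_distrib_left)
  finally show ?case .
qed

lemma char_eval_orthogonality:
  assumes G: "comm_group G" "finite (carrier G)"
  shows "map fst \<alpha> = map fst \<beta> \<Longrightarrow> snd ` set \<alpha> \<subseteq> characters G \<Longrightarrow> snd ` set \<beta> \<subseteq> characters G \<Longrightarrow>
    (\<Sum>p\<in>labellings G \<beta>. char_eval \<beta> p * cnj (char_eval \<alpha> p))
    = (if \<alpha> = \<beta> then of_nat (card (carrier G)) ^ length \<beta> else 0)"
proof (induction \<beta> arbitrary: \<alpha>)
  case Nil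
  then show ?case by (simp add: labellings_Nil char_eval_Nil)
next
  case (Cons y \<beta>)
  then obtain x \<alpha>' where \<alpha>: "\<alpha> = x # \<alpha>'" by (cases \<alpha>) auto
  have "(\<Sum>p\<in>labellings G (y # \<beta>). char_eval (y # \<beta>) p * cnj (char_eval \<alpha> p))
      = (\<Sum>g\<in>carrier G. snd y g * cnj (snd x g)) * (\<Sum>p\<in>labellings G \<beta>. char_eval \<beta> p * cnj (char_eval \<alpha>' p))"
    by (simp add: sum_labellings_Cons \<alpha> char_eval_Cons sum_product mult_ac)
  also have "\<dots> = (if snd y = snd x then of_nat (card (carrier G)) else 0) *
      (if \<alpha>' = \<beta> then of_nat (card (carrier G)) ^ length \<beta> else 0)"
    using Cons.prems \<alpha> by (subst comm_group.character_orthogonality[OF G]) (auto simp: Cons.IH)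
  also have "\<dots> = (if \<alpha> = y # \<beta> then of_nat (card (carrier G)) ^ length (y # \<beta>) else 0)"
    using Cons.prems(1) by (auto simp: \<alpha> prod_eq_iff)
  finally show ?case .
qed

text \<open>Collecting by \<open>p\<close> gives coefficients \<open>b p\<close>, which vanish by
  \<open>cprod_log_part_indep\<close>. Pairing them with the characters of \<beta> isolates a
  nonzero multiple of \<open>c \<beta>\<close>.\<close>

lemma cprod_char_log_indep:
  assumes G: "comm_group G" "finite (carrier G)"
    and z: "\<And>w. w \<in> carrier (wreath n G) \<Longrightarrow>
      (\<Sum>\<alpha>\<in>Gamma n (characters G). c \<alpha> * char_prod G \<alpha> w) = 0"
    and \<beta>: "\<beta> \<in> Gamma n (characters G)"
  shows "c \<beta> = 0"
proof -
  let ?A = "Gamma n (characters G)" and ?\<Gamma> = "Gamma n (carrier G)"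
  have finA: "finite ?A" using finite_Gamma comm_group.finite_characters[OF G] by blast
  have fin: "finite ?\<Gamma>" by (rule finite_Gamma[OF G(2)])
  define b where "b p = (\<Sum>\<alpha>\<in>?A. if map fst p = map fst \<alpha> then c \<alpha> * cnj (char_eval \<alpha> p) else 0)" for p
  have b0: "b p = 0" if "p \<in> ?\<Gamma>" for p
  proof (rule cprod_log_part_indep[OF G(2) _ that])
    fix w assume w: "w \<in> carrier (wreath n G)"
    have "(\<Sum>p\<in>?\<Gamma>. b p * cprod (map log_part p) w)
        = (\<Sum>\<alpha>\<in>?A. \<Sum>p\<in>?\<Gamma>. if map fst p = map fst \<alpha> then c \<alpha> * (cnj (char_eval \<alpha> p) * cprod (map log_part p) w) else 0)"
      unfolding b_def by (subst sum.swap) (auto simp: sum_distrib_right intro!: sum.cong)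
    also have "\<dots> = (\<Sum>\<alpha>\<in>?A. c \<alpha> * char_prod G \<alpha> w)"
    proof (rule sum.cong[OF refl])
      fix \<alpha> assume \<alpha>: "\<alpha> \<in> ?A"
      show "(\<Sum>p\<in>?\<Gamma>. if map fst p = map fst \<alpha> then c \<alpha> * (cnj (char_eval \<alpha> p) * cprod (map log_part p) w) else 0)
          = c \<alpha> * char_prod G \<alpha> w"
        unfolding sum.inter_filter[OF fin, symmetric] labellings_Gamma[OF \<alpha>] cprod_char_log_expand sum_distrib_left ..
    qed
    finally show "(\<Sum>p\<in>?\<Gamma>. b p * cprod (map log_part p) w) = 0" using z[OF w] by simp
  qed
  have "0 = (\<Sum>p\<in>labellings G \<beta>. char_eval \<beta> p * b p)"
    using b0 labellings_Gamma[OF \<beta>, of G] by (intro sum.neutral[symmetric]) auto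
  also have "\<dots> = (\<Sum>\<alpha>\<in>?A. \<Sum>p\<in>labellings G \<beta>.
      if map fst p = map fst \<alpha> then c \<alpha> * (char_eval \<beta> p * cnj (char_eval \<alpha> p)) else 0)"
    unfolding b_def sum_distrib_left by (subst sum.swap) (auto intro!: sum.cong)
  also have "\<dots> = (\<Sum>\<alpha>\<in>?A. if \<alpha> = \<beta> then c \<beta> * of_nat (card (carrier G)) ^ length \<beta> else 0)"
  proof (rule sum.cong[OF refl])
    fix \<alpha> assume \<alpha>: "\<alpha> \<in> ?A"
    show "(\<Sum>p\<in>labellings G \<beta>. if map fst p = map fst \<alpha> then c \<alpha> * (char_eval \<beta> p * cnj (char_eval \<alpha> p)) else 0)
        = (if \<alpha> = \<beta> then c \<beta> * of_nat (card (carrier G)) ^ length \<beta> else 0)"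
    proof (cases "map fst \<alpha> = map fst \<beta>")
      case True
      then have "(\<Sum>p\<in>labellings G \<beta>. if map fst p = map fst \<alpha> then c \<alpha> * (char_eval \<beta> p * cnj (char_eval \<alpha> p)) else 0)
          = c \<alpha> * (\<Sum>p\<in>labellings G \<beta>. char_eval \<beta> p * cnj (char_eval \<alpha> p))"
        unfolding sum_distrib_left by (intro sum.cong) (auto simp: labellings_def)
      then show ?thesis
        using char_eval_orthogonality[OF G True] \<alpha> \<beta> by (simp add: Gamma_iff)
    next
      case False
      then show ?thesis by (auto simp: labellings_def intro!: sum.neutral)
    qed
  qed
  also have "\<dots> = c \<beta> * of_nat (card (carrier G)) ^ length \<beta>"
    using finA \<beta> by simp
  moreover have "card (carrier G) \<noteq> 0"
  proof -
    interpret comm_group G by fact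
    show ?thesis using G(2) by auto
  qed
  ultimately show ?thesis by simp
qed

section \<open>Decomposition of the identity\<close>

definition compositions :: "nat \<Rightarrow> nat \<Rightarrow> 'l set \<Rightarrow> (nat \<times> 'l) list set" where
  "compositions l m L = {\<alpha> \<in> Gamma m L. length \<alpha> = l}"

lemma compositions_0: "compositions 0 m L = (if m = 0 then {[]} else {})"
  by (auto simp: compositions_def Gamma_iff)

lemma compositions_Suc:
  "compositions (Suc l) m L = (\<lambda>(x, \<alpha>). x # \<alpha>) ` (SIGMA x:{1..m} \<times> L. compositions l (m - fst x) L)"
proof (intro equalityI subsetI)
  fix \<beta> assume "\<beta> \<in> compositions (Suc l) m L"
  then obtain x \<alpha> where "\<beta> = x # \<alpha>" "x \<in> {1..m} \<times> L" "\<alpha> \<in> compositions l (m - fst x) L"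
    by (cases \<beta>) (auto simp: compositions_def Gamma_iff mem_Times_iff)
  then show "\<beta> \<in> (\<lambda>(x, \<alpha>). x # \<alpha>) ` (SIGMA x:{1..m} \<times> L. compositions l (m - fst x) L)"
    by (intro image_eqI[of _ _ "(x, \<alpha>)"]) auto
qed (auto simp: compositions_def Gamma_iff image_subset_iff)

text \<open>Summing each factor over all characters leaves |G| times the logarithm labelled by the
  unit; summing over the sizes then reassembles the full logarithm from its homogeneous
  components.\<close>

lemma sum_compositions_cprod:
  assumes G: "comm_group G" "finite (carrier G)"
  shows "(\<Sum>\<alpha>\<in>compositions l (length w) (characters G). char_prod G \<alpha> w)
    = of_nat (card (carrier G)) ^ l * convpow (clog (inc_ind \<one>\<^bsub>G\<^esub>)) l w"
proof (induction l arbitrary: w)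
  case 0
  then show ?case by (simp add: compositions_0 counit_def)
next
  case (Suc l)
  interpret comm_group G by fact
  let ?C = "characters G" and ?N = "of_nat (card (carrier G)) :: complex"
  have finC: "finite ?C" by (rule finite_characters[OF G(2)])
  have fin: "finite (compositions l m ?C)" for m
    using finite_Gamma[OF finC, of m] by (simp add: compositions_def)
  have char_log: "(\<Sum>\<phi>\<in>?C. char_log G (i, \<phi>) s) = ?N * log_part (i, \<one>\<^bsub>G\<^esub>) s" for i s
  proof -
    have "(\<Sum>\<phi>\<in>?C. char_log G (i, \<phi>) s) = (\<Sum>g\<in>carrier G. (\<Sum>\<phi>\<in>?C. cnj (\<phi> g)) * log_part (i, g) s)"
      unfolding char_log_def by (subst sum.swap) (simp add: sum_distrib_right)
    also have "\<dots> = (\<Sum>g\<in>carrier G. if g = \<one>\<^bsub>G\<^esub> then ?N * log_part (i, g) s else 0)"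
      by (rule sum.cong) (auto simp: character_dual_orthogonality[OF G(2)])
    also have "\<dots> = ?N * log_part (i, \<one>\<^bsub>G\<^esub>) s" using G(2) by simp
    finally show ?thesis .
  qed
  have "(\<Sum>\<alpha>\<in>compositions (Suc l) (length w) ?C. char_prod G \<alpha> w)
      = (\<Sum>(x, \<alpha>)\<in>(SIGMA x:{1..length w} \<times> ?C. compositions l (length w - fst x) ?C). char_prod G (x # \<alpha>) w)"
    unfolding compositions_Suc by (subst sum.reindex) (auto simp: inj_on_def case_prod_unfold)
  also have "\<dots> = (\<Sum>x\<in>{1..length w} \<times> ?C. \<Sum>\<alpha>\<in>compositions l (length w - fst x) ?C. char_prod G (x # \<alpha>) w)"
    by (rule sum.Sigma[symmetric]) (use finC fin in auto)
  also have "\<dots> = (\<Sum>i\<in>{1..length w}. \<Sum>\<phi>\<in>?C. \<Sum>\<alpha>\<in>compositions l (length w - i) ?C. cprod (map (char_log G) ((i, \<phi>) # \<alpha>)) w)"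
    by (subst sum.cartesian_product') (simp only: fst_conv)
  also have "\<dots> = (\<Sum>i\<in>{1..length w}. ?N ^ Suc l * (clog (inc_ind \<one>\<^bsub>G\<^esub>) (take i w) * convpow (clog (inc_ind \<one>\<^bsub>G\<^esub>)) l (drop i w)))"
  proof (rule sum.cong[OF refl])
    fix i assume i: "i \<in> {1..length w}"
    have "(\<Sum>\<phi>\<in>?C. \<Sum>\<alpha>\<in>compositions l (length w - i) ?C. cprod (map (char_log G) ((i, \<phi>) # \<alpha>)) w)
       = (\<Sum>\<phi>\<in>?C. char_log G (i, \<phi>) (take i w)) * (\<Sum>\<alpha>\<in>compositions l (length (drop i w)) ?C. char_prod G \<alpha> (drop i w))"
      unfolding sum_product
    proof (intro sum.cong)
      fix \<phi> \<alpha>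
      show "cprod (map (char_log G) ((i, \<phi>) # \<alpha>)) w = char_log G (i, \<phi>) (take i w) * char_prod G \<alpha> (drop i w)"
        using cprod_map_append[of fst "char_log G" "[(i, \<phi>)]" \<alpha> w, OF char_log_length] i by simp
    qed simp_all
    also have "\<dots> = ?N ^ Suc l * (clog (inc_ind \<one>\<^bsub>G\<^esub>) (take i w) * convpow (clog (inc_ind \<one>\<^bsub>G\<^esub>)) l (drop i w))"
      unfolding char_log Suc.IH using i by (simp add: log_part_def mult_ac)
    finally show "(\<Sum>\<phi>\<in>?C. \<Sum>\<alpha>\<in>compositions l (length w - i) ?C. cprod (map (char_log G) ((i, \<phi>) # \<alpha>)) w)
       = ?N ^ Suc l * (clog (inc_ind \<one>\<^bsub>G\<^esub>) (take i w) * convpow (clog (inc_ind \<one>\<^bsub>G\<^esub>)) l (drop i w))" .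
  qed
  \<comment> \<open>Parts are positive, but the convolution also has the cut at 0; there the
    logarithm is evaluated on the empty word and vanishes.\<close>
  also have "\<dots> = (\<Sum>i\<le>length w. ?N ^ Suc l * (clog (inc_ind \<one>\<^bsub>G\<^esub>) (take i w) * convpow (clog (inc_ind \<one>\<^bsub>G\<^esub>)) l (drop i w)))"
    by (rule sum.mono_neutral_left) (auto simp: not_le)
  also have "\<dots> = ?N ^ Suc l * convpow (clog (inc_ind \<one>\<^bsub>G\<^esub>)) (Suc l) w"
    by (simp add: conv_sum sum_distrib_left)
  finally show ?case .
qed

lemma inc_ind_one:
  assumes "w \<in> carrier (wreath n G)"
  shows "inc_ind \<one>\<^bsub>G\<^esub> w = of_bool (w = \<one>\<^bsub>wreath n G\<^esub>)"
proof -
  have "incr \<one>\<^bsub>G\<^esub> w \<longleftrightarrow> w = map (\<lambda>i. (i, \<one>\<^bsub>G\<^esub>)) [1..<Suc n]"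
  proof
    assume w: "incr \<one>\<^bsub>G\<^esub> w"
    have "map fst w = [1..<Suc n]"
      by (rule sorted_distinct_set_unique) (use w assms in \<open>auto simp: incr_def strict_sorted_iff wreath_carrier_iff
        atLeastLessThanSuc_atLeastAtMost simp del: upt_Suc\<close>)
    moreover have "w = map (\<lambda>i. (i, \<one>\<^bsub>G\<^esub>)) (map fst w)"
      using w by (auto simp: incr_def intro!: map_idI[symmetric])
    ultimately show "w = map (\<lambda>i. (i, \<one>\<^bsub>G\<^esub>)) [1..<Suc n]" by metis
  next
    assume "w = map (\<lambda>i. (i, \<one>\<^bsub>G\<^esub>)) [1..<Suc n]"
    then show "incr \<one>\<^bsub>G\<^esub> w" by (auto simp: incr_def o_def simp del: upt_Suc)
  qed
  then show ?thesis by (simp add: inc_ind_def wreath_def)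
qed

lemma length_le_Gamma: "\<alpha> \<in> Gamma n L \<Longrightarrow> length \<alpha> \<le> n"
proof -
  have "positive \<alpha> \<Longrightarrow> length \<alpha> \<le> sum_list (map fst \<alpha>)" for \<alpha> :: "(nat \<times> 'a) list" by (induction \<alpha>) auto
  then show "\<alpha> \<in> Gamma n L \<Longrightarrow> length \<alpha> \<le> n" by (auto simp: Gamma_iff)
qed

text \<open>This is exp(log A) = A for the indicator A of increasing words labelled by the unit,
  grouped by the number of parts.\<close>

lemma sum_Gamma_cprod:
  assumes G: "comm_group G" "finite (carrier G)" and w: "w \<in> carrier (wreath n G)"
  shows "(\<Sum>\<alpha>\<in>Gamma n (characters G). char_prod G \<alpha> w / (of_nat (card (carrier G)) ^ length \<alpha> * fact (length \<alpha>)))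
     = of_bool (w = \<one>\<^bsub>wreath n G\<^esub>)"
proof -
  interpret comm_group G by fact
  let ?C = "characters G" and ?N = "of_nat (card (carrier G)) :: complex"
  have N: "?N \<noteq> 0" using G(2) by auto
  have fin: "finite (Gamma n ?C)" by (rule finite_Gamma[OF finite_characters[OF G(2)]])
  have "(\<Sum>\<alpha>\<in>Gamma n ?C. char_prod G \<alpha> w / (?N ^ length \<alpha> * fact (length \<alpha>)))
      = (\<Sum>l\<le>n. \<Sum>\<alpha>\<in>{\<alpha> \<in> Gamma n ?C. length \<alpha> = l}. char_prod G \<alpha> w / (?N ^ length \<alpha> * fact (length \<alpha>)))"
    by (rule sum.group[symmetric]) (use fin length_le_Gamma in auto)
  also have "\<dots> = (\<Sum>l\<le>n. (\<Sum>\<alpha>\<in>compositions l n ?C. char_prod G \<alpha> w) / (?N ^ l * fact l))"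
    unfolding sum_divide_distrib by (intro sum.cong) (auto simp: compositions_def)
  also have "\<dots> = (\<Sum>l\<le>length w. convpow (clog (inc_ind \<one>\<^bsub>G\<^esub>)) l w / fact l)"
    using sum_compositions_cprod[OF G, of w] N wreath_length[OF w] by simp
  also have "\<dots> = inc_ind \<one>\<^bsub>G\<^esub> w"
    by (rule exp_clog[symmetric]) simp
  finally show ?thesis using inc_ind_one[OF w] by simp
qed

section \<open>Linear algebra in the group algebra and in \<open>MR\<close>\<close>

lemma module_scale: "module scale"
  by (unfold_locales) (auto simp: scale_def fun_eq_iff algebra_simps)

interpretation ga: module scale
  by (rule module_scale)

lemma scale_apply: "scale c f x = c * f x"
  by (simp add: scale_def)

lemma gmult_cong:
  "(\<And>u. u \<in> carrier (wreath n G) \<Longrightarrow> x u = x' u) \<Longrightarrow> (\<And>u. u \<in> carrier (wreath n G) \<Longrightarrow> y u = y' u) \<Longrightarrow>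
    gmult n G x y w = gmult n G x' y' w"
  unfolding gmult_apply by (intro sum.cong refl) simp

lemma gmult_add_left: "gmult n G (x + x') y = gmult n G x y + gmult n G x' y"
  by (simp add: fun_eq_iff gmult_apply algebra_simps sum.distrib)

lemma gmult_add_right: "gmult n G x (y + y') = gmult n G x y + gmult n G x y'"
  by (simp add: fun_eq_iff gmult_apply algebra_simps sum.distrib)

lemma gmult_scale_left: "gmult n G (scale c x) y = scale c (gmult n G x y)"
  by (simp add: fun_eq_iff gmult_apply scale_apply sum_distrib_left mult.assoc)

lemma gmult_scale_right: "gmult n G x (scale c y) = scale c (gmult n G x y)"
  by (simp add: fun_eq_iff gmult_apply scale_apply sum_distrib_left mult_ac)

lemma gmult_zero_left: "gmult n G 0 y = 0"
  by (simp add: fun_eq_iff gmult_apply)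

lemma gmult_zero_right: "gmult n G x 0 = 0"
  by (simp add: fun_eq_iff gmult_apply)

lemma gmult_sum_left: "gmult n G (\<Sum>i\<in>I. f i) y = (\<Sum>i\<in>I. gmult n G (f i) y)"
  by (induction I rule: infinite_finite_induct) (simp_all only: sum.infinite sum.empty sum.insert gmult_zero_left gmult_add_left simp_thms)

lemma subspace_gmult_eq: "ga.subspace {y. gmult n G x y = gmult n G x' y}"
  by (rule ga.subspaceI) (simp_all add: gmult_zero_right gmult_add_right gmult_scale_right)

lemma gmult_outside:
  assumes "group G" "w \<notin> carrier (wreath n G)"
  shows "gmult n G x y w = 0"
  unfolding gmult_apply using wmult_closed[OF assms(1)] assms(2) by (intro sum.neutral ballI) auto

lemma wmult_one:
  assumes "group G" "v \<in> carrier (wreath n G)"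
  shows "wmult G \<one>\<^bsub>wreath n G\<^esub> v = v"
proof -
  interpret group G by fact
  have "(fst (\<one>\<^bsub>wreath n G\<^esub> ! (t - 1)), snd (\<one>\<^bsub>wreath n G\<^esub> ! (t - 1)) \<otimes>\<^bsub>G\<^esub> h) = (t, h)" if "(t, h) \<in> set v" for t h
  proof -
    have "t \<in> {1..n}" "h \<in> carrier G"
      using that assms(2) unfolding wreath_carrier_iff by force+
    then obtain i where "t = Suc i" "i < n" by (cases t) auto
    then show ?thesis using \<open>h \<in> carrier G\<close> by (simp add: wreath_def nth_upt del: upt_Suc)
  qed
  then show ?thesis unfolding wmult_def by (intro map_idI) auto
qed

lemma one_wreath:
  assumes "group G"
  shows "\<one>\<^bsub>wreath n G\<^esub> \<in> carrier (wreath n G)"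
proof -
  interpret group G by fact
  have "map fst \<one>\<^bsub>wreath n G\<^esub> = [1..<Suc n]"
    by (simp add: wreath_def o_def del: upt_Suc)
  moreover have "[1..<Suc n] \<in> permutations_of_set {1..n}"
    by (auto simp: permutations_of_set_def simp del: upt_Suc)
  moreover have "snd ` set \<one>\<^bsub>wreath n G\<^esub> \<subseteq> carrier G"
    by (auto simp: wreath_def simp del: upt_Suc)
  ultimately show ?thesis by (simp add: wreath_def del: upt_Suc)
qed

lemma gmult_one_left:
  assumes G: "group G" "finite (carrier G)" and y: "\<And>w. w \<notin> carrier (wreath n G) \<Longrightarrow> y w = 0"
  shows "gmult n G (basis_elt \<one>\<^bsub>wreath n G\<^esub>) y = y"
proof
  fix w
  let ?W = "carrier (wreath n G)"
  have fin: "finite ?W" by (rule finite_wreath[OF G(2)])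
  have "gmult n G (basis_elt \<one>\<^bsub>wreath n G\<^esub>) y w
      = (\<Sum>u\<in>{\<one>\<^bsub>wreath n G\<^esub>}. \<Sum>v\<in>?W. basis_elt \<one>\<^bsub>wreath n G\<^esub> u * y v * of_bool (wmult G u v = w))"
    unfolding gmult_apply
    by (rule sum.mono_neutral_right) (use fin one_wreath[OF G(1)] in \<open>auto simp: basis_elt_def\<close>)
  also have "\<dots> = (\<Sum>v\<in>?W. if v = w then y v else 0)"
    by (auto simp: basis_elt_def wmult_one[OF G(1)] intro!: sum.cong)
  also have "\<dots> = y w" using y fin by simp
  finally show "gmult n G (basis_elt \<one>\<^bsub>wreath n G\<^esub>) y w = y w" .
qed

lemma MR_simps:
  "carrier (MR n G) = ga.span (Y n G ` Gamma n (carrier G))"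
  "monoid.mult (MR n G) = gmult n G" "one (MR n G) = basis_elt \<one>\<^bsub>wreath n G\<^esub>"
  "zero (MR n G) = 0" "add (MR n G) = (+)"
  by (simp_all add: MR_def group_algebra_def)

lemma X_mem_MR: "p \<in> Gamma n (carrier G) \<Longrightarrow> X n G p \<in> carrier (MR n G)"
  unfolding MR_simps X_def by (intro ga.span_sum ga.span_base) auto

text \<open>Inverts the unitriangular definition of \<open>X\<close>: all \<open>q\<close> strictly
  below \<open>p\<close> have fewer parts.\<close>

lemma Y_mem_span_X:
  assumes "finite (carrier G)"
  shows "p \<in> Gamma n (carrier G) \<Longrightarrow> Y n G p \<in> ga.span (X n G ` Gamma n (carrier G))"
proof (induction "length p" arbitrary: p rule: less_induct)
  case less
  let ?S = "{q \<in> Gamma n (carrier G). q \<preceq> p}"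
  have "finite ?S" using finite_Gamma[OF assms] by simp
  then have "X n G p = Y n G p + (\<Sum>q\<in>?S - {p}. Y n G q)"
    unfolding X_def using less.prems by (intro sum.remove) (auto simp: refines_refl)
  then have "Y n G p = X n G p - (\<Sum>q\<in>?S - {p}. Y n G q)" by simp
  also have "\<dots> \<in> ga.span (X n G ` Gamma n (carrier G))"
  proof (intro ga.span_diff ga.span_sum)
    fix q assume q: "q \<in> ?S - {p}"
    then have "length q < length p"
      using refines_length_eq[of q p] by (auto simp: Gamma_iff not_less[symmetric])
    then show "Y n G q \<in> ga.span (X n G ` Gamma n (carrier G))" using less.hyps q by blast
  qed (use less.prems in \<open>auto intro: ga.span_base\<close>)
  finally show ?case .
qed

lemma MR_span_X:
  assumes "finite (carrier G)"
  shows "carrier (MR n G) \<subseteq> ga.span (X n G ` Gamma n (carrier G))"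
  unfolding MR_simps using Y_mem_span_X[OF assms] by (intro ga.span_minimal ga.subspace_span) auto

lemma MR_outside:
  assumes "finite (carrier G)" "x \<in> carrier (MR n G)" "w \<notin> carrier (wreath n G)"
  shows "x w = 0"
proof -
  have "ga.subspace {x. x w = 0}" by (rule ga.subspaceI) (auto simp: scale_apply)
  moreover have "Y n G ` Gamma n (carrier G) \<subseteq> {x. x w = 0}"
    using assms(3) by (auto simp: Y_apply[OF assms(1)])
  ultimately have "carrier (MR n G) \<subseteq> {x. x w = 0}"
    unfolding MR_simps by (intro ga.span_minimal)
  then show ?thesis using assms(2) by auto
qed

text \<open>The twisted products are functionals on all words and need not vanish outside the wreath
  product, so the support condition is imposed separately and the combination is required on the
  wreath product only.\<close>

definition Mspan :: "nat \<Rightarrow> ('g, 'm) monoid_scheme \<Rightarrow> (nat \<times> ('g \<Rightarrow> complex)) multiset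
    \<Rightarrow> ((nat \<times> 'g) list \<Rightarrow> complex) set" where
  "Mspan n G M = {x. (\<forall>w. w \<notin> carrier (wreath n G) \<longrightarrow> x w = 0) \<and>
     x \<in> combs (carrier (wreath n G)) {\<alpha>. mset \<alpha> = M} (\<lambda>\<alpha>. char_prod G \<alpha>)}"

lemma Mspan_add: "x \<in> Mspan n G M \<Longrightarrow> y \<in> Mspan n G M \<Longrightarrow> x + y \<in> Mspan n G M"
  unfolding Mspan_def by (auto simp: plus_fun_def intro!: combs_add)

lemma Mspan_scale: "x \<in> Mspan n G M \<Longrightarrow> scale c x \<in> Mspan n G M"
  unfolding Mspan_def by (auto simp: scale_def intro!: combs_cmult)

lemma Mspan_zero: "0 \<in> Mspan n G M"
  unfolding Mspan_def by (auto simp: zero_fun_def combs_zero)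

lemma Mspan_diff: "x \<in> Mspan n G M \<Longrightarrow> y \<in> Mspan n G M \<Longrightarrow> x - y \<in> Mspan n G M"
  using Mspan_add[of x n G M "scale (-1) y"] Mspan_scale[of y n G M "-1"]
  by (simp add: scale_def fun_diff_def plus_fun_def)

lemma Lambda_eq: "Lambda n L = mset ` Gamma n L"
proof (intro equalityI subsetI)
  fix M assume M: "M \<in> Lambda n L"
  obtain \<alpha> where \<alpha>: "mset \<alpha> = M" using ex_mset by blast
  then have "\<alpha> \<in> Gamma n L" using M
    by (auto simp: Lambda_def Gamma_def sum_mset_sum_list simp flip: mset_map)
  then show "M \<in> mset ` Gamma n L" using \<alpha> by blast
qed (auto simp: Lambda_def Gamma_def sum_mset_sum_list simp flip: mset_map)

lemma mset_Lambda: "M \<in> Lambda n L \<Longrightarrow> mset \<alpha> = M \<Longrightarrow> \<alpha> \<in> Gamma n L"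
  by (auto simp: Lambda_def Gamma_def sum_mset_sum_list simp flip: mset_map)

lemma Mspan_gmult_X:
  assumes G: "comm_group G" "finite (carrier G)" and M: "M \<in> Lambda n (characters G)"
    and x: "x \<in> Mspan n G M" and p: "p \<in> Gamma n (carrier G)"
  shows "gmult n G x (X n G p) \<in> Mspan n G M"
proof -
  interpret comm_group G by fact
  let ?W = "carrier (wreath n G)" and ?A = "{\<alpha>. mset \<alpha> = M}"
  obtain c where c: "\<And>w. w \<in> ?W \<Longrightarrow> x w = (\<Sum>\<alpha>\<in>?A. c \<alpha> * char_prod G \<alpha> w)"
    using x unfolding Mspan_def combs_def by blast
  have "gmult n G x (X n G p) w = (\<Sum>\<alpha>\<in>?A. c \<alpha> * seg_sum G p (char_prod G \<alpha>) w)" if w: "w \<in> ?W" for w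
  proof -
    have "gmult n G x (X n G p) w = gmult n G (\<lambda>w. \<Sum>\<alpha>\<in>?A. c \<alpha> * char_prod G \<alpha> w) (X n G p) w"
      by (rule gmult_cong) (auto simp: c)
    then show ?thesis
      using w by (simp add: gmult_X[OF is_group G(2) p] seg_sum_sum seg_sum_cmult)
  qed
  moreover have "seg_sum G p (char_prod G \<alpha>) \<in> combs ?W ?A (\<lambda>\<alpha>. char_prod G \<alpha>)" if "\<alpha> \<in> ?A" for \<alpha>
  proof -
    have \<alpha>: "mset \<alpha> = M" "\<alpha> \<in> Gamma n (characters G)" using that mset_Lambda[OF M] by auto
    have "seg_sum G p (char_prod G \<alpha>) \<in> combs (Words G) {\<beta>. mset \<beta> = mset \<alpha>} (\<lambda>\<beta>. char_prod G \<beta>)"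
    proof (rule seg_sum_cprod_combs[where sz = fst and \<chi> = snd])
      fix y h s assume "y \<in> set \<alpha>" "h \<in> snd ` set p" "s \<in> Words G"
      moreover have "snd y \<in> characters G" "h \<in> carrier G"
        using \<alpha>(2) p \<open>y \<in> set \<alpha>\<close> \<open>h \<in> snd ` set p\<close> by (auto simp: Gamma_iff image_subset_iff)
      ultimately show "char_log G y (untwist G h s) = snd y h * char_log G y s" by (intro char_log_untwist[OF G])
    qed (simp_all add: char_log_length primitive_char_log)
    then show ?thesis using wreath_Words[of _ n G] unfolding combs_def \<alpha>(1) by blast
  qed
  then have "(\<lambda>w. \<Sum>\<alpha>\<in>?A. c \<alpha> * seg_sum G p (char_prod G \<alpha>) w) \<in> combs ?W ?A (\<lambda>\<alpha>. char_prod G \<alpha>)"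
    by (intro combs_sum combs_cmult)
  ultimately have "gmult n G x (X n G p) \<in> combs ?W ?A (\<lambda>\<alpha>. char_prod G \<alpha>)"
    by (rule combs_cong[rotated])
  then show ?thesis
    unfolding Mspan_def using gmult_outside[OF is_group] by simp
qed

lemma Mspan_gmult:
  assumes G: "comm_group G" "finite (carrier G)" and M: "M \<in> Lambda n (characters G)"
    and x: "x \<in> Mspan n G M" and y: "y \<in> carrier (MR n G)"
  shows "gmult n G x y \<in> Mspan n G M"
proof -
  have "ga.subspace {y. gmult n G x y \<in> Mspan n G M}"
    by (rule ga.subspaceI)
      (simp_all add: gmult_zero_right gmult_add_right gmult_scale_right Mspan_zero Mspan_add Mspan_scale)
  moreover have "X n G ` Gamma n (carrier G) \<subseteq> {y. gmult n G x y \<in> Mspan n G M}"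
    using Mspan_gmult_X[OF G M x] by auto
  ultimately have "ga.span (X n G ` Gamma n (carrier G)) \<subseteq> {y. gmult n G x y \<in> Mspan n G M}"
    by (intro ga.span_minimal)
  then show ?thesis using MR_span_X[OF G(2), of n] y by blast
qed

lemma Mspan_direct:
  assumes G: "comm_group G" "finite (carrier G)"
    and x: "\<And>M. M \<in> Lambda n (characters G) \<Longrightarrow> x M \<in> Mspan n G M"
    and sum0: "(\<Sum>M\<in>Lambda n (characters G). x M) = 0"
    and M: "M \<in> Lambda n (characters G)"
  shows "x M = 0"
proof -
  let ?W = "carrier (wreath n G)" and ?\<Lambda> = "Lambda n (characters G)" and ?\<Gamma> = "Gamma n (characters G)"
  have fin: "finite ?\<Gamma>" by (rule finite_Gamma[OF comm_group.finite_characters[OF G]])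
  have "\<forall>M\<in>?\<Lambda>. \<exists>c. \<forall>w\<in>?W. x M w = (\<Sum>\<alpha>\<in>{\<alpha>. mset \<alpha> = M}. c \<alpha> * char_prod G \<alpha> w)"
    using x unfolding Mspan_def combs_def by blast
  from bchoice[OF this] obtain c where c: "\<And>M w. M \<in> ?\<Lambda> \<Longrightarrow> w \<in> ?W \<Longrightarrow>
      x M w = (\<Sum>\<alpha>\<in>{\<alpha>. mset \<alpha> = M}. c M \<alpha> * char_prod G \<alpha> w)"
    by (elim exE) blast
  have set_eq: "{\<alpha>. mset \<alpha> = M} = {\<alpha> \<in> ?\<Gamma>. mset \<alpha> = M}" if "M \<in> ?\<Lambda>" for M
    using mset_Lambda[OF that] by auto
  \<comment> \<open>The possible supports partition the compositions \<alpha>, so the coefficients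
    of all components merge into a single family to which independence applies.\<close>
  have "c (mset \<alpha>) \<alpha> = 0" if \<alpha>: "\<alpha> \<in> ?\<Gamma>" for \<alpha>
  proof (rule cprod_char_log_indep[OF G _ \<alpha>])
    fix w assume w: "w \<in> ?W"
    have "(\<Sum>\<alpha>\<in>?\<Gamma>. c (mset \<alpha>) \<alpha> * char_prod G \<alpha> w)
        = (\<Sum>M\<in>?\<Lambda>. \<Sum>\<alpha>\<in>{\<alpha> \<in> ?\<Gamma>. mset \<alpha> = M}. c (mset \<alpha>) \<alpha> * char_prod G \<alpha> w)"
      by (rule sum.group[symmetric]) (use fin in \<open>auto simp: Lambda_eq\<close>)
    also have "\<dots> = (\<Sum>M\<in>?\<Lambda>. x M w)"
      by (rule sum.cong[OF refl]) (simp add: c[OF _ w] set_eq)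
    also have "\<dots> = 0" using sum0 by (metis sum_fun_apply zero_fun_def)
    finally show "(\<Sum>\<alpha>\<in>?\<Gamma>. c (mset \<alpha>) \<alpha> * char_prod G \<alpha> w) = 0" .
  qed
  then have "c M \<alpha> = 0" if "mset \<alpha> = M" for \<alpha> using mset_Lambda[OF M that] that by auto
  then have "x M w = 0" if "w \<in> ?W" for w using c[OF M that] by simp
  moreover have "x M w = 0" if "w \<notin> ?W" for w using x[OF M] that by (simp add: Mspan_def)
  ultimately show ?thesis by (auto simp: fun_eq_iff)
qed

section \<open>The elements f: products, sum and primitivity\<close>

lemma f_elt_span:
  assumes "finite (carrier G)" and M: "M \<in> Lambda n (characters G)"
  shows "f_elt n G M \<in> ga.span (X n G ` {q \<in> Gamma n (carrier G). size M \<le> length q})"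
  unfolding f_elt_def
proof (intro ga.span_scale ga.span_sum)
  fix \<alpha> p q
  assume "\<alpha> \<in> {\<alpha> \<in> Gamma n (characters G). mset \<alpha> = M}"
    and "p \<in> {p \<in> Gamma n (carrier G). map fst p = map fst \<alpha>}"
    and "q \<in> {q \<in> Gamma n (carrier G). p \<preceq> q}"
  then have "size M = length p" "length p \<le> length q" "q \<in> Gamma n (carrier G)"
    using refines_length[of p q] by (auto simp: Gamma_iff dest: map_eq_imp_length_eq)
  then show "X n G q \<in> ga.span (X n G ` {q \<in> Gamma n (carrier G). size M \<le> length q})"
    by (auto intro!: ga.span_base)
qed

lemma f_elt_mem_MR:
  assumes "finite (carrier G)" and M: "M \<in> Lambda n (characters G)"
  shows "f_elt n G M \<in> carrier (MR n G)"
proof -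
  have "ga.span (X n G ` {q \<in> Gamma n (carrier G). size M \<le> length q}) \<subseteq> carrier (MR n G)"
    using X_mem_MR unfolding MR_simps by (intro ga.span_minimal ga.subspace_span) (auto simp: MR_simps)
  then show ?thesis using f_elt_span[OF assms] by blast
qed

text \<open>The two inner sums in the definition of f are \<open>char_prod\<close>: the one over
  \<open>q\<close> expands a product of logarithms, the one over \<open>p\<close> is its Fourier
  transform in the labels.\<close>

lemma f_elt_apply:
  assumes G: "comm_group G" "finite (carrier G)" and M: "M \<in> Lambda n (characters G)"
    and w: "w \<in> carrier (wreath n G)"
  shows "f_elt n G M w = 1 / (of_nat (card (carrier G)) ^ size M * fact (size M)) *
    (\<Sum>\<alpha>\<in>{\<alpha>. mset \<alpha> = M}. char_prod G \<alpha> w)"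
proof -
  have "(\<Sum>p\<in>{p \<in> Gamma n (carrier G). map fst p = map fst \<alpha>}. scale (cnj (char_eval \<alpha> p))
         (\<Sum>q\<in>{q \<in> Gamma n (carrier G). p \<preceq> q}.
           scale ((-1) ^ (length q - length p) / of_nat (split_degree q p)) (X n G q))) w
      = char_prod G \<alpha> w" if \<alpha>: "\<alpha> \<in> Gamma n (characters G)" for \<alpha>
  proof -
    have "(\<Sum>q\<in>{q \<in> Gamma n (carrier G). p \<preceq> q}.
        scale ((-1) ^ (length q - length p) / of_nat (split_degree q p)) (X n G q)) w = cprod (map log_part p) w"
      if "p \<in> Gamma n (carrier G)" for p
      using cprod_log_part_X[OF G(2) that w] by (simp add: sum_fun_apply scale_apply refine_coeff_def)
    then show ?thesis
      unfolding sum_fun_apply scale_apply cprod_char_log_expand labellings_Gamma[OF \<alpha>, symmetric]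
      by (intro sum.cong refl) (simp add: sum_fun_apply scale_apply)
  qed
  moreover have "{\<alpha> \<in> Gamma n (characters G). mset \<alpha> = M} = {\<alpha>. mset \<alpha> = M}"
    using mset_Lambda[OF M] by auto
  ultimately show ?thesis
    using mset_Lambda[OF M] by (simp add: f_elt_def scale_apply sum_fun_apply[of _ "{\<alpha>. mset \<alpha> = M}"])
qed

lemma f_elt_mem_Mspan:
  assumes G: "comm_group G" "finite (carrier G)" and M: "M \<in> Lambda n (characters G)"
  shows "f_elt n G M \<in> Mspan n G M"
  unfolding Mspan_def
proof (intro CollectI conjI allI impI)
  show "f_elt n G M w = 0" if "w \<notin> carrier (wreath n G)" for w
    by (rule MR_outside[OF G(2) f_elt_mem_MR[OF G(2) M] that])
  show "f_elt n G M \<in> combs (carrier (wreath n G)) {\<alpha>. mset \<alpha> = M} (\<lambda>\<alpha>. char_prod G \<alpha>)"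
    by (rule combs_cong[OF combs_cmult[OF combs_sum] f_elt_apply[OF G M]])
      (auto intro!: combs_base finite_mset_eq)
qed

lemma finite_Lambda: "comm_group G \<Longrightarrow> finite (carrier G) \<Longrightarrow> finite (Lambda n (characters G))"
  unfolding Lambda_eq by (intro finite_imageI finite_Gamma comm_group.finite_characters)

lemma sum_f_elt:
  assumes G: "comm_group G" "finite (carrier G)"
  shows "(\<Sum>M\<in>Lambda n (characters G). f_elt n G M) = basis_elt \<one>\<^bsub>wreath n G\<^esub>"
proof
  fix w
  interpret comm_group G by fact
  let ?\<Lambda> = "Lambda n (characters G)" and ?\<Gamma> = "Gamma n (characters G)"
  let ?N = "of_nat (card (carrier G)) :: complex"
  show "(\<Sum>M\<in>?\<Lambda>. f_elt n G M) w = basis_elt \<one>\<^bsub>wreath n G\<^esub> w"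
  proof (cases "w \<in> carrier (wreath n G)")
    case True
    have "(\<Sum>M\<in>?\<Lambda>. f_elt n G M) w = (\<Sum>M\<in>?\<Lambda>. \<Sum>\<alpha>\<in>{\<alpha> \<in> ?\<Gamma>. mset \<alpha> = M}.
        char_prod G \<alpha> w / (?N ^ length \<alpha> * fact (length \<alpha>)))"
      unfolding sum_fun_apply
    proof (rule sum.cong[OF refl])
      fix M assume M: "M \<in> ?\<Lambda>"
      have "{\<alpha> \<in> ?\<Gamma>. mset \<alpha> = M} = {\<alpha>. mset \<alpha> = M}" using mset_Lambda[OF M] by auto
      then show "f_elt n G M w = (\<Sum>\<alpha>\<in>{\<alpha> \<in> ?\<Gamma>. mset \<alpha> = M}.
          char_prod G \<alpha> w / (?N ^ length \<alpha> * fact (length \<alpha>)))"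
        unfolding f_elt_apply[OF G M True] sum_distrib_left by (auto intro!: sum.cong)
    qed
    also have "\<dots> = (\<Sum>\<alpha>\<in>?\<Gamma>. char_prod G \<alpha> w / (?N ^ length \<alpha> * fact (length \<alpha>)))"
      by (rule sum.group) (auto simp: Lambda_eq finite_Gamma finite_characters G)
    also have "\<dots> = basis_elt \<one>\<^bsub>wreath n G\<^esub> w"
      using sum_Gamma_cprod[OF G True] by (simp add: basis_elt_def)
    finally show ?thesis .
  next
    case False
    have "f_elt n G M w = 0" if "M \<in> ?\<Lambda>" for M
      by (rule MR_outside[OF G(2) f_elt_mem_MR[OF G(2) that] False])
    moreover have "w \<noteq> \<one>\<^bsub>wreath n G\<^esub>" using False one_wreath[OF is_group] by auto
    ultimately show ?thesis by (simp add: sum_fun_apply basis_elt_def)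
  qed
qed

lemma f_elt_orthogonal:
  assumes G: "comm_group G" "finite (carrier G)"
    and M: "M \<in> Lambda n (characters G)" and N: "N \<in> Lambda n (characters G)"
  shows "gmult n G (f_elt n G M) (f_elt n G N) = (if M = N then f_elt n G N else 0)"
proof -
  interpret comm_group G by fact
  let ?\<Lambda> = "Lambda n (characters G)" and ?f = "f_elt n G"
  have f: "?f N \<in> carrier (MR n G)" by (rule f_elt_mem_MR[OF G(2) N])
  \<comment> \<open>The K-component of the sum of all products \<open>f_K f_N\<close> minus
    \<open>f_N\<close>: the right ideal property puts the first term into the span for
    \<open>K\<close>.\<close>
  define x where "x K = gmult n G (?f K) (?f N) - (if K = N then ?f N else 0)" for K
  have "x M = 0"
  proof (rule Mspan_direct[OF G _ _ M])
    show "x K \<in> Mspan n G K" if "K \<in> ?\<Lambda>" for K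
      unfolding x_def
      by (intro Mspan_diff Mspan_gmult[OF G that _ f] f_elt_mem_Mspan[OF G that])
        (use f_elt_mem_Mspan[OF G that] in \<open>auto simp: Mspan_zero\<close>)
    have "(\<Sum>K\<in>?\<Lambda>. x K) = gmult n G (\<Sum>K\<in>?\<Lambda>. ?f K) (?f N) - ?f N"
      using finite_Lambda[OF G] N by (simp add: x_def sum_subtractf gmult_sum_left)
    also have "\<dots> = 0"
      unfolding sum_f_elt[OF G] using gmult_one_left[OF is_group G(2), of n "?f N"] MR_outside[OF G(2) f] by simp
    finally show "(\<Sum>K\<in>?\<Lambda>. x K) = 0" .
  qed
  then show ?thesis by (simp add: x_def)
qed

lemma f_elt_nonzero:
  assumes G: "comm_group G" "finite (carrier G)" and M: "M \<in> Lambda n (characters G)"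
  shows "f_elt n G M \<noteq> 0"
proof
  interpret comm_group G by fact
  let ?\<Gamma> = "Gamma n (characters G)"
  let ?k = "1 / (of_nat (card (carrier G)) ^ size M * fact (size M)) :: complex"
  assume f0: "f_elt n G M = 0"
  obtain \<beta> where \<beta>: "mset \<beta> = M" using ex_mset by blast
  have fin: "finite ?\<Gamma>" by (rule finite_Gamma[OF finite_characters[OF G(2)]])
  have "(if mset \<beta> = M then ?k else 0) = 0"
  proof (rule cprod_char_log_indep[OF G _ mset_Lambda[OF M \<beta>]])
    fix w assume w: "w \<in> carrier (wreath n G)"
    have "(\<Sum>\<alpha>\<in>?\<Gamma>. (if mset \<alpha> = M then ?k else 0) * char_prod G \<alpha> w)
        = (\<Sum>\<alpha>\<in>?\<Gamma>. if mset \<alpha> = M then ?k * char_prod G \<alpha> w else 0)"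
      by (intro sum.cong) auto
    also have "\<dots> = (\<Sum>\<alpha>\<in>{\<alpha> \<in> ?\<Gamma>. mset \<alpha> = M}. ?k * char_prod G \<alpha> w)"
      by (rule sum.inter_filter[symmetric, OF fin])
    also have "{\<alpha> \<in> ?\<Gamma>. mset \<alpha> = M} = {\<alpha>. mset \<alpha> = M}" using mset_Lambda[OF M] by auto
    also have "(\<Sum>\<alpha>\<in>{\<alpha>. mset \<alpha> = M}. ?k * char_prod G \<alpha> w) = f_elt n G M w"
      unfolding f_elt_apply[OF G M w] sum_distrib_left ..
    finally show "(\<Sum>\<alpha>\<in>?\<Gamma>. (if mset \<alpha> = M then ?k else 0) * char_prod G \<alpha> w) = 0"
      using f0 by simp
  qed
  moreover have "card (carrier G) \<noteq> 0" using G(2) by auto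
  ultimately show False using \<beta> by simp
qed

text \<open>
  A commutator of primitives is primitive, and \<open>f\<close> only involves \<open>X\<^sub>q\<close> with at least
  \<open>length \<alpha>\<close> parts, so that products of fewer primitives are annihilated.
\<close>

lemma gmult_cprod_f_elt:
  assumes G: "comm_group G" "finite (carrier G)" and M: "M \<in> Lambda n (characters G)"
    and \<alpha>: "mset \<alpha> = M" "mset \<beta> = M"
  shows "gmult n G (char_prod G \<alpha>) (f_elt n G M) = gmult n G (char_prod G \<beta>) (f_elt n G M)"
proof -
  interpret comm_group G by fact
  let ?S = "X n G ` {q \<in> Gamma n (carrier G). size M \<le> length q}"
  let ?E = "{y. gmult n G (char_prod G \<alpha>) y = gmult n G (char_prod G \<beta>) y}"
  have "?S \<subseteq> ?E"
  proof clarify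
    fix q assume q: "q \<in> Gamma n (carrier G)" "size M \<le> length q"
    have "seg_sum G q (char_prod G \<alpha>) w = seg_sum G q (char_prod G \<beta>) w"
      if w: "w \<in> carrier (wreath n G)" for w
    proof (rule mset_eq_swap_invariant[where F = "\<lambda>\<alpha>. seg_sum G q (char_prod G \<alpha>) w", OF _ \<alpha>])
      fix xs x y ys assume m: "mset (xs @ [x, y] @ ys) = M"
      have "length (map (char_log G) xs @ [char_log G x, char_log G y] @ map (char_log G) ys) \<le> length q"
        using q(2) m[symmetric] by simp
      then have "seg_sum G q (cprod (map (char_log G) xs @ [char_log G x, char_log G y] @ map (char_log G) ys)) w
          = seg_sum G q (cprod (map (char_log G) xs @ [char_log G y, char_log G x] @ map (char_log G) ys)) w"
        using w q(1) by (intro seg_sum_cprod_swap) (auto simp: primitive_char_log wreath_carrier_iff Gamma_iff positive_def)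
      then show "seg_sum G q (char_prod G (xs @ [x, y] @ ys)) w = seg_sum G q (char_prod G (xs @ [y, x] @ ys)) w"
        by simp
    qed
    then show "gmult n G (char_prod G \<alpha>) (X n G q) = gmult n G (char_prod G \<beta>) (X n G q)"
      by (simp add: fun_eq_iff gmult_X[OF is_group G(2) q(1)])
  qed
  then have "ga.span ?S \<subseteq> ?E" by (intro ga.span_minimal subspace_gmult_eq)
  then show ?thesis using f_elt_span[OF G(2) M] by blast
qed

lemma gmult_Mspan_f_elt:
  assumes G: "comm_group G" "finite (carrier G)" and M: "M \<in> Lambda n (characters G)"
    and x: "x \<in> Mspan n G M"
  obtains c where "gmult n G x (f_elt n G M) = scale c (f_elt n G M)"
proof -
  interpret comm_group G by fact
  let ?f = "f_elt n G M" and ?A = "{\<alpha>. mset \<alpha> = M}" and ?W = "carrier (wreath n G)"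
  obtain \<beta> where \<beta>: "mset \<beta> = M" using ex_mset by blast
  define y where "y = gmult n G (char_prod G \<beta>) ?f"
  have comb: "gmult n G z ?f = scale (\<Sum>\<alpha>\<in>?A. c \<alpha>) y"
    if z: "\<And>w. w \<in> ?W \<Longrightarrow> z w = (\<Sum>\<alpha>\<in>?A. c \<alpha> * char_prod G \<alpha> w)" for z c
  proof -
    have "gmult n G z ?f = gmult n G (\<Sum>\<alpha>\<in>?A. scale (c \<alpha>) (char_prod G \<alpha>)) ?f"
      by (rule ext, rule gmult_cong) (auto simp: z sum_fun_apply scale_apply)
    also have "\<dots> = (\<Sum>\<alpha>\<in>?A. scale (c \<alpha>) y)"
      unfolding gmult_sum_left gmult_scale_left y_def
      by (intro sum.cong refl) (use gmult_cprod_f_elt[OF G M _ \<beta>] in auto)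
    also have "\<dots> = scale (\<Sum>\<alpha>\<in>?A. c \<alpha>) y"
      by (simp add: fun_eq_iff sum_fun_apply scale_apply sum_distrib_right)
    finally show ?thesis .
  qed
  define k :: complex where "k = 1 / (of_nat (card (carrier G)) ^ size M * fact (size M))"
  \<comment> \<open>Idempotency of f, with the constant coefficients \<open>k\<close> that express f
    in the spanning products.\<close>
  have "?f = scale (\<Sum>\<alpha>\<in>?A. k) y"
    using comb[of ?f "\<lambda>_. k"] f_elt_apply[OF G M] f_elt_orthogonal[OF G M M]
    by (simp add: k_def sum_distrib_left)
  then obtain m where fy: "?f = scale m y" by blast
  have m: "m \<noteq> 0"
  proof
    assume "m = 0"
    then have "?f = 0" unfolding fy by simp
    then show False using f_elt_nonzero[OF G M] by blast
  qed
  then have y: "y = scale (1 / m) ?f"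
    by (simp add: fy scale_def)
  obtain c where "\<And>w. w \<in> ?W \<Longrightarrow> x w = (\<Sum>\<alpha>\<in>?A. c \<alpha> * char_prod G \<alpha> w)"
    using x unfolding Mspan_def combs_def by blast
  then have "gmult n G x ?f = scale (\<Sum>\<alpha>\<in>?A. c \<alpha>) y" by (rule comb)
  also have "\<dots> = scale ((\<Sum>\<alpha>\<in>?A. c \<alpha>) * (1 / m)) ?f"
    by (subst y) (simp add: scale_def mult.assoc)
  finally show ?thesis by (rule that)
qed

text \<open>For an orthogonal decomposition f = a + b one has a = f a = a f. The first equality puts
  \<open>a\<close> into the right ideal, the second makes it a multiple c f, and idempotency leaves
  c = 0 or c = 1, so that \<open>a\<close> or \<open>b\<close> is zero.\<close>

lemma primitive_idempotent_f_elt: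
  assumes G: "comm_group G" "finite (carrier G)" and M: "M \<in> Lambda n (characters G)"
  shows "primitive_idempotent (MR n G) (f_elt n G M)"
  unfolding primitive_idempotent_def MR_simps(2-5)
proof (intro conjI notI)
  let ?f = "f_elt n G M"
  show "?f \<in> carrier (MR n G)" by (rule f_elt_mem_MR[OF G(2) M])
  show False if "?f = 0" using f_elt_nonzero[OF G M] that by simp
  show "gmult n G ?f ?f = ?f" using f_elt_orthogonal[OF G M M] by simp
  assume "\<exists>a\<in>carrier (MR n G). \<exists>b\<in>carrier (MR n G). a \<noteq> 0 \<and> b \<noteq> 0 \<and> gmult n G a a = a \<and>
      gmult n G b b = b \<and> gmult n G a b = 0 \<and> gmult n G b a = 0 \<and> ?f = a + b"
  then obtain a b where a: "a \<in> carrier (MR n G)" "a \<noteq> 0" "gmult n G a a = a"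
    and b: "b \<noteq> 0" "gmult n G a b = 0" "gmult n G b a = 0" and f: "?f = a + b"
    by blast
  have fa: "gmult n G ?f a = a" and af: "gmult n G a ?f = a"
    unfolding f using a b by (simp_all add: gmult_add_left gmult_add_right)
  have "a \<in> Mspan n G M"
    using Mspan_gmult[OF G M f_elt_mem_Mspan[OF G M] a(1)] fa by simp
  then obtain c where c: "a = scale c ?f"
    using gmult_Mspan_f_elt[OF G M] af by metis
  have "scale (c * c) ?f = gmult n G a a"
    unfolding c gmult_scale_left gmult_scale_right using f_elt_orthogonal[OF G M M] by (simp add: scale_def mult.assoc)
  then have "scale (c * c) ?f = scale c ?f" using a(3) c by simp
  moreover obtain w where "?f w \<noteq> 0" using f_elt_nonzero[OF G M] by (auto simp: fun_eq_iff)
  ultimately have "c * c = c" by (metis mult_cancel_right scale_apply)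
  then have "c = 0 \<or> c = 1" by simp
  then show False
  proof
    assume "c = 0"
    then show False using a(2) c by (simp add: scale_def zero_fun_def)
  next
    assume "c = 1"
    then have "a = ?f" using c by (simp add: scale_def)
    then show False using b(1) f by simp
  qed
qed

lemma abelian_monoid_MR: "abelian_monoid (MR n G)"
  by (rule abelian_monoidI) (auto simp: MR_simps ga.span_add ga.span_zero add_ac)

lemma finsum_MR:
  assumes "finite I" "\<And>i. i \<in> I \<Longrightarrow> x i \<in> carrier (MR n G)"
  shows "(\<Oplus>\<^bsub>MR n G\<^esub>i\<in>I. x i) = (\<Sum>i\<in>I. x i)"
  using assms
proof (induction I)
  case empty
  then show ?case using abelian_monoid.finsum_empty[OF abelian_monoid_MR] by (simp only: MR_simps sum.empty)
next
  case (insert i I)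
  then show ?case
    using abelian_monoid.finsum_insert[OF abelian_monoid_MR, of I i x n G]
    by (auto simp: MR_simps(5) Pi_def)
qed

theorem theorem7p5:
  fixes G :: "('g, 'm) monoid_scheme" and n :: nat
  assumes "comm_group G" and "finite (carrier G)" and "n \<ge> 1"
  shows "complete_primitive_orthogonal_idempotents (MR n G) (Lambda n (characters G)) (f_elt n G)"
  unfolding complete_primitive_orthogonal_idempotents_def
proof (intro conjI ballI impI)
  note G = assms(1,2)
  show "finite (Lambda n (characters G))" by (rule finite_Lambda[OF G])
  show "primitive_idempotent (MR n G) (f_elt n G M)" if "M \<in> Lambda n (characters G)" for M
    by (rule primitive_idempotent_f_elt[OF G that])
  show "f_elt n G M \<otimes>\<^bsub>MR n G\<^esub> f_elt n G N = \<zero>\<^bsub>MR n G\<^esub>"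
    if "M \<in> Lambda n (characters G)" "N \<in> Lambda n (characters G)" "M \<noteq> N" for M N
    using f_elt_orthogonal[OF G that(1,2)] that(3) by (simp add: MR_simps)
  show "(\<Oplus>\<^bsub>MR n G\<^esub>M\<in>Lambda n (characters G). f_elt n G M) = \<one>\<^bsub>MR n G\<^esub>"
    using finsum_MR[OF finite_Lambda[OF G] f_elt_mem_MR[OF G(2)]] sum_f_elt[OF G] by (simp add: MR_simps)
qed

end
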